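(* Let $f=(f_1,\ldots,f_n)$ be an $n$-tuple of formal power series with the radial approximation property and let $M_{\mathcal A(\mathbb B_f)}$ be the set of all characters of the domain algebra $\mathcal A(\mathbb B_f)$. Then the map $$\Psi:\mathbb B_f(\mathbb C)\to M_{\mathcal A(\mathbb B_f)},\qquad \Psi(\lambda):=\Phi_\lambda,$$ is a homeomorphism and $\mathbb B_f(\mathbb C)$ is homeomorphic to the closed unit ball $\overline{\mathbb B}_n$ of $\mathbb C^n$.
   Context: Notation. $\mathbb F_n^+$ is the free semigroup on $g_1,\ldots,g_n$ with identity $g_0$ and length $|\cdot|$. For an $n$-tuple $X$ of elements of a unital algebra, $X_\alpha=X_{i_1}\cdots X_{i_k}$ if $\alpha=g_{i_1}\cdots g_{i_k}$, $X_{g_0}=I$; $[f(X)]_\alpha$ is the corresponding product of $f_1(X),\ldots,f_n(X)$. A tuple $X\in B(\mathcal H)^n$ is viewed as a row operator, so $\|X\|=\|\sum X_iX_i^*\|^{1/2}$; $[B(\mathcal H)^n]_\gamma=\{X:\|X\|<\gamma\}$. A free holomorphic function on $[B(\mathcal H)^n]_\gamma$ is a formal power series $\sum a_\alpha Z_\alpha$ in noncommuting indeterminates (complex coefficients) with radius of convergence $r$, $r^{-1}=\limsup_k(\sum_{|\alpha|=k}|a_\alpha|^2)^{1/2k}$, at least $\gamma$, identified with the map $X\mapsto\sum_k\sum_{|\alpha|=k}a_\alpha X_\alpha$ (norm convergence; $\mathcal H$ separable infinite-dimensional). $H^2_{\bf ball}$ is the Hilbert space of series with $\sum|a_\alpha|^2<\infty$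 (the $Z_\alpha$ being orthonormal). Convergence sets. For an $n$-tuple $f$ of formal power series $f_j=\sum c^{(j)}_\alpha Z_\alpha$ and a Hilbert space $\mathcal H$: $\mathcal C_f^{SOT}(\mathcal H)$ is the set of $X\in B(\mathcal H)^n$ such that each series $f_j(X):=\sum_k\sum_{|\alpha|=k}c^{(j)}_\alpha X_\alpha$ is SOT-convergent; $\mathcal C_f^{rad}(\mathcal H)$ is the set of $X$ such that for some $\delta\in(0,1)$ these series converge in norm at $rX$ for all $r\in(\delta,1)$ and $f_j(X):=\text{SOT-}\lim_{r\to1}f_j(rX)$ exists for each $j$. Model property. $f=(f_1,\ldots,f_n)$ has the model property if one of the following holds. (A) $f$ is an $n$-tuple of noncommutative polynomials for which there is an $n$-tuple $g$ of noncommutative polynomials with $f\circ g=g\circ f=\mathrm{id}$. Then $\{f_\alpha\}$ is a linear basis of $\mathbb C[Z_1,\ldots,Z_n]$ and $\mathbb H^2(f)$ is the completion of $\mathbb C[Z_1,\ldots,Z_n]$ for the inner product $\langle f_\alpha,f_\beta\rangle=\delta_{\alpha\beta}$. (S) $f$ is an $n$-tuple of formal power series with $f(0)=0$, nonzero radius of convergence and $\det J_f(0)\neq0$ ($J_f(0)_{ij}$ is the coefficient of $Z_j$ in $f_i$); $\mathbb H^2(f)$ is the Hilbert space of formal power series $\sum a_\alpha f_\alpha$, $\sum|a_\alpha|^2<\infty$, with $\{f_\alpha\}$ orthonormal; $Z_1,\ldots,Z_n\in\mathbb H^2(f)$; left multiplication $M_{Z_i}$ by $Z_i$ is bounded on $\mathbb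 H^2(f)$; and $M_Z=(M_{Z_1},\ldots,M_{Z_n})$ belongs to $\mathcal C_f^{SOT}(\mathbb H^2(f))$ or $\mathcal C_f^{rad}(\mathbb H^2(f))$ with $f_j(M_Z)=M_{f_j}$ (left multiplication by $f_j$), $j=1,\ldots,n$. (F) $f$ is an $n$-tuple of free holomorphic functions on some $[B(\mathcal H)^n]_\gamma$, $\gamma>0$, with range in $[B(\mathcal H)^n]_1$, such that $G\circ f\not\equiv0$ for every nonzero free holomorphic $G$ on $[B(\mathcal H)^n]_1$; $\mathbb H^2(f)=\{G\circ f:G\in H^2_{\bf ball}\}$ with $\langle F\circ f,G\circ f\rangle=\langle F,G\rangle$; the coordinate functions $Z_1,\ldots,Z_n$ lie in $\mathbb H^2(f)$, left multiplications $M_{Z_i}$ by them are bounded on $\mathbb H^2(f)$, and $M_Z$ is in $\mathcal C_f^{SOT}(\mathbb H^2(f))$ or $\mathcal C_f^{rad}(\mathbb H^2(f))$ with $f_j(M_Z)=M_{f_j}$ for all $j$. In all cases $\{f_\alpha\}_{\alpha\in\mathbb F_n^+}$ is an orthonormal basis of $\mathbb H^2(f)$, and $M_Z$ is called the universal model. Writing $Z_i=\sum_\alpha a^{(i)}_\alpha f_\alpha$ in $\mathbb H^2(f)$, one has $M_{Z_i}f_\beta=\sum_\alpha a^{(i)}_\alpha f_{\alpha\beta}$, and $g_i:=\sum_\alpha a^{(i)}_\alpha Z_\alpha$ defines the inverse $g=(g_1,\ldots,g_n)$ of $f$ with respect to composition. Domain. $X\in B(\mathcal H)^n$ satisfies $g(f(X))=X$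 if $X\in\mathcal C_f^{SOT}(\mathcal H)\cup\mathcal C_f^{rad}(\mathcal H)$ and either (for all $i$) $X_i=\sum_k\sum_{|\alpha|=k}a^{(i)}_\alpha[f(X)]_\alpha$ in the SOT, or (for all $i$) $X_i=\text{SOT-}\lim_{r\to1}\sum_k\sum_{|\alpha|=k}a^{(i)}_\alpha r^{|\alpha|}[f(X)]_\alpha$ (automatic in case (A)). Then $\mathbb B_f(\mathcal H):=\{X\in B(\mathcal H)^n:\ g(f(X))=X,\ \|f(X)\|\le1\}$; $\mathbb B_f(\mathbb C)\subset\mathbb C^n$ is the case $\mathcal H=\mathbb C$. $f$ has the radial approximation property if it has the model property and there is $\delta\in(0,1)$ such that $(rf_1,\ldots,rf_n)$ has the model property for every $r\in(\delta,1]$. $\mathcal A(\mathbb B_f)$ is the norm closure in $B(\mathbb H^2(f))$ of all noncommutative polynomials in $M_{Z_1},\ldots,M_{Z_n}$ and the identity. Characters are (nonzero) multiplicative linear functionals $\mathcal A(\mathbb B_f)\to\mathbb C$, and $M_{\mathcal A(\mathbb B_f)}$ carries the weak$^*$ topology. For $\lambda\in\mathbb B_f(\mathbb C)$ one has $|p(\lambda)|\le\|p(M_Z)\|$ for every polynomial $p$, and $\Phi_\lambda$ is the unique continuous extension to $\mathcal A(\mathbb B_f)$ of $p(M_Z)\mapsto p(\lambda)$; it is a character. *)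

theory Defs
  imports "HOL-Analysis.Analysis"
begin

section \<open>Complex Hilbert spaces\<close>

class chilbert = banach +
  fixes scaleC :: "complex \<Rightarrow> 'a \<Rightarrow> 'a" (infixr "*\<^sub>C" 75)
    and cinner :: "'a \<Rightarrow> 'a \<Rightarrow> complex"
  assumes scaleC_add_right: "c *\<^sub>C (x + y) = c *\<^sub>C x + c *\<^sub>C y"
    and scaleC_add_left: "(c + d) *\<^sub>C x = c *\<^sub>C x + d *\<^sub>C x"
    and scaleC_scaleC: "c *\<^sub>C d *\<^sub>C x = (c * d) *\<^sub>C x"
    and scaleC_of_real: "of_real r *\<^sub>C x = r *\<^sub>R x"
    and cinner_add_left: "cinner (x + y) z = cinner x z + cinner y z"
    and cinner_scaleC_left: "cinner (c *\<^sub>C x) y = c * cinner x y"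
    and cinner_commute: "cinner x y = cnj (cinner y x)"
    and cinner_norm: "cinner x x = of_real ((norm x)\<^sup>2)"

lemma norm_scaleC: "norm (c *\<^sub>C (x :: 'a :: chilbert)) = cmod c * norm x"
proof -
  have "complex_of_real ((norm (c *\<^sub>C x))\<^sup>2) = c * cinner x (c *\<^sub>C x)"
    by (simp only: cinner_norm [symmetric] cinner_scaleC_left)
  also have "cinner x (c *\<^sub>C x) = cnj c * cinner x x"
    by (metis cinner_commute cinner_scaleC_left complex_cnj_mult)
  also have "c * (cnj c * cinner x x) = of_real ((cmod c * norm x)\<^sup>2)"
    by (simp add: cinner_norm power_mult_distrib mult.assoc [symmetric]
        complex_norm_square [symmetric] del: of_real_power)
  finally have "(norm (c *\<^sub>C x))\<^sup>2 = (cmod c * norm x)\<^sup>2"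
    using of_real_eq_iff by blast
  then show ?thesis by simp
qed

lemma bounded_linear_scaleC: "bounded_linear (\<lambda>x :: 'a :: chilbert. c *\<^sub>C x)"
proof (rule bounded_linear_intro [where K = "cmod c"])
  fix r :: real and x :: 'a
  show "c *\<^sub>C (r *\<^sub>R x) = r *\<^sub>R (c *\<^sub>C x)"
    by (simp add: scaleC_of_real [symmetric] scaleC_scaleC mult.commute)
qed (simp_all add: scaleC_add_right norm_scaleC)

instantiation complex :: chilbert
begin
definition scaleC_complex :: "complex \<Rightarrow> complex \<Rightarrow> complex" where "scaleC_complex = (*)"
definition cinner_complex :: "complex \<Rightarrow> complex \<Rightarrow> complex" where "cinner_complex x y = x * cnj y"
instance
proof
  fix x y z c d :: complex and r :: real
  show "cinner x x = of_real ((norm x)\<^sup>2)"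
    by (simp only: cinner_complex_def complex_norm_square)
qed (simp_all add: scaleC_complex_def cinner_complex_def ring_distribs scaleR_conv_of_real
    mult_ac)
end

typedef 'a ell2 = "{x :: 'a \<Rightarrow> complex. (\<lambda>i. (cmod (x i))\<^sup>2) summable_on UNIV}"
  morphisms coord Abs_ell2
  by (rule exI [where x = "\<lambda>_. 0"]) simp

definition ell2_seq :: "('a \<Rightarrow> complex) \<Rightarrow> bool" where
  "ell2_seq x \<longleftrightarrow> (\<lambda>i. (cmod (x i))\<^sup>2) summable_on UNIV"

definition ell2_norm :: "('a \<Rightarrow> complex) \<Rightarrow> real" where
  "ell2_norm x = sqrt (infsum (\<lambda>i. (cmod (x i))\<^sup>2) UNIV)"

lemma ell2_norm_nonneg: "0 \<le> ell2_norm x"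
  by (simp add: ell2_norm_def infsum_nonneg)

lemma L2_set_le_ell2_norm:
  assumes "ell2_seq x" "finite F"
  shows "L2_set (\<lambda>i. cmod (x i)) F \<le> ell2_norm x"
  unfolding L2_set_def ell2_norm_def real_sqrt_le_iff
  using assms by (intro finite_sum_le_infsum) (auto simp: ell2_seq_def)

lemma ell2_bound:
  assumes "\<And>F. finite F \<Longrightarrow> L2_set (\<lambda>i. cmod (x i)) F \<le> B"
  shows "ell2_seq x" "ell2_norm x \<le> B"
proof -
  have B: "0 \<le> B" using assms [of "{}"] by simp
  have *: "(\<Sum>i\<in>F. (cmod (x i))\<^sup>2) \<le> B\<^sup>2" if "finite F" for F
    using assms [OF that] unfolding L2_set_def by (rule sqrt_le_D)
  show s: "ell2_seq x"
    unfolding ell2_seq_def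
    using * by (intro nonneg_bdd_above_summable_on bdd_aboveI2 [where M = "B\<^sup>2"]) simp_all
  have "infsum (\<lambda>i. (cmod (x i))\<^sup>2) UNIV \<le> B\<^sup>2"
    using s * by (intro infsum_le_finite_sums) (auto simp: ell2_seq_def)
  then show "ell2_norm x \<le> B"
    unfolding ell2_norm_def using B by (intro real_le_lsqrt)
qed

lemma ell2_triangle:
  assumes "ell2_seq x" "ell2_seq y"
  shows "ell2_seq (\<lambda>i. x i + y i)" "ell2_norm (\<lambda>i. x i + y i) \<le> ell2_norm x + ell2_norm y"
proof -
  have *: "L2_set (\<lambda>i. cmod (x i + y i)) F \<le> ell2_norm x + ell2_norm y" if "finite F" for F
  proof -
    have "L2_set (\<lambda>i. cmod (x i + y i)) F \<le> L2_set (\<lambda>i. cmod (x i) + cmod (y i)) F"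
      by (rule L2_set_mono) (auto intro: norm_triangle_ineq)
    also have "\<dots> \<le> L2_set (\<lambda>i. cmod (x i)) F + L2_set (\<lambda>i. cmod (y i)) F"
      by (rule L2_set_triangle_ineq)
    also have "\<dots> \<le> ell2_norm x + ell2_norm y"
      by (intro add_mono L2_set_le_ell2_norm assms that)
    finally show ?thesis .
  qed
  show "ell2_seq (\<lambda>i. x i + y i)" "ell2_norm (\<lambda>i. x i + y i) \<le> ell2_norm x + ell2_norm y"
    using ell2_bound [OF *] by auto
qed

lemma ell2_scale:
  assumes "ell2_seq x"
  shows "ell2_seq (\<lambda>i. c * x i)" "ell2_norm (\<lambda>i. c * x i) = cmod c * ell2_norm x"
proof -
  have *: "(cmod (c * x i))\<^sup>2 = (cmod c)\<^sup>2 * (cmod (x i))\<^sup>2" for i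
    by (simp add: norm_mult power_mult_distrib)
  show "ell2_seq (\<lambda>i. c * x i)"
    using assms unfolding ell2_seq_def * by (rule summable_on_cmult_right)
  show "ell2_norm (\<lambda>i. c * x i) = cmod c * ell2_norm x"
    unfolding ell2_norm_def * infsum_cmult_right' by (simp add: real_sqrt_mult)
qed

lemma ell2_inner_summable:
  assumes "ell2_seq x" "ell2_seq y"
  shows "(\<lambda>i. x i * cnj (y i)) summable_on UNIV"
proof -
  have "(\<lambda>i. norm (x i * cnj (y i))) summable_on UNIV"
    using assms
    by - (rule abs_summable_product, simp_all add: ell2_seq_def norm_mult power2_eq_square)
  then show ?thesis by (rule abs_summable_summable)
qed

lemma ell2_seq_coord: "ell2_seq (coord x)"
  using coord [of x] by (simp add: ell2_seq_def)

lemma coord_Abs_ell2: "ell2_seq x \<Longrightarrow> coord (Abs_ell2 x) = x"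
  by (simp add: Abs_ell2_inverse ell2_seq_def)

lemma ell2_coord_le_norm: "cmod (coord x i) \<le> ell2_norm (coord x)"
  using L2_set_le_ell2_norm [OF ell2_seq_coord, of "{i}" x] by simp

instantiation ell2 :: (type) real_normed_vector
begin

definition zero_ell2 :: "'a ell2" where "0 = Abs_ell2 (\<lambda>_. 0)"
definition plus_ell2 :: "'a ell2 \<Rightarrow> 'a ell2 \<Rightarrow> 'a ell2" where
  "x + y = Abs_ell2 (\<lambda>i. coord x i + coord y i)"
definition scaleR_ell2 :: "real \<Rightarrow> 'a ell2 \<Rightarrow> 'a ell2" where
  "r *\<^sub>R x = Abs_ell2 (\<lambda>i. complex_of_real r * coord x i)"
definition uminus_ell2 :: "'a ell2 \<Rightarrow> 'a ell2" where
  "- x = (-1) *\<^sub>R (x :: 'a ell2)"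
definition minus_ell2 :: "'a ell2 \<Rightarrow> 'a ell2 \<Rightarrow> 'a ell2" where
  "x - y = x + - (y :: 'a ell2)"
definition norm_ell2 :: "'a ell2 \<Rightarrow> real" where
  "norm x = ell2_norm (coord x)"
definition sgn_ell2 :: "'a ell2 \<Rightarrow> 'a ell2" where
  "sgn x = inverse (norm x) *\<^sub>R (x :: 'a ell2)"
definition dist_ell2 :: "'a ell2 \<Rightarrow> 'a ell2 \<Rightarrow> real" where
  "dist x y = norm (x - y :: 'a ell2)"
definition uniformity_ell2 :: "('a ell2 \<times> 'a ell2) filter" where
  "uniformity = (INF e\<in>{0 <..}. principal {(x, y). dist x (y :: 'a ell2) < e})"
definition open_ell2 :: "'a ell2 set \<Rightarrow> bool" where
  "open U \<longleftrightarrow> (\<forall>x\<in>U. \<forall>\<^sub>F (x', y) in uniformity. x' = x \<longrightarrow> y \<in> (U :: 'a ell2 set))"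

lemma coord_zero: "coord (0 :: 'a ell2) i = 0"
  by (simp add: zero_ell2_def coord_Abs_ell2 ell2_seq_def)
lemma coord_plus: "coord (x + y :: 'a ell2) i = coord x i + coord y i"
  by (simp add: plus_ell2_def coord_Abs_ell2 ell2_triangle ell2_seq_coord)
lemma coord_scaleR: "coord (r *\<^sub>R x :: 'a ell2) i = of_real r * coord x i"
  by (simp add: scaleR_ell2_def coord_Abs_ell2 ell2_scale ell2_seq_coord)
lemma coord_uminus: "coord (- x :: 'a ell2) i = - coord x i"
  by (simp add: uminus_ell2_def coord_scaleR)
lemma coord_minus: "coord (x - y :: 'a ell2) i = coord x i - coord y i"
  by (simp add: minus_ell2_def coord_plus coord_uminus)

lemmas coord_simps = coord_zero coord_plus coord_scaleR coord_uminus coord_minus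

lemma ell2_eqI: "(\<And>i. coord x i = coord (y :: 'a ell2) i) \<Longrightarrow> x = y"
  using coord_inject by blast

instance
proof
  fix x y z :: "'a ell2" and a b r :: real
  show "x + y + z = x + (y + z)" "x + y = y + x" "0 + x = x" "- x + x = 0" "x - y = x + - y"
    "a *\<^sub>R (x + y) = a *\<^sub>R x + a *\<^sub>R y" "(a + b) *\<^sub>R x = a *\<^sub>R x + b *\<^sub>R x"
    "a *\<^sub>R b *\<^sub>R x = (a * b) *\<^sub>R x" "1 *\<^sub>R x = x"
    by (rule ell2_eqI; simp add: coord_simps algebra_simps)+
  show "dist x y = norm (x - y)" by (rule dist_ell2_def)
  show "sgn x = inverse (norm x) *\<^sub>R x" by (rule sgn_ell2_def)
  show "(uniformity :: ('a ell2 \<times> 'a ell2) filter)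
      = (INF e\<in>{0 <..}. principal {(x, y). dist x y < e})"
    by (rule uniformity_ell2_def)
  show "open U \<longleftrightarrow> (\<forall>x\<in>U. \<forall>\<^sub>F (x', y) in uniformity. x' = x \<longrightarrow> y \<in> U)"
    for U :: "'a ell2 set"
    by (rule open_ell2_def)
  show "norm x = 0 \<longleftrightarrow> x = 0"
  proof
    assume "norm x = 0"
    then have "coord x i = 0" for i
      using ell2_coord_le_norm [of x i] by (simp add: norm_ell2_def)
    then show "x = 0" by (intro ell2_eqI) (simp add: coord_zero)
  next
    assume "x = 0"
    then show "norm x = 0" by (simp add: norm_ell2_def ell2_norm_def coord_zero)
  qed
  show "norm (x + y) \<le> norm x + norm y"
    using ell2_triangle(2) [OF ell2_seq_coord ell2_seq_coord, of x y]
    by (simp add: norm_ell2_def coord_plus [abs_def])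
  show "norm (a *\<^sub>R x) = \<bar>a\<bar> * norm x"
    using ell2_scale(2) [OF ell2_seq_coord, of "of_real a" x]
    by (simp add: norm_ell2_def coord_scaleR [abs_def])
qed

end

instance ell2 :: (type) banach
proof
  fix X :: "nat \<Rightarrow> 'a ell2"
  assume C: "Cauchy X"
  have "Cauchy (\<lambda>n. coord (X n) i)" for i
  proof (rule metric_CauchyI)
    fix e :: real assume "0 < e"
    then obtain N where N: "\<forall>m\<ge>N. \<forall>n\<ge>N. norm (X m - X n) < e"
      using C by (auto simp: Cauchy_def dist_norm)
    have "cmod (coord (X m) i - coord (X n) i) < e" if "m \<ge> N" "n \<ge> N" for m n
      using ell2_coord_le_norm [of "X m - X n" i] N that
      by (fastforce simp: coord_minus norm_ell2_def)
    then show "\<exists>M. \<forall>m\<ge>M. \<forall>n\<ge>M. dist (coord (X m) i) (coord (X n) i) < e"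
      by (auto simp: dist_norm)
  qed
  then have "\<exists>l. (\<lambda>n. coord (X n) i) \<longlonglongrightarrow> l" for i
    by (simp add: Cauchy_convergent_iff convergent_def)
  then obtain l where l: "\<And>i. (\<lambda>n. coord (X n) i) \<longlonglongrightarrow> l i" by metis
  have key: "\<exists>N. \<forall>n\<ge>N. \<forall>F. finite F \<longrightarrow> L2_set (\<lambda>i. cmod (coord (X n) i - l i)) F \<le> e"
    if e: "0 < e" for e
  proof -
    obtain N where N: "\<forall>m\<ge>N. \<forall>n\<ge>N. norm (X m - X n) < e"
      using C e by (auto simp: Cauchy_def dist_norm)
    have "L2_set (\<lambda>i. cmod (coord (X n) i - l i)) F \<le> e" if "n \<ge> N" "finite F" for n F
    proof (rule tendsto_upperbound)
      show "(\<lambda>m. L2_set (\<lambda>i. cmod (coord (X n) i - coord (X m) i)) F)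
          \<longlonglongrightarrow> L2_set (\<lambda>i. cmod (coord (X n) i - l i)) F"
        unfolding L2_set_def by (intro tendsto_intros l)
      have "L2_set (\<lambda>i. cmod (coord (X n) i - coord (X m) i)) F \<le> e" if "m \<ge> N" for m
      proof -
        have "L2_set (\<lambda>i. cmod (coord (X n - X m) i)) F \<le> norm (X n - X m)"
          unfolding norm_ell2_def by (rule L2_set_le_ell2_norm [OF ell2_seq_coord \<open>finite F\<close>])
        with N \<open>n \<ge> N\<close> that show ?thesis by (force simp: coord_minus)
      qed
      then show "\<forall>\<^sub>F m in sequentially. L2_set (\<lambda>i. cmod (coord (X n) i - coord (X m) i)) F \<le> e"
        by (auto simp: eventually_sequentially)
    qed simp
    then show ?thesis by blast
  qed
  have "ell2_seq l"
  proof -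
    obtain N where N: "\<And>F. finite F \<Longrightarrow> L2_set (\<lambda>i. cmod (coord (X N) i - l i)) F \<le> 1"
      using key [of 1] by auto
    have 1: "ell2_seq (\<lambda>i. coord (X N) i - l i)" by (rule ell2_bound [OF N])
    have "ell2_seq (\<lambda>i. coord (X N) i + (-1) * (coord (X N) i - l i))"
      by (intro ell2_triangle ell2_scale ell2_seq_coord 1)
    then show ?thesis by simp
  qed
  then have cl: "coord (Abs_ell2 l) = l" by (rule coord_Abs_ell2)
  have "\<exists>N. \<forall>n\<ge>N. dist (X n) (Abs_ell2 l) < e" if e: "0 < e" for e
  proof -
    obtain N where N: "\<And>n F. n \<ge> N \<Longrightarrow> finite F \<Longrightarrow>
        L2_set (\<lambda>i. cmod (coord (X n) i - l i)) F \<le> e / 2"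
      using key [OF half_gt_zero [OF e]] by metis
    have "norm (X n - Abs_ell2 l) \<le> e / 2" if "n \<ge> N" for n
      using ell2_bound(2) [OF N, OF that] by (simp add: norm_ell2_def coord_minus [abs_def] cl)
    then show ?thesis using e by (force simp: dist_norm)
  qed
  then show "convergent X"
    unfolding convergent_def lim_sequentially by blast
qed

instantiation ell2 :: (type) chilbert
begin

definition scaleC_ell2 :: "complex \<Rightarrow> 'a ell2 \<Rightarrow> 'a ell2" where
  "c *\<^sub>C x = Abs_ell2 (\<lambda>i. c * coord x i)"
definition cinner_ell2 :: "'a ell2 \<Rightarrow> 'a ell2 \<Rightarrow> complex" where
  "cinner x y = infsum (\<lambda>i. coord x i * cnj (coord y i)) UNIV"

lemma coord_scaleC: "coord (c *\<^sub>C x :: 'a ell2) i = c * coord x i"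
  by (simp add: scaleC_ell2_def coord_Abs_ell2 ell2_scale ell2_seq_coord)

instance
proof
  fix x y z :: "'a ell2" and r :: real and c d :: complex
  show "c *\<^sub>C (x + y) = c *\<^sub>C x + c *\<^sub>C y" "(c + d) *\<^sub>C x = c *\<^sub>C x + d *\<^sub>C x"
    "c *\<^sub>C d *\<^sub>C x = (c * d) *\<^sub>C x" "of_real r *\<^sub>C x = r *\<^sub>R x"
    by (rule ell2_eqI; simp add: coord_simps coord_scaleC algebra_simps)+
  show "cinner (x + y) z = cinner x z + cinner y z"
    by (simp add: cinner_ell2_def coord_plus distrib_right infsum_add ell2_inner_summable
        ell2_seq_coord)
  show "cinner (c *\<^sub>C x) y = c * cinner x y"
    by (simp add: cinner_ell2_def coord_scaleC mult.assoc infsum_cmult_right')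
  show "cinner x y = cnj (cinner y x)"
    by (simp add: cinner_ell2_def infsum_cnj [symmetric] mult.commute del: infsum_cnj)
  show "cinner x x = of_real ((norm x)\<^sup>2)"
  proof -
    have "((\<lambda>i. (cmod (coord x i))\<^sup>2) has_sum (norm x)\<^sup>2) UNIV"
      using ell2_seq_coord [of x]
      by (simp add: norm_ell2_def ell2_norm_def ell2_seq_def infsum_nonneg has_sum_infsum)
    then have "((\<lambda>i. complex_of_real ((cmod (coord x i))\<^sup>2)) has_sum of_real ((norm x)\<^sup>2)) UNIV"
      by (rule has_sum_of_real)
    then show ?thesis
      unfolding cinner_ell2_def complex_norm_square by (rule infsumI)
  qed
qed

end


section \<open>Operators and tuples of operators\<close>

text \<open>An operator on a complex Hilbert space is an element of the real Banach space
  \<open>'h \<Rightarrow>\<^sub>L 'h\<close> that is complex linear; its real and complex operator norms coincide.\<close>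

definition clinear_op :: "('h::chilbert \<Rightarrow>\<^sub>L 'h) \<Rightarrow> bool" where
  "clinear_op T \<longleftrightarrow> (\<forall>c x. blinfun_apply T (c *\<^sub>C x) = c *\<^sub>C blinfun_apply T x)"

definition op_scaleC :: "complex \<Rightarrow> ('h::chilbert \<Rightarrow>\<^sub>L 'h) \<Rightarrow> ('h \<Rightarrow>\<^sub>L 'h)" where
  "op_scaleC c T = Blinfun (\<lambda>x. c *\<^sub>C blinfun_apply T x)"

lemma blinfun_apply_op_scaleC [simp]:
  "blinfun_apply (op_scaleC c T) x = c *\<^sub>C blinfun_apply T x"
proof -
  have "bounded_linear (\<lambda>x. c *\<^sub>C blinfun_apply T x)"
    by (rule bounded_linear_compose [OF bounded_linear_scaleC blinfun.bounded_linear_right])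
  then show ?thesis by (simp add: op_scaleC_def bounded_linear_Blinfun_apply)
qed

text \<open>The norm of the row operator \<open>(h\<^sub>i)\<^sub>i \<mapsto> \<Sum>\<^sub>i X\<^sub>i h\<^sub>i\<close> on the Hilbert space direct sum
  \<open>'h ^ 'n\<close> (whose norm is the Euclidean combination of the norms of the components).\<close>

definition row_norm :: "('n::finite \<Rightarrow> 'h::chilbert \<Rightarrow>\<^sub>L 'h) \<Rightarrow> real" where
  "row_norm X = onorm (\<lambda>h :: 'h ^ 'n. \<Sum>i\<in>UNIV. blinfun_apply (X i) (h $ i))"

primrec op_word :: "('n \<Rightarrow> 'h::chilbert \<Rightarrow>\<^sub>L 'h) \<Rightarrow> 'n list \<Rightarrow> ('h \<Rightarrow>\<^sub>L 'h)" where
  "op_word X [] = id_blinfun"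
| "op_word X (i # \<alpha>) = X i o\<^sub>L op_word X \<alpha>"

section \<open>Formal power series in noncommuting indeterminates\<close>

text \<open>The free semigroup on \<open>n\<close> generators is \<open>'n list\<close> with \<open>CARD('n) = n\<close>, and a formal power
  series is the family of its coefficients.\<close>

type_synonym 'n ncps = "'n list \<Rightarrow> complex"

definition ps_one :: "'n ncps" where
  "ps_one \<alpha> = (if \<alpha> = [] then 1 else 0)"

definition ps_var :: "'n \<Rightarrow> 'n ncps" where
  "ps_var i \<alpha> = (if \<alpha> = [i] then 1 else 0)"

definition ps_mult :: "'n ncps \<Rightarrow> 'n ncps \<Rightarrow> 'n ncps" where
  "ps_mult p q \<alpha> = (\<Sum>k\<le>length \<alpha>. p (take k \<alpha>) * q (drop k \<alpha>))"

primrec ps_word :: "('n \<Rightarrow> 'n ncps) \<Rightarrow> 'n list \<Rightarrow> 'n ncps" where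
  "ps_word f [] = ps_one"
| "ps_word f (i # \<alpha>) = ps_mult (f i) (ps_word f \<alpha>)"

definition ps_polynomial :: "'n ncps \<Rightarrow> bool" where
  "ps_polynomial p \<longleftrightarrow> finite {\<alpha>. p \<alpha> \<noteq> 0}"

text \<open>\<open>ps_comp p f\<close> is the series \<open>\<Sum>\<^sub>\<alpha> p\<^sub>\<alpha> f\<^sub>\<alpha>\<close>. It is used only if \<open>p\<close> is a polynomial or all the
  \<open>f\<^sub>j\<close> have zero constant term; then the sum defining each coefficient is finite.\<close>

definition ps_comp :: "'n ncps \<Rightarrow> ('n \<Rightarrow> 'n ncps) \<Rightarrow> 'n ncps" where
  "ps_comp p f \<beta> = (\<Sum>\<alpha> | p \<alpha> * ps_word f \<alpha> \<beta> \<noteq> 0. p \<alpha> * ps_word f \<alpha> \<beta>)"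

definition ps_radius :: "'n::finite ncps \<Rightarrow> ereal" where
  "ps_radius p =
     inverse (limsup (\<lambda>k. ereal (root (2 * k) (\<Sum>\<alpha> | length \<alpha> = k. (cmod (p \<alpha>))\<^sup>2))))"

text \<open>The inner, finite sum \<open>\<Sum>\<^bsub>|\<alpha>|=k\<^esub> p\<^sub>\<alpha> X\<^sub>\<alpha>\<close>.\<close>

definition hom_part :: "'n::finite ncps \<Rightarrow> ('n \<Rightarrow> 'h::chilbert \<Rightarrow>\<^sub>L 'h) \<Rightarrow> nat \<Rightarrow> ('h \<Rightarrow>\<^sub>L 'h)" where
  "hom_part p X k = (\<Sum>\<alpha> | length \<alpha> = k. op_scaleC (p \<alpha>) (op_word X \<alpha>))"

text \<open>Value of a series at a tuple of operators, in the sense of norm convergence.\<close>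

definition ps_eval :: "'n::finite ncps \<Rightarrow> ('n \<Rightarrow> 'h::chilbert \<Rightarrow>\<^sub>L 'h) \<Rightarrow> ('h \<Rightarrow>\<^sub>L 'h)" where
  "ps_eval p X = (\<Sum>k. hom_part p X k)"

text \<open>\<open>sot_value f X Y\<close>: the tuple \<open>X\<close> is in the SOT convergence set of \<open>f\<close>, with \<open>f(X) = Y\<close>.\<close>

definition sot_value :: "('n::finite \<Rightarrow> 'n ncps) \<Rightarrow> ('n \<Rightarrow> 'h::chilbert \<Rightarrow>\<^sub>L 'h) \<Rightarrow>
    ('n \<Rightarrow> 'h \<Rightarrow>\<^sub>L 'h) \<Rightarrow> bool" where
  "sot_value f X Y \<longleftrightarrow>
     (\<forall>j h. (\<lambda>k. blinfun_apply (hom_part (f j) X k) h) sums blinfun_apply (Y j) h)"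

text \<open>\<open>rad_value f X Y\<close>: the tuple \<open>X\<close> is in the radial convergence set of \<open>f\<close>, with \<open>f(X) = Y\<close>.\<close>

definition rad_value :: "('n::finite \<Rightarrow> 'n ncps) \<Rightarrow> ('n \<Rightarrow> 'h::chilbert \<Rightarrow>\<^sub>L 'h) \<Rightarrow>
    ('n \<Rightarrow> 'h \<Rightarrow>\<^sub>L 'h) \<Rightarrow> bool" where
  "rad_value f X Y \<longleftrightarrow>
     (\<exists>\<delta>\<in>{0<..<1}. \<forall>r\<in>{\<delta><..<1}. \<forall>j. summable (hom_part (f j) (\<lambda>i. r *\<^sub>R X i))) \<and>
     (\<forall>j h. ((\<lambda>r. blinfun_apply (ps_eval (f j) (\<lambda>i. r *\<^sub>R X i)) h)
        \<longlongrightarrow> blinfun_apply (Y j) h) (at_left 1))"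

definition has_value :: "('n::finite \<Rightarrow> 'n ncps) \<Rightarrow> ('n \<Rightarrow> 'h::chilbert \<Rightarrow>\<^sub>L 'h) \<Rightarrow>
    ('n \<Rightarrow> 'h \<Rightarrow>\<^sub>L 'h) \<Rightarrow> bool" where
  "has_value f X Y \<longleftrightarrow> sot_value f X Y \<or> rad_value f X Y"

section \<open>The model property\<close>

text \<open>The model property has three variants: polynomial automorphisms (\<open>model_A\<close>), formal power
  series (\<open>model_S\<close>) and free holomorphic functions (\<open>model_F\<close>). In each of them \<open>H\<^sup>2(f)\<close> is by
  definition the Hilbert space with orthonormal basis \<open>f\<^sub>\<alpha>\<close>, so it is carried by
  \<open>'n list ell2\<close>, a vector \<open>x\<close> standing for \<open>\<Sum>\<^sub>\<alpha> x\<^sub>\<alpha> f\<^sub>\<alpha>\<close>. Concretely this is the series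
  \<open>ps_comp (coord x) f\<close> in \<open>model_S\<close>, and the function \<open>X \<mapsto> ps_eval (coord x) (f(X))\<close> in
  \<open>model_F\<close>; in \<open>model_A\<close> the finitely supported \<open>x\<close> stand for the polynomials
  \<open>ps_comp (coord x) f\<close>, which are dense in their completion \<open>H\<^sup>2(f)\<close>.

  In all three predicates \<open>g i\<close> is the coefficient family of \<open>Z\<^sub>i\<close> with respect to \<open>f\<^sub>\<alpha>\<close>, and
  \<open>M i\<close> is the (bounded) left multiplication by \<open>Z\<^sub>i\<close> on \<open>H\<^sup>2(f)\<close>.\<close>

definition model_A :: "('n::finite \<Rightarrow> 'n ncps) \<Rightarrow> ('n \<Rightarrow> 'n ncps) \<Rightarrow>
    ('n \<Rightarrow> 'n list ell2 \<Rightarrow>\<^sub>L 'n list ell2) \<Rightarrow> bool" where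
  "model_A f g M \<longleftrightarrow>
     (\<forall>i. ps_polynomial (f i)) \<and> (\<forall>i. ps_polynomial (g i)) \<and>
     (\<forall>i. ps_comp (f i) g = ps_var i) \<and> (\<forall>i. ps_comp (g i) f = ps_var i) \<and>
     (\<forall>i x. ps_polynomial (coord x) \<longrightarrow>
        ps_polynomial (coord (blinfun_apply (M i) x)) \<and>
        ps_comp (coord (blinfun_apply (M i) x)) f = ps_mult (ps_var i) (ps_comp (coord x) f))"

text \<open>In the next two predicates \<open>N j\<close> is the left multiplication by \<open>f\<^sub>j\<close> on \<open>H\<^sup>2(f)\<close>.\<close>

definition model_S :: "('n::finite \<Rightarrow> 'n ncps) \<Rightarrow> ('n \<Rightarrow> 'n ncps) \<Rightarrow>
    ('n \<Rightarrow> 'n list ell2 \<Rightarrow>\<^sub>L 'n list ell2) \<Rightarrow> bool" where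
  "model_S f g M \<longleftrightarrow>
     (\<forall>j. f j [] = 0) \<and> (\<forall>j. ps_radius (f j) > 0) \<and>
     det (\<chi> i j. f i [j]) \<noteq> 0 \<and>
     (\<forall>i. ell2_seq (g i) \<and> ps_comp (g i) f = ps_var i) \<and>
     (\<forall>i x. ps_comp (coord (blinfun_apply (M i) x)) f =
        ps_mult (ps_var i) (ps_comp (coord x) f)) \<and>
     (\<exists>N. (\<forall>j x. ps_comp (coord (blinfun_apply (N j) x)) f =
        ps_mult (f j) (ps_comp (coord x) f)) \<and> has_value f M N)"

text \<open>The balls of \<open>B(H)\<^sup>n\<close> for the separable infinite-dimensional Hilbert space
  \<open>H = \<ell>\<^sup>2(\<nat>)\<close> on which free holomorphic functions are evaluated.\<close>

definition op_ball :: "real \<Rightarrow> ('n::finite \<Rightarrow> nat ell2 \<Rightarrow>\<^sub>L nat ell2) set" where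
  "op_ball \<gamma> = {X. (\<forall>i. clinear_op (X i)) \<and> row_norm X < \<gamma>}"

definition model_F :: "('n::finite \<Rightarrow> 'n ncps) \<Rightarrow> ('n \<Rightarrow> 'n ncps) \<Rightarrow>
    ('n \<Rightarrow> 'n list ell2 \<Rightarrow>\<^sub>L 'n list ell2) \<Rightarrow> bool" where
  "model_F f g M \<longleftrightarrow> (\<exists>\<gamma>>0. let F = (\<lambda>X j. ps_eval (f j) X) in
     (\<forall>j. ereal \<gamma> \<le> ps_radius (f j)) \<and>
     (\<forall>X\<in>op_ball \<gamma>. F X \<in> op_ball 1) \<and>
     (\<forall>G. 1 \<le> ps_radius G \<and> G \<noteq> (\<lambda>_. 0) \<longrightarrow> (\<exists>X\<in>op_ball \<gamma>. ps_eval G (F X) \<noteq> 0)) \<and>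
     (\<forall>i. ell2_seq (g i) \<and> (\<forall>X\<in>op_ball \<gamma>. ps_eval (g i) (F X) = X i)) \<and>
     (\<forall>i x. \<forall>X\<in>op_ball \<gamma>. ps_eval (coord (blinfun_apply (M i) x)) (F X) =
        X i o\<^sub>L ps_eval (coord x) (F X)) \<and>
     (\<exists>N. (\<forall>j x. \<forall>X\<in>op_ball \<gamma>. ps_eval (coord (blinfun_apply (N j) x)) (F X) =
        F X j o\<^sub>L ps_eval (coord x) (F X)) \<and> has_value f M N))"

text \<open>\<open>f\<close> has the model property, with inverse \<open>g\<close> and universal model \<open>M\<close>.\<close>

definition universal_model :: "('n::finite \<Rightarrow> 'n ncps) \<Rightarrow> ('n \<Rightarrow> 'n ncps) \<Rightarrow>
    ('n \<Rightarrow> 'n list ell2 \<Rightarrow>\<^sub>L 'n list ell2) \<Rightarrow> bool" where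
  "universal_model f g M \<longleftrightarrow>
     (\<forall>i. clinear_op (M i)) \<and> (model_A f g M \<or> model_S f g M \<or> model_F f g M)"

definition model_property :: "('n::finite \<Rightarrow> 'n ncps) \<Rightarrow> bool" where
  "model_property f \<longleftrightarrow> (\<exists>g M. universal_model f g M)"

definition radial_approximation_property :: "('n::finite \<Rightarrow> 'n ncps) \<Rightarrow> bool" where
  "radial_approximation_property f \<longleftrightarrow> model_property f \<and>
     (\<exists>\<delta>\<in>{0<..<1}. \<forall>r\<in>{\<delta><..1}. model_property (\<lambda>j \<alpha>. complex_of_real r * f j \<alpha>))"

section \<open>Noncommutative domains, the domain algebra and its characters\<close>

text \<open>The condition \<open>has_value f X Y \<and> has_value g Y X\<close> says that \<open>f(X) = Y\<close> and
  \<open>g(f(X)) = X\<close>; in the radial alternative for \<open>g\<close> note that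
  \<open>r\<^bsup>|\<alpha>|\<^esup> Y\<^sub>\<alpha> = (rY)\<^sub>\<alpha>\<close>.\<close>

definition nc_domain :: "('n::finite \<Rightarrow> 'n ncps) \<Rightarrow> ('n \<Rightarrow> 'n ncps) \<Rightarrow>
    ('n \<Rightarrow> 'h::chilbert \<Rightarrow>\<^sub>L 'h) set" where
  "nc_domain f g = {X. (\<forall>i. clinear_op (X i)) \<and>
     (\<exists>Y. has_value f X Y \<and> has_value g Y X \<and> row_norm Y \<le> 1)}"

definition scalar_domain :: "('n::finite \<Rightarrow> 'n ncps) \<Rightarrow> ('n \<Rightarrow> 'n ncps) \<Rightarrow> (complex ^ 'n) set" where
  "scalar_domain f g =
     {z. (\<lambda>i. op_scaleC (z $ i) (id_blinfun :: complex \<Rightarrow>\<^sub>L complex)) \<in> nc_domain f g}"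

definition poly_op :: "'n ncps \<Rightarrow> ('n \<Rightarrow> 'h::chilbert \<Rightarrow>\<^sub>L 'h) \<Rightarrow> ('h \<Rightarrow>\<^sub>L 'h)" where
  "poly_op p X = (\<Sum>\<alpha> | p \<alpha> \<noteq> 0. op_scaleC (p \<alpha>) (op_word X \<alpha>))"

definition poly_scalar :: "'n::finite ncps \<Rightarrow> complex ^ 'n \<Rightarrow> complex" where
  "poly_scalar p z = (\<Sum>\<alpha> | p \<alpha> \<noteq> 0. p \<alpha> * prod_list (map (\<lambda>i. z $ i) \<alpha>))"

definition domain_algebra :: "('n \<Rightarrow> 'h::chilbert \<Rightarrow>\<^sub>L 'h) \<Rightarrow> ('h \<Rightarrow>\<^sub>L 'h) set" where
  "domain_algebra M = closure {poly_op p M | p. ps_polynomial p}"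

text \<open>Functionals on the algebra \<open>A\<close> are represented by functions that are \<open>undefined\<close> outside
  \<open>A\<close>.\<close>

definition characters :: "('h::chilbert \<Rightarrow>\<^sub>L 'h) set \<Rightarrow> (('h \<Rightarrow>\<^sub>L 'h) \<Rightarrow> complex) set" where
  "characters A = {\<phi> \<in> extensional A.
     (\<forall>S\<in>A. \<forall>T\<in>A. \<phi> (S + T) = \<phi> S + \<phi> T) \<and>
     (\<forall>c. \<forall>T\<in>A. \<phi> (op_scaleC c T) = c * \<phi> T) \<and>
     (\<forall>S\<in>A. \<forall>T\<in>A. \<phi> (S o\<^sub>L T) = \<phi> S * \<phi> T) \<and>
     (\<exists>T\<in>A. \<phi> T \<noteq> 0)}"

text \<open>The weak* topology is the topology of pointwise convergence on \<open>A\<close>.\<close>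

definition character_space :: "('h::chilbert \<Rightarrow>\<^sub>L 'h) set \<Rightarrow> (('h \<Rightarrow>\<^sub>L 'h) \<Rightarrow> complex) topology" where
  "character_space A = subtopology (product_topology (\<lambda>_. euclidean) A) (characters A)"

definition point_character :: "('n::finite \<Rightarrow> 'h::chilbert \<Rightarrow>\<^sub>L 'h) \<Rightarrow> complex ^ 'n \<Rightarrow>
    ('h \<Rightarrow>\<^sub>L 'h) \<Rightarrow> complex" where
  "point_character M z = (THE \<phi>. \<phi> \<in> extensional (domain_algebra M) \<and>
     continuous_on (domain_algebra M) \<phi> \<and>
     (\<forall>p. ps_polynomial p \<longrightarrow> \<phi> (poly_op p M) = poly_scalar p z))"

end

theory Submission
  imports Defs "HOL-Complex_Analysis.Conformal_Mappings"
begin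

text \<open>Let \<open>S\<close> be the tuple of left creation operators on the full Fock space. The universal model is
  \<open>M = g(S)\<close>, and \<open>f(M) = S\<close>. The inverse of \<open>r f\<close> is \<open>g(r\<^sup>-\<^sup>1 Z)\<close>, so the radial approximation property
  says that the coefficients of \<open>g\<close> decay geometrically; this makes \<open>g(S)\<close> norm convergent and, applied
  to the model of \<open>r f\<close>, upgrades the strong convergence of \<open>f(M) = S\<close> to norm convergence. Hence the
  domain algebra coincides with the noncommutative disc algebra generated by \<open>S\<close>, whose characters are
  the evaluations at the points \<open>\<mu>\<close> of the closed unit ball, and the character at \<open>\<mu>\<close> takes the
  value \<open>\<lambda> = g(\<mu>)\<close> at \<open>M\<close>, with \<open>f(\<lambda>) = \<mu>\<close>. Compactness of the ball turns the continuous bijections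
  into homeomorphisms.\<close>

section \<open>Formal power series\<close>

text \<open>The comparison of the inverses of \<open>f\<close> and \<open>r f\<close> is the
  delicate point. It rests on injectivity of composition with \<open>f\<close>, whose meaning
  changes with the variant of the model property, and \<open>f\<close> and \<open>r f\<close> may
  have this property through different variants. Without constant terms, formal composition serves
  all variants; otherwise only polynomial automorphisms and free holomorphic functions remain, and
  two free holomorphic inverses are a priori valid on balls of different radii, which calls for an
  identity theorem. Operators are compared through symbols: a left multiplication is determined by
  its value at the vacuum vector \<open>ket []\<close>. Strong convergence is used at this single
  vector, and the way back from symbol to operator is norm bounded once the symbol is damped by
  \<open>r ^ length \<alpha>\<close>. Norm convergence is what allows characters to be applied term
  by term. Evaluation on the boundary of the ball needs a von Neumann inequality for scalar points,
  obtained from a crude estimate by taking powers.\<close>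

lemma finite_length_eq: "finite {\<alpha> :: 'n::finite list. length \<alpha> = k}"
  using finite_lists_length_eq [of "UNIV :: 'n set" k] by simp

lemma finite_length_le: "finite {\<alpha> :: 'n::finite list. length \<alpha> \<le> k}"
  using finite_lists_length_le [of "UNIV :: 'n set" k] by simp

lemma finite_length_less: "finite {\<alpha> :: 'n::finite list. length \<alpha> < k}"
  by (rule finite_subset [OF _ finite_length_le [of k]]) auto

lemma sum_length_Suc:
  "(\<Sum>\<alpha> | length \<alpha> = Suc k. F (\<alpha> :: 'n::finite list))
    = (\<Sum>i\<in>UNIV. \<Sum>\<alpha> | length \<alpha> = k. F (i # \<alpha>))"
proof -
  have "{\<alpha> :: 'n list. length \<alpha> = Suc k} = (\<lambda>(i, \<alpha>). i # \<alpha>) ` (UNIV \<times> {\<alpha>. length \<alpha> = k})"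
    by (force simp: length_Suc_conv)
  then show ?thesis
    by (simp add: sum.reindex inj_on_def sum.cartesian_product split_beta)
qed

lemma ps_mult_Nil: "ps_mult p q [] = p [] * q []"
  by (simp add: ps_mult_def)

text \<open>Taking a letter off the word replaces \<open>p\<close> by its left quotient
  \<open>\<lambda>\<alpha>. p (i # \<alpha>)\<close>. With \<open>p\<close> arbitrary, the unit and
  associativity laws become inductions over the word.\<close>

lemma ps_mult_Cons: "ps_mult p q (i # \<beta>) = p [] * q (i # \<beta>) + ps_mult (\<lambda>\<alpha>. p (i # \<alpha>)) q \<beta>"
  unfolding ps_mult_def by (simp add: sum.atMost_Suc_shift del: sum.atMost_Suc)

lemmas ps_mult_rec = ps_mult_Nil ps_mult_Cons

lemma ps_mult_add_left: "ps_mult (\<lambda>\<alpha>. p \<alpha> + p' \<alpha>) q \<beta> = ps_mult p q \<beta> + ps_mult p' q \<beta>"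
  by (simp add: ps_mult_def distrib_right sum.distrib)

lemma ps_mult_scale_left: "ps_mult (\<lambda>\<alpha>. c * p \<alpha>) q \<beta> = c * ps_mult p q \<beta>"
  by (simp add: ps_mult_def sum_distrib_left mult.assoc)

lemma ps_mult_scale_right: "ps_mult p (\<lambda>\<alpha>. c * q \<alpha>) \<beta> = c * ps_mult p q \<beta>"
  by (simp add: ps_mult_def sum_distrib_left mult_ac)

lemma ps_mult_zero_left: "ps_mult (\<lambda>\<alpha>. 0) q \<beta> = 0"
  by (simp add: ps_mult_def)

lemma ps_mult_one_left: "ps_mult ps_one q = q"
proof
  show "ps_mult ps_one q \<beta> = q \<beta>" for \<beta>
    by (cases \<beta>) (simp_all add: ps_mult_rec ps_one_def ps_mult_zero_left)
qed

lemma ps_mult_one_right: "ps_mult p ps_one = p"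
proof
  show "ps_mult p ps_one \<beta> = p \<beta>" for \<beta>
    by (induction \<beta> arbitrary: p) (simp_all add: ps_mult_rec ps_one_def)
qed

lemma ps_mult_assoc: "ps_mult (ps_mult p q) r = ps_mult p (ps_mult q r)"
proof
  show "ps_mult (ps_mult p q) r \<beta> = ps_mult p (ps_mult q r) \<beta>" for \<beta>
    by (induction \<beta> arbitrary: p)
      (simp_all add: ps_mult_rec ps_mult_add_left ps_mult_scale_left algebra_simps)
qed

lemma ps_mult_var_left:
  "ps_mult (ps_var i) q \<beta> = (case \<beta> of [] \<Rightarrow> 0 | j # \<gamma> \<Rightarrow> if j = i then q \<gamma> else 0)"
proof (cases \<beta>)
  case (Cons j \<gamma>)
  have "(\<lambda>\<alpha>. ps_var i (j # \<alpha>)) = (\<lambda>\<alpha>. (if j = i then 1 else 0) * ps_one \<alpha>)"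
    by (auto simp: ps_var_def ps_one_def)
  then show ?thesis
    using Cons ps_mult_scale_left [of "if j = i then 1 else 0" ps_one q \<gamma>]
    by (simp only: ps_mult_Cons ps_mult_one_left) (simp add: ps_var_def)
qed (simp add: ps_mult_Nil ps_var_def)

lemma finite_splits: "finite {z. fst z @ snd z = \<beta>}"
proof -
  have "{z. fst z @ snd z = \<beta>} \<subseteq> (\<lambda>k. (take k \<beta>, drop k \<beta>)) ` {..length \<beta>}"
  proof
    fix z assume "z \<in> {z. fst z @ snd z = \<beta>}"
    then show "z \<in> (\<lambda>k. (take k \<beta>, drop k \<beta>)) ` {..length \<beta>}"
      by (intro image_eqI [where x = "length (fst z)"]) (auto simp: prod_eq_iff)
  qed
  then show ?thesis by (rule finite_subset) simp
qed

lemma ps_mult_eq_sum_splits: "ps_mult p q \<beta> = (\<Sum>z | fst z @ snd z = \<beta>. p (fst z) * q (snd z))"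
  unfolding ps_mult_def
  by (rule sum.reindex_bij_witness
        [where j = "\<lambda>k. (take k \<beta>, drop k \<beta>)" and i = "\<lambda>z. length (fst z)"]) auto

text \<open>Lengths add under concatenation, so the substitution of cZ for Z is
  multiplicative.\<close>

lemma ps_mult_dilate:
  "ps_mult (\<lambda>\<alpha>. c ^ length \<alpha> * p \<alpha>) (\<lambda>\<alpha>. c ^ length \<alpha> * q \<alpha>) \<beta> = c ^ length \<beta> * ps_mult p q \<beta>"
  unfolding ps_mult_def sum_distrib_left
proof (rule sum.cong)
  fix k assume "k \<in> {..length \<beta>}"
  then have "c ^ k * c ^ (length \<beta> - k) = c ^ length \<beta>"
    by (simp add: power_add [symmetric])
  then show "c ^ length (take k \<beta>) * p (take k \<beta>) * (c ^ length (drop k \<beta>) * q (drop k \<beta>))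
      = c ^ length \<beta> * (p (take k \<beta>) * q (drop k \<beta>))"
    using \<open>k \<in> {..length \<beta>}\<close> by (simp add: min_def mult_ac)
qed simp

lemma ps_word_append: "ps_word f (\<alpha> @ \<beta>) = ps_mult (ps_word f \<alpha>) (ps_word f \<beta>)"
  by (induction \<alpha>) (simp_all add: ps_mult_one_left ps_mult_assoc)

lemma ps_word_dilate:
  "ps_word (\<lambda>i \<alpha>. c ^ length \<alpha> * f i \<alpha>) \<alpha> = (\<lambda>\<beta>. c ^ length \<beta> * ps_word f \<alpha> \<beta>)"
proof (induction \<alpha>)
  case Nil
  show ?case by (auto simp: ps_one_def)
next
  case (Cons i \<alpha>)
  then show ?case by (auto simp: ps_mult_dilate)
qed

lemma ps_word_scale:
  "ps_word (\<lambda>i \<alpha>. c * f i \<alpha>) \<alpha> = (\<lambda>\<beta>. c ^ length \<alpha> * ps_word f \<alpha> \<beta>)"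
  by (induction \<alpha>) (auto simp: ps_mult_scale_left ps_mult_scale_right)

text \<open>Without constant terms every factor uses up at least one letter. This is what makes each
  coefficient of a formal composition a finite sum.\<close>

lemma ps_word_eq_0:
  assumes "\<And>i. f i [] = 0" "length \<beta> < length \<alpha>"
  shows "ps_word f \<alpha> \<beta> = 0"
  using assms(2)
proof (induction \<alpha> arbitrary: \<beta>)
  case (Cons i \<alpha>)
  show ?case
    unfolding ps_word.simps ps_mult_def
  proof (rule sum.neutral, rule ballI)
    fix k assume "k \<in> {..length \<beta>}"
    with Cons show "f i (take k \<beta>) * ps_word f \<alpha> (drop k \<beta>) = 0"
      by (cases k) (auto simp: assms(1))
  qed
qed simp

text \<open>In the lowest possible degree every factor uses exactly one letter, so only linear
  coefficients survive: a longer first piece would leave too few letters for the remaining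
  factors.\<close>

lemma ps_word_Cons_Cons:
  assumes "\<And>i. f i [] = 0" "length \<alpha> = length \<beta>"
  shows "ps_word f (i # \<alpha>) (j # \<beta>) = f i [j] * ps_word f \<alpha> \<beta>"
proof -
  have "(\<Sum>k\<le>length \<beta>. f i (j # take k \<beta>) * ps_word f \<alpha> (drop k \<beta>))
      = (\<Sum>k\<in>{0}. f i (j # take k \<beta>) * ps_word f \<alpha> (drop k \<beta>))"
    by (rule sum.mono_neutral_right) (auto intro!: ps_word_eq_0 simp: assms)
  then show ?thesis
    by (simp add: ps_mult_Cons assms(1)) (simp add: ps_mult_def)
qed

lemma ps_comp_eq_sum:
  assumes "finite A" "\<And>\<alpha>. \<alpha> \<notin> A \<Longrightarrow> p \<alpha> * ps_word f \<alpha> \<beta> = 0"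
  shows "ps_comp p f \<beta> = (\<Sum>\<alpha>\<in>A. p \<alpha> * ps_word f \<alpha> \<beta>)"
  unfolding ps_comp_def by (rule sum.mono_neutral_left) (use assms in auto)

lemma ps_comp_eq_sum_polynomial:
  assumes "finite A" "\<And>\<alpha>. \<alpha> \<notin> A \<Longrightarrow> p \<alpha> = 0"
  shows "ps_comp p f = (\<lambda>\<beta>. \<Sum>\<alpha>\<in>A. p \<alpha> * ps_word f \<alpha> \<beta>)"
  by (rule ext, rule ps_comp_eq_sum) (use assms in auto)

section \<open>Formal composition with series without constant term\<close>

context
  fixes f :: "'n::finite \<Rightarrow> 'n ncps"
  assumes f0: "\<And>i. f i [] = 0"
begin

lemma ps_comp_eq_sum_le:
  assumes "length \<beta> \<le> n"
  shows "ps_comp p f \<beta> = (\<Sum>\<alpha> | length \<alpha> \<le> n. p \<alpha> * ps_word f \<alpha> \<beta>)"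
  by (rule ps_comp_eq_sum [OF finite_length_le]) (use assms in \<open>auto intro!: ps_word_eq_0 f0\<close>)

lemma ps_comp_mult: "ps_comp (ps_mult p q) f = ps_mult (ps_comp p f) (ps_comp q f)"
proof
  fix \<beta> :: "'n list"
  define n where "n = length \<beta>"
  define L where "L = {\<alpha> :: 'n list. length \<alpha> \<le> n}"
  define T where "T = {z :: 'n list \<times> 'n list. fst z @ snd z \<in> L}"
  let ?w = "ps_word f"
  have TL: "T \<subseteq> L \<times> L" by (auto simp: T_def L_def)
  have fL: "finite L" unfolding L_def by (rule finite_length_le)
  have fT: "finite T" using TL fL finite_subset by blast
  have "ps_comp (ps_mult p q) f \<beta> = (\<Sum>\<alpha>\<in>L. ps_mult p q \<alpha> * ?w \<alpha> \<beta>)"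
    unfolding L_def by (rule ps_comp_eq_sum_le) (simp add: n_def)
  also have "\<dots> = (\<Sum>\<alpha>\<in>L. \<Sum>z\<in>{z\<in>T. fst z @ snd z = \<alpha>}. p (fst z) * q (snd z) * ?w (fst z @ snd z) \<beta>)"
    unfolding ps_mult_eq_sum_splits sum_distrib_right
    by (intro sum.cong) (auto simp: T_def)
  also have "\<dots> = (\<Sum>z\<in>T. p (fst z) * q (snd z) * ?w (fst z @ snd z) \<beta>)"
    by (rule sum.group [OF fT fL]) (auto simp: T_def)
  \<comment> \<open>A pair outside \<open>T\<close> concatenates to a word longer than
    \<open>\<beta>\<close>, whose contribution at \<open>\<beta>\<close> vanishes. On the full
    rectangle the two summations separate.\<close>
  also have "\<dots> = (\<Sum>z\<in>L\<times>L. p (fst z) * q (snd z) * ?w (fst z @ snd z) \<beta>)"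
    by (rule sum.mono_neutral_left)
      (use TL fL in \<open>auto simp: T_def L_def n_def intro!: ps_word_eq_0 f0\<close>)
  also have "\<dots> = (\<Sum>u\<in>L. \<Sum>v\<in>L. p u * q v * ps_mult (?w u) (?w v) \<beta>)"
    by (simp add: ps_word_append sum.cartesian_product split_beta)
  also have "\<dots> = (\<Sum>k\<le>n. (\<Sum>u\<in>L. p u * ?w u (take k \<beta>)) * (\<Sum>v\<in>L. q v * ?w v (drop k \<beta>)))"
  proof -
    have "(\<Sum>u\<in>L. \<Sum>v\<in>L. p u * q v * ps_mult (?w u) (?w v) \<beta>)
        = (\<Sum>u\<in>L. \<Sum>v\<in>L. \<Sum>k\<le>n. (p u * ?w u (take k \<beta>)) * (q v * ?w v (drop k \<beta>)))"
      by (simp add: ps_mult_def sum_distrib_left n_def mult_ac)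
    also have "\<dots> = (\<Sum>u\<in>L. \<Sum>k\<le>n. \<Sum>v\<in>L. (p u * ?w u (take k \<beta>)) * (q v * ?w v (drop k \<beta>)))"
      by (intro sum.cong refl sum.swap)
    also have "\<dots> = (\<Sum>k\<le>n. \<Sum>u\<in>L. \<Sum>v\<in>L. (p u * ?w u (take k \<beta>)) * (q v * ?w v (drop k \<beta>)))"
      by (rule sum.swap)
    finally show ?thesis by (simp only: sum_product)
  qed
  also have "\<dots> = ps_mult (ps_comp p f) (ps_comp q f) \<beta>"
    unfolding ps_mult_def L_def n_def
    by (rule sum.cong) (simp_all add: ps_comp_eq_sum_le [of _ "length \<beta>"])
  finally show "ps_comp (ps_mult p q) f \<beta> = ps_mult (ps_comp p f) (ps_comp q f) \<beta>" .
qed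

lemma ps_comp_var: "ps_comp (ps_var i) f = f i"
proof
  fix \<beta>
  show "ps_comp (ps_var i) f \<beta> = f i \<beta>"
    by (subst ps_comp_eq_sum [of "{[i]}"]) (auto simp: ps_var_def ps_mult_one_right)
qed

lemma ps_comp_diff: "ps_comp (\<lambda>\<alpha>. p \<alpha> - q \<alpha>) f \<beta> = ps_comp p f \<beta> - ps_comp q f \<beta>"
  by (simp add: ps_comp_eq_sum_le [of _ "length \<beta>"] left_diff_distrib sum_subtractf)

text \<open>The homogeneous component of lowest degree of \<open>H\<close> is transformed by a tensor power of the
  Jacobian matrix of \<open>f\<close> at the origin.\<close>

lemma homogeneous_comp_eq_0:
  assumes "\<And>i j. (\<Sum>k\<in>UNIV. f i [k] * B k j) = (if i = j then 1 else 0)"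
    and "\<And>\<beta>. length \<beta> = m \<Longrightarrow> (\<Sum>\<alpha> | length \<alpha> = m. H \<alpha> * ps_word f \<alpha> \<beta>) = 0"
    and "length \<alpha> = m"
  shows "H \<alpha> = 0"
  using assms(2,3)
proof (induction m arbitrary: H \<alpha>)
  case 0
  then show ?case by (simp add: ps_one_def)
next
  case (Suc m)
  \<comment> \<open>\<open>K \<beta> a\<close> contracts all tensor factors but the first. The
    hypothesis at \<open>k # \<beta>\<close> is then a linear system with the Jacobian as matrix,
    which the right inverse \<open>B\<close> solves.\<close>
  define K where "K \<beta> a = (\<Sum>\<alpha> | length \<alpha> = m. H (a # \<alpha>) * ps_word f \<alpha> \<beta>)" for \<beta> a
  have K: "K \<beta> b = 0" if "length \<beta> = m" for \<beta> b
  proof -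
    have *: "(\<Sum>a\<in>UNIV. f a [k] * K \<beta> a) = 0" for k
    proof -
      have "0 = (\<Sum>a\<in>UNIV. \<Sum>\<alpha> | length \<alpha> = m. H (a # \<alpha>) * ps_word f (a # \<alpha>) (k # \<beta>))"
        using Suc.prems(1) [of "k # \<beta>"] that by (simp add: sum_length_Suc)
      also have "\<dots> = (\<Sum>a\<in>UNIV. f a [k] * K \<beta> a)"
        unfolding K_def sum_distrib_left
        by (intro sum.cong refl)
           (use that in \<open>simp add: ps_word_Cons_Cons [where f = f, OF f0] mult_ac del: ps_word.simps\<close>)
      finally show ?thesis by simp
    qed
    have "K \<beta> b = (\<Sum>a\<in>UNIV. (if a = b then 1 else 0) * K \<beta> a)"
      by (simp add: if_distrib [of "\<lambda>x. x * _"] cong: if_cong)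
    also have "\<dots> = (\<Sum>a\<in>UNIV. \<Sum>k\<in>UNIV. f a [k] * B k b * K \<beta> a)"
      by (simp add: assms(1) [symmetric] sum_distrib_right)
    also have "\<dots> = (\<Sum>k\<in>UNIV. B k b * (\<Sum>a\<in>UNIV. f a [k] * K \<beta> a))"
      by (subst sum.swap) (simp add: sum_distrib_left mult_ac)
    finally show ?thesis by (simp add: *)
  qed
  obtain a \<alpha>' where \<alpha>: "\<alpha> = a # \<alpha>'" "length \<alpha>' = m"
    using Suc.prems(2) by (cases \<alpha>) auto
  show ?case
    unfolding \<alpha>(1) by (rule Suc.IH [of "\<lambda>\<alpha>. H (a # \<alpha>)"]) (use K in \<open>auto simp: K_def \<alpha>\<close>)
qed

text \<open>The linear parts of \<open>ps_comp (g i) f = ps_var i\<close> make the Jacobian of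
  \<open>g\<close> a left inverse of that of \<open>f\<close>, hence a right inverse, the matrices
  being square. Once the components of \<open>H\<close> below degree \<open>m\<close> vanish, longer
  words cannot reach degree \<open>m\<close>, so the component of degree \<open>m\<close> is killed
  by an invertible tensor power.\<close>

lemma ps_comp_eq_0D:
  assumes g: "\<And>i. ps_comp (g i) f = ps_var i"
    and H: "ps_comp H f = (\<lambda>_. 0)"
  shows "H = (\<lambda>_. 0)"
proof -
  define F where "F = (\<chi> i j. f i [j])"
  define G where "G = (\<chi> i j. g i [j])"
  have "(\<Sum>k\<in>UNIV. g i [k] * f k [j]) = (if i = j then 1 else 0)" for i j
  proof -
    have "ps_comp (g i) f [j] = (\<Sum>\<alpha>\<in>range (\<lambda>k. [k]). g i \<alpha> * ps_word f \<alpha> [j])"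
    proof (rule ps_comp_eq_sum)
      fix \<alpha> :: "'n list" assume "\<alpha> \<notin> range (\<lambda>k. [k])"
      then have "\<alpha> = [] \<or> length \<alpha> > 1" by (cases \<alpha>; cases "tl \<alpha>") auto
      then show "g i \<alpha> * ps_word f \<alpha> [j] = 0"
        using ps_word_eq_0 [where f = f, OF f0, of "[j]" \<alpha>] by (auto simp: ps_one_def)
    qed simp
    then show ?thesis
      by (simp add: sum.reindex inj_on_def g ps_var_def ps_mult_one_right) (metis)
  qed
  then have "G ** F = mat 1"
    by (simp add: G_def F_def matrix_matrix_mult_def mat_def)
  then have "F ** G = mat 1" by (simp add: matrix_left_right_inverse)
  then have FG: "(\<Sum>k\<in>UNIV. f i [k] * g k [j]) = (if i = j then 1 else 0)" for i j
    by (simp add: G_def F_def matrix_matrix_mult_def mat_def vec_eq_iff)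
  have "H \<alpha> = 0" if "length \<alpha> = m" for m \<alpha>
    using that
  proof (induction m arbitrary: \<alpha> rule: less_induct)
    case (less m)
    show ?case
    proof (rule homogeneous_comp_eq_0 [OF FG _ less.prems])
      fix \<beta> :: "'n list" assume \<beta>: "length \<beta> = m"
      have "(\<Sum>\<alpha> | length \<alpha> = m. H \<alpha> * ps_word f \<alpha> \<beta>) = ps_comp H f \<beta>"
      proof (rule ps_comp_eq_sum [OF finite_length_eq, symmetric])
        fix \<alpha> :: "'n list" assume "\<alpha> \<notin> {\<alpha>. length \<alpha> = m}"
        then consider "length \<alpha> < m" | "length \<beta> < length \<alpha>" using \<beta> by fastforce
        then show "H \<alpha> * ps_word f \<alpha> \<beta> = 0"
          by cases (auto simp: less.IH intro: ps_word_eq_0 [where f = f, OF f0])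
      qed
      then show "(\<Sum>\<alpha> | length \<alpha> = m. H \<alpha> * ps_word f \<alpha> \<beta>) = 0" by (simp add: H)
    qed
  qed
  then show ?thesis by blast
qed

end

section \<open>Noncommutative polynomials\<close>

lemma ps_polynomial_bound:
  assumes "ps_polynomial p"
  obtains n where "\<And>\<alpha>. n \<le> length \<alpha> \<Longrightarrow> p \<alpha> = 0"
proof -
  have "finite (length ` {\<alpha>. p \<alpha> \<noteq> 0})" using assms by (simp add: ps_polynomial_def)
  then obtain n where "\<forall>k\<in>length ` {\<alpha>. p \<alpha> \<noteq> 0}. k < n"
    using finite_nat_set_iff_bounded by blast
  then show ?thesis by (intro that [of n]) force
qed

lemma ps_polynomialI:
  fixes p :: "'n::finite ncps"
  assumes "\<And>\<alpha>. n \<le> length \<alpha> \<Longrightarrow> p \<alpha> = 0"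
  shows "ps_polynomial p"
  unfolding ps_polynomial_def
  by (rule finite_subset [OF _ finite_length_le [of n]]) (use assms nat_le_linear in auto)

lemma ps_polynomial_one: "ps_polynomial ps_one"
  unfolding ps_polynomial_def
  by (rule finite_subset [of _ "{[]}"]) (auto simp: ps_one_def)

lemma ps_polynomial_var: "ps_polynomial (ps_var i)"
  unfolding ps_polynomial_def
  by (rule finite_subset [of _ "{[i]}"]) (auto simp: ps_var_def)

lemma ps_polynomial_add: "ps_polynomial p \<Longrightarrow> ps_polynomial q \<Longrightarrow> ps_polynomial (\<lambda>\<alpha>. p \<alpha> + q \<alpha>)"
  unfolding ps_polynomial_def
  by (rule finite_subset [of _ "{\<alpha>. p \<alpha> \<noteq> 0} \<union> {\<alpha>. q \<alpha> \<noteq> 0}"]) auto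

lemma ps_polynomial_scale: "ps_polynomial p \<Longrightarrow> ps_polynomial (\<lambda>\<alpha>. c \<alpha> * p \<alpha>)"
  unfolding ps_polynomial_def by (rule finite_subset [of _ "{\<alpha>. p \<alpha> \<noteq> 0}"]) auto

lemma ps_polynomial_sum:
  "(\<And>a. a \<in> A \<Longrightarrow> ps_polynomial (p a)) \<Longrightarrow> ps_polynomial (\<lambda>\<alpha>. \<Sum>a\<in>A. p a \<alpha>)"
proof (induction A rule: infinite_finite_induct)
  case (insert a A)
  then show ?case by (simp add: ps_polynomial_add)
qed (simp_all add: ps_polynomial_def)

lemma ps_polynomial_mult:
  assumes "ps_polynomial p" "ps_polynomial q"
  shows "ps_polynomial (ps_mult p q)"
  unfolding ps_polynomial_def
proof (rule finite_subset)
  show "finite ((\<lambda>z. fst z @ snd z) ` ({\<alpha>. p \<alpha> \<noteq> 0} \<times> {\<alpha>. q \<alpha> \<noteq> 0}))"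
    using assms by (simp add: ps_polynomial_def)
  show "{\<alpha>. ps_mult p q \<alpha> \<noteq> 0}
      \<subseteq> (\<lambda>z. fst z @ snd z) ` ({\<alpha>. p \<alpha> \<noteq> 0} \<times> {\<alpha>. q \<alpha> \<noteq> 0})"
  proof
    fix \<alpha> assume "\<alpha> \<in> {\<alpha>. ps_mult p q \<alpha> \<noteq> 0}"
    then obtain z where "fst z @ snd z = \<alpha>" "p (fst z) * q (snd z) \<noteq> 0"
      unfolding ps_mult_eq_sum_splits by (auto elim: sum.not_neutral_contains_not_neutral)
    then show "\<alpha> \<in> (\<lambda>z. fst z @ snd z) ` ({\<alpha>. p \<alpha> \<noteq> 0} \<times> {\<alpha>. q \<alpha> \<noteq> 0})"
      by (auto intro!: image_eqI [where x = z] simp: prod_eq_iff mem_Times_iff)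
  qed
qed

lemma ps_polynomial_word: "(\<And>i. ps_polynomial (f i)) \<Longrightarrow> ps_polynomial (ps_word f \<alpha>)"
  by (induction \<alpha>) (simp_all add: ps_polynomial_one ps_polynomial_mult)

section \<open>Tuples of operators\<close>

lemma scaleC_zero_left [simp]: "0 *\<^sub>C (x :: 'a :: chilbert) = 0"
  using scaleC_of_real [of 0 x] by simp

lemma scaleC_zero_right [simp]: "c *\<^sub>C (0 :: 'a :: chilbert) = 0"
  using norm_scaleC [of c "0 :: 'a"] by simp

lemma scaleC_one [simp]: "1 *\<^sub>C (x :: 'a :: chilbert) = x"
  using scaleC_of_real [of 1 x] by simp

lemma scaleC_sum_right: "c *\<^sub>C (\<Sum>a\<in>A. x a :: 'a :: chilbert) = (\<Sum>a\<in>A. c *\<^sub>C x a)"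
  by (induction A rule: infinite_finite_induct) (simp_all add: scaleC_add_right)

lemma op_scaleC_add_right: "op_scaleC c (S + T) = op_scaleC c S + op_scaleC c T"
  by (rule blinfun_eqI) (simp add: blinfun.add_left scaleC_add_right)

lemma op_scaleC_add_left: "op_scaleC (c + d) T = op_scaleC c T + op_scaleC d T"
  by (rule blinfun_eqI) (simp add: blinfun.add_left scaleC_add_left)

lemma op_scaleC_op_scaleC: "op_scaleC c (op_scaleC d T) = op_scaleC (c * d) T"
  by (rule blinfun_eqI) (simp add: scaleC_scaleC)

lemma op_scaleC_zero_left [simp]: "op_scaleC 0 T = 0"
  by (rule blinfun_eqI) simp

lemma op_scaleC_zero_right [simp]: "op_scaleC c 0 = 0"
  by (rule blinfun_eqI) simp

lemma op_scaleC_one [simp]: "op_scaleC 1 T = T"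
  by (rule blinfun_eqI) simp

lemma op_scaleC_of_real: "op_scaleC (of_real r) T = r *\<^sub>R T"
  by (rule blinfun_eqI) (simp add: scaleC_of_real blinfun.scaleR_left)

lemma op_scaleC_minus_one: "op_scaleC (-1) T = - T"
  using op_scaleC_of_real [of "-1" T] by simp

lemma op_scaleC_sum_right: "op_scaleC c (\<Sum>a\<in>A. T a) = (\<Sum>a\<in>A. op_scaleC c (T a))"
  by (induction A rule: infinite_finite_induct) (simp_all add: op_scaleC_add_right)

lemma op_scaleC_sum_left: "op_scaleC (\<Sum>a\<in>A. c a) T = (\<Sum>a\<in>A. op_scaleC (c a) T)"
  by (induction A rule: infinite_finite_induct) (simp_all add: op_scaleC_add_left)

lemma norm_op_scaleC_le: "norm (op_scaleC c T) \<le> cmod c * norm T"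
  by (rule norm_blinfun_bound)
    (auto simp: norm_scaleC mult.assoc intro!: mult_left_mono norm_blinfun)

lemma bounded_linear_op_scaleC: "bounded_linear (op_scaleC c)"
proof (rule bounded_linear_intro [where K = "cmod c"])
  show "op_scaleC c (r *\<^sub>R T) = r *\<^sub>R op_scaleC c T" for r T
    by (simp add: op_scaleC_of_real [symmetric] op_scaleC_op_scaleC mult.commute)
qed (simp_all add: op_scaleC_add_right norm_op_scaleC_le mult.commute)

lemma op_scaleC_compose_left: "op_scaleC c S o\<^sub>L T = op_scaleC c (S o\<^sub>L T)"
  by (rule blinfun_eqI) simp

lemma op_scaleC_compose_right: "clinear_op S \<Longrightarrow> S o\<^sub>L op_scaleC c T = op_scaleC c (S o\<^sub>L T)"
  by (rule blinfun_eqI) (simp add: clinear_op_def)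

lemma compose_sum_left: "(\<Sum>a\<in>A. S a) o\<^sub>L T = (\<Sum>a\<in>A. S a o\<^sub>L T)"
  by (rule blinfun_eqI) (simp add: blinfun.sum_left)

lemma compose_sum_right: "S o\<^sub>L (\<Sum>a\<in>A. T a) = (\<Sum>a\<in>A. S o\<^sub>L T a)"
  by (rule blinfun_eqI) (simp add: blinfun.sum_left blinfun.sum_right)

lemma blinfun_compose_assoc: "R o\<^sub>L (S o\<^sub>L T) = (R o\<^sub>L S) o\<^sub>L T"
  by (rule blinfun_eqI) (simp only: blinfun_apply_blinfun_compose)

lemma compose_id [simp]: "T o\<^sub>L id_blinfun = T" "id_blinfun o\<^sub>L T = T"
  by (rule blinfun_eqI; simp)+

lemma norm_compose_le: "norm (S o\<^sub>L T) \<le> norm S * norm T"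
  by (rule norm_blinfun_compose)

lemma clinear_op_id: "clinear_op id_blinfun"
  by (simp add: clinear_op_def)

lemma clinear_op_zero: "clinear_op 0"
  by (simp add: clinear_op_def)

lemma clinear_op_add: "clinear_op S \<Longrightarrow> clinear_op T \<Longrightarrow> clinear_op (S + T)"
  by (simp add: clinear_op_def blinfun.add_left scaleC_add_right)

lemma clinear_op_sum: "(\<And>a. a \<in> A \<Longrightarrow> clinear_op (T a)) \<Longrightarrow> clinear_op (\<Sum>a\<in>A. T a)"
  by (induction A rule: infinite_finite_induct) (simp_all add: clinear_op_zero clinear_op_add)

lemma clinear_op_scaleC: "clinear_op T \<Longrightarrow> clinear_op (op_scaleC c T)"
  by (simp add: clinear_op_def scaleC_scaleC mult.commute)

lemma clinear_op_scaleR: "clinear_op T \<Longrightarrow> clinear_op (r *\<^sub>R T)"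
  using clinear_op_scaleC [of T "of_real r"] by (simp add: op_scaleC_of_real)

lemma clinear_op_compose: "clinear_op S \<Longrightarrow> clinear_op T \<Longrightarrow> clinear_op (S o\<^sub>L T)"
  by (simp add: clinear_op_def)

lemma tendsto_blinfun_apply: "(T \<longlongrightarrow> T') F \<Longrightarrow> ((\<lambda>n. blinfun_apply (T n) x) \<longlongrightarrow> blinfun_apply T' x) F"
  by (intro tendsto_intros)

lemma sums_blinfun_apply: "T sums T' \<Longrightarrow> (\<lambda>n. blinfun_apply (T n) x) sums blinfun_apply T' x"
  by (rule bounded_linear.sums [OF blinfun.bounded_linear_left])

lemma clinear_op_sums:
  assumes "T sums T'" "\<And>k. clinear_op (T k)"
  shows "clinear_op T'"
  unfolding clinear_op_def
proof (intro allI)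
  fix c x
  have "(\<lambda>n. blinfun_apply (T n) (c *\<^sub>C x)) sums blinfun_apply T' (c *\<^sub>C x)"
    by (rule sums_blinfun_apply [OF assms(1)])
  moreover have "(\<lambda>n. c *\<^sub>C blinfun_apply (T n) x) sums (c *\<^sub>C blinfun_apply T' x)"
    by (rule bounded_linear.sums [OF bounded_linear_scaleC sums_blinfun_apply [OF assms(1)]])
  ultimately show "blinfun_apply T' (c *\<^sub>C x) = c *\<^sub>C blinfun_apply T' x"
    using assms(2) by (simp add: clinear_op_def sums_unique2)
qed

lemma op_word_append: "op_word X (\<alpha> @ \<beta>) = op_word X \<alpha> o\<^sub>L op_word X \<beta>"
  by (induction \<alpha>) (simp_all add: blinfun_compose_assoc)

lemma clinear_op_word: "(\<And>i. clinear_op (X i)) \<Longrightarrow> clinear_op (op_word X \<alpha>)"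
  by (induction \<alpha>) (simp_all add: clinear_op_id clinear_op_compose)

lemma op_word_scaleC:
  assumes "\<And>i. clinear_op (X i)"
  shows "op_word (\<lambda>i. op_scaleC c (X i)) \<alpha> = op_scaleC (c ^ length \<alpha>) (op_word X \<alpha>)"
  by (induction \<alpha>)
    (simp_all add: op_scaleC_compose_left op_scaleC_compose_right assms op_scaleC_op_scaleC)

lemma clinear_op_hom_part: "(\<And>i. clinear_op (X i)) \<Longrightarrow> clinear_op (hom_part p X k)"
  unfolding hom_part_def by (intro clinear_op_sum clinear_op_scaleC clinear_op_word)

lemma hom_part_0: "hom_part p X 0 = op_scaleC (p []) id_blinfun"
  by (simp add: hom_part_def)

lemma hom_part_Suc:
  assumes "\<And>i. clinear_op (X i)"
  shows "hom_part p X (Suc k) = (\<Sum>i\<in>UNIV. X i o\<^sub>L hom_part (\<lambda>\<alpha>. p (i # \<alpha>)) X k)"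
  by (simp add: hom_part_def sum_length_Suc compose_sum_right op_scaleC_compose_right assms)

lemma hom_part_add: "hom_part (\<lambda>\<alpha>. p \<alpha> + q \<alpha>) X k = hom_part p X k + hom_part q X k"
  by (simp add: hom_part_def op_scaleC_add_left sum.distrib)

lemma hom_part_scale: "hom_part (\<lambda>\<alpha>. c * p \<alpha>) X k = op_scaleC c (hom_part p X k)"
  by (simp add: hom_part_def op_scaleC_op_scaleC op_scaleC_sum_right)

lemma hom_part_diff: "hom_part (\<lambda>\<alpha>. p \<alpha> - q \<alpha>) X k = hom_part p X k - hom_part q X k"
  using hom_part_add [of p "\<lambda>\<alpha>. (-1) * q \<alpha>" X k] hom_part_scale [of "-1" q X k]
  by (simp add: op_scaleC_minus_one)

lemma hom_part_scaleC:
  assumes "\<And>i. clinear_op (X i)"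
  shows "hom_part p (\<lambda>i. op_scaleC c (X i)) k = op_scaleC (c ^ k) (hom_part p X k)"
  unfolding hom_part_def op_scaleC_sum_right
  by (rule sum.cong) (simp_all add: op_word_scaleC assms op_scaleC_op_scaleC mult.commute)

lemma hom_part_dilate:
  "hom_part (\<lambda>\<alpha>. c ^ length \<alpha> * p \<alpha>) X k = op_scaleC (c ^ k) (hom_part p X k)"
  unfolding hom_part_def op_scaleC_sum_right
  by (rule sum.cong) (simp_all add: op_scaleC_op_scaleC)

lemma hom_part_scaleR:
  assumes "\<And>i. clinear_op (X i)"
  shows "hom_part p (\<lambda>i. r *\<^sub>R X i) k = r ^ k *\<^sub>R hom_part p X k"
  using hom_part_scaleC [of X p "of_real r" k, OF assms]
  by (simp add: op_scaleC_of_real flip: of_real_power)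

lemma hom_part_mult_letter:
  assumes "\<And>i. clinear_op (X i)"
  shows "hom_part (ps_mult (ps_var j) p) X (Suc k) = X j o\<^sub>L hom_part p X k"
    and "hom_part (ps_mult (ps_var j) p) X 0 = 0"
proof -
  have "(\<lambda>\<alpha>. ps_mult (ps_var j) p (i # \<alpha>)) = (\<lambda>\<alpha>. (if i = j then 1 else 0) * p \<alpha>)" for i
    by (auto simp: ps_mult_var_left)
  then have "hom_part (ps_mult (ps_var j) p) X (Suc k)
      = (\<Sum>i\<in>UNIV. if i = j then X i o\<^sub>L hom_part p X k else 0)"
    unfolding hom_part_Suc [OF assms] by (intro sum.cong) (simp_all add: hom_part_scale)
  then show "hom_part (ps_mult (ps_var j) p) X (Suc k) = X j o\<^sub>L hom_part p X k" by simp
qed (simp add: hom_part_0 ps_mult_var_left)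

subsection \<open>Row norms\<close>

lemma bounded_linear_row:
  "bounded_linear (\<lambda>h :: 'h::chilbert ^ 'n::finite. \<Sum>i\<in>UNIV. blinfun_apply (X i) (h $ i))"
  by (intro bounded_linear_sum bounded_linear_compose [OF blinfun.bounded_linear_right]
      bounded_linear_vec_nth)

lemma norm_row_le:
  fixes X :: "'n::finite \<Rightarrow> 'h::chilbert \<Rightarrow>\<^sub>L 'h"
  shows "norm (\<Sum>i\<in>UNIV. X i (v i)) \<le> row_norm X * L2_set (\<lambda>i. norm (v i)) UNIV"
  using onorm [OF bounded_linear_row, of X "\<chi> i. v i"] by (simp add: row_norm_def norm_vec_def)

lemma row_norm_nonneg: "0 \<le> row_norm X"
  unfolding row_norm_def by (rule onorm_pos_le [OF bounded_linear_row])

lemma row_norm_le: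
  fixes X :: "'n::finite \<Rightarrow> 'h::chilbert \<Rightarrow>\<^sub>L 'h"
  assumes "0 \<le> B"
    and "\<And>v. norm (\<Sum>i\<in>UNIV. X i (v i)) \<le> B * L2_set (\<lambda>i. norm (v i)) UNIV"
  shows "row_norm X \<le> B"
  unfolding row_norm_def using assms by (intro onorm_bound) (simp_all add: norm_vec_def)

lemma row_norm_scaleC_le:
  "row_norm (\<lambda>i. op_scaleC c (X i)) \<le> cmod c * row_norm X"
  by (rule row_norm_le)
    (auto simp: row_norm_nonneg norm_scaleC mult.assoc norm_row_le
      simp flip: scaleC_sum_right intro!: mult_left_mono)

text \<open>Each component of a vector is dominated by its Euclidean norm; this crude perturbation
  bound is enough for continuity of the row norm.\<close>

lemma row_norm_triangle:
  fixes X Y :: "'n::finite \<Rightarrow> 'h::chilbert \<Rightarrow>\<^sub>L 'h"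
  shows "row_norm X \<le> row_norm Y + (\<Sum>i\<in>UNIV. norm (X i - Y i))"
proof (rule row_norm_le)
  fix v :: "'n \<Rightarrow> 'h"
  have "norm (\<Sum>i\<in>UNIV. (X i - Y i) (v i))
      \<le> (\<Sum>i\<in>UNIV. norm (X i - Y i) * L2_set (\<lambda>i. norm (v i)) UNIV)"
    by (intro sum_norm_le order_trans [OF norm_blinfun] mult_left_mono member_le_L2_set) auto
  then have "norm ((\<Sum>i\<in>UNIV. Y i (v i)) + (\<Sum>i\<in>UNIV. (X i - Y i) (v i)))
      \<le> row_norm Y * L2_set (\<lambda>i. norm (v i)) UNIV
        + (\<Sum>i\<in>UNIV. norm (X i - Y i) * L2_set (\<lambda>i. norm (v i)) UNIV)"
    by (intro norm_triangle_mono norm_row_le)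
  moreover have "(\<Sum>i\<in>UNIV. X i (v i))
      = (\<Sum>i\<in>UNIV. Y i (v i)) + (\<Sum>i\<in>UNIV. (X i - Y i) (v i))"
    by (simp add: blinfun.diff_left sum_subtractf)
  ultimately show "norm (\<Sum>i\<in>UNIV. X i (v i))
      \<le> (row_norm Y + (\<Sum>i\<in>UNIV. norm (X i - Y i))) * L2_set (\<lambda>i. norm (v i)) UNIV"
    by (simp only: distrib_right sum_distrib_right)
qed (simp add: row_norm_nonneg sum_nonneg)

lemma L2_set_length_Suc:
  "L2_set F {\<alpha> :: 'n::finite list. length \<alpha> = Suc k}
    = L2_set (\<lambda>i. L2_set (\<lambda>\<alpha>. F (i # \<alpha>)) {\<alpha>. length \<alpha> = k}) UNIV"
  by (simp add: L2_set_def sum_length_Suc sum_nonneg)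

text \<open>The words of length \<open>k\<close> in \<open>X\<close> form a row of norm at most
  \<open>row_norm X ^ k\<close>, and the coefficients act as a column with Euclidean norm. The
  induction splits off the first letter and applies \<open>norm_row_le\<close> to the left quotients
  of \<open>p\<close>.\<close>

lemma norm_hom_part_le:
  fixes X :: "'n::finite \<Rightarrow> 'h::chilbert \<Rightarrow>\<^sub>L 'h"
  assumes "\<And>i. clinear_op (X i)"
  shows "norm (hom_part p X k) \<le> L2_set (\<lambda>\<alpha>. cmod (p \<alpha>)) {\<alpha>. length \<alpha> = k} * row_norm X ^ k"
proof (induction k arbitrary: p)
  case 0
  have "norm (op_scaleC (p []) (id_blinfun :: 'h \<Rightarrow>\<^sub>L 'h)) \<le> cmod (p []) * 1"
    by (rule order_trans [OF norm_op_scaleC_le mult_left_mono])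
       (simp_all add: norm_blinfun_id_le)
  then show ?case by (simp add: hom_part_0)
next
  case (Suc k)
  define l where "l i = L2_set (\<lambda>\<alpha>. cmod (p (i # \<alpha>))) {\<alpha>. length \<alpha> = k}" for i
  define H where "H i = hom_part (\<lambda>\<alpha>. p (i # \<alpha>)) X k" for i
  have L: "L2_set (\<lambda>\<alpha>. cmod (p \<alpha>)) {\<alpha>. length \<alpha> = Suc k} = L2_set l UNIV"
    by (simp add: L2_set_length_Suc l_def [abs_def])
  show ?case
    unfolding L
  proof (rule norm_blinfun_bound)
    fix h
    have "norm (H i h) \<le> (row_norm X ^ k * norm h) * l i" for i
      using order_trans [OF norm_blinfun mult_right_mono [OF Suc.IH]]
      by (simp add: H_def l_def mult_ac)
    then have "L2_set (\<lambda>i. norm (H i h)) UNIV \<le> L2_set (\<lambda>i. (row_norm X ^ k * norm h) * l i) UNIV"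
      by (intro L2_set_mono) auto
    also have "\<dots> = row_norm X ^ k * norm h * L2_set l UNIV"
      by (rule L2_set_right_distrib [symmetric]) (simp add: row_norm_nonneg)
    finally have "row_norm X * L2_set (\<lambda>i. norm (H i h)) UNIV
        \<le> row_norm X * (row_norm X ^ k * norm h * L2_set l UNIV)"
      by (rule mult_left_mono) (rule row_norm_nonneg)
    then show "norm (hom_part p X (Suc k) h) \<le> L2_set l UNIV * row_norm X ^ Suc k * norm h"
      using norm_row_le [of X "\<lambda>i. H i h"]
      by (simp add: hom_part_Suc [OF assms] blinfun.sum_left H_def mult_ac)
  qed (simp add: row_norm_nonneg)
qed

lemma norm_hom_part_ell2_le:
  fixes X :: "'n::finite \<Rightarrow> 'h::chilbert \<Rightarrow>\<^sub>L 'h"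
  assumes "\<And>i. clinear_op (X i)" "ell2_seq p"
  shows "norm (hom_part p X k) \<le> ell2_norm p * row_norm X ^ k"
  by (rule order_trans [OF norm_hom_part_le [OF assms(1)] mult_right_mono])
     (simp_all add: L2_set_le_ell2_norm [OF assms(2) finite_length_eq] row_norm_nonneg)

lemma summable_hom_part_ell2:
  fixes X :: "'n::finite \<Rightarrow> 'h::chilbert \<Rightarrow>\<^sub>L 'h"
  assumes "\<And>i. clinear_op (X i)" "ell2_seq p" "row_norm X < 1"
  shows "summable (\<lambda>k. norm (hom_part p X k))"
proof (rule summable_comparison_test')
  show "summable (\<lambda>k. ell2_norm p * row_norm X ^ k)"
    using assms(3) row_norm_nonneg [of X] by (intro summable_mult summable_geometric) simp
  show "norm (norm (hom_part p X k)) \<le> ell2_norm p * row_norm X ^ k" for k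
    using norm_hom_part_ell2_le [OF assms(1,2)] by simp
qed

text \<open>Root test: for \<open>y\<close> strictly between the row norm \<open>x\<close> and the
  radius, the Euclidean norm of the coefficients of degree k is eventually at most
  \<open>(1 / y) ^ k\<close>, so a geometric series with ratio \<open>x / y\<close>
  dominates.\<close>

lemma summable_hom_part_radius:
  fixes X :: "'n::finite \<Rightarrow> 'h::chilbert \<Rightarrow>\<^sub>L 'h"
  assumes X: "\<And>i. clinear_op (X i)" and r: "ereal (row_norm X) < ps_radius p"
  shows "summable (\<lambda>k. norm (hom_part p X k))"
proof -
  define L where "L = limsup (\<lambda>k. ereal (root (2 * k) (\<Sum>\<alpha> | length \<alpha> = k. (cmod (p \<alpha>))\<^sup>2)))"
  define x where "x = row_norm X"
  have x: "0 \<le> x" "ereal x < inverse L"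
    using r row_norm_nonneg [of X] by (auto simp: x_def L_def ps_radius_def)
  obtain y where y: "x < y" "ereal y < inverse L"
    using ereal_dense2 [OF x(2)] by auto
  have "0 \<le> L"
    unfolding L_def
    by (rule le_Limsup) (auto intro!: always_eventually real_root_ge_zero sum_nonneg)
  have "L < ereal (1 / y)"
    using y x(1) \<open>0 \<le> L\<close> by (cases L) (auto simp: field_simps split: if_splits)
  then have "\<forall>\<^sub>F k in sequentially.
      ereal (root (2 * k) (\<Sum>\<alpha> | length \<alpha> = k. (cmod (p \<alpha>))\<^sup>2)) < ereal (1 / y)"
    unfolding L_def by (rule Limsup_lessD)
  then have "\<forall>\<^sub>F k in sequentially. norm (norm (hom_part p X k)) \<le> (x / y) ^ k"
    using eventually_gt_at_top [of 0]
  proof eventually_elim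
    case (elim k)
    define s where "s = (\<Sum>\<alpha> | length \<alpha> = k. (cmod (p \<alpha>))\<^sup>2)"
    have "0 \<le> s" by (simp add: s_def sum_nonneg)
    then have "root (2 * k) s ^ (2 * k) = s" using elim by (intro real_root_pow_pos2) auto
    moreover have "root (2 * k) s ^ (2 * k) \<le> (1 / y) ^ (2 * k)"
      using elim \<open>0 \<le> s\<close> by (intro power_mono) (auto simp: s_def real_root_ge_zero)
    ultimately have "s \<le> ((1 / y) ^ k)\<^sup>2" by (simp add: power_mult [symmetric] mult.commute)
    then have "sqrt s \<le> (1 / y) ^ k" using x(1) y(1) by (intro real_le_lsqrt) auto
    then have "sqrt s * x ^ k \<le> (1 / y) ^ k * x ^ k" using x by (intro mult_right_mono) auto
    moreover have "norm (hom_part p X k) \<le> sqrt s * x ^ k"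
      using norm_hom_part_le [of X p k, OF X] by (simp add: L2_set_def s_def x_def)
    ultimately show ?case by (simp add: power_divide)
  qed
  moreover have "summable (\<lambda>k. (x / y) ^ k)"
    using x y by (intro summable_geometric) (auto simp: field_simps)
  ultimately show ?thesis by (rule summable_comparison_test_ev)
qed

lemma ps_radius_ell2:
  fixes p :: "'n::finite ncps"
  assumes "ell2_seq p"
  shows "1 \<le> ps_radius p"
proof -
  \<comment> \<open>The added 1 keeps \<open>C\<close> positive, so that its roots tend to
    1.\<close>
  define C where "C = (ell2_norm p)\<^sup>2 + 1"
  define s where "s k = (\<Sum>\<alpha> | length \<alpha> = k. (cmod (p \<alpha>))\<^sup>2)" for k
  define L where "L = limsup (\<lambda>k. ereal (root (2 * k) (s k)))"
  have s: "0 \<le> s k" "s k \<le> C" for k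
  proof -
    show "0 \<le> s k" by (simp add: s_def sum_nonneg)
    have "sqrt (s k) \<le> ell2_norm p"
      using L2_set_le_ell2_norm [OF assms finite_length_eq [of k]] by (simp add: L2_set_def s_def)
    then have "s k \<le> (ell2_norm p)\<^sup>2" by (rule sqrt_le_D)
    then show "s k \<le> C" by (simp add: C_def)
  qed
  have "0 \<le> L"
    unfolding L_def by (rule le_Limsup) (auto intro!: always_eventually real_root_ge_zero s)
  have "(\<lambda>k. root (2 * k) C) \<longlonglongrightarrow> 1"
    using LIMSEQ_subseq_LIMSEQ [OF LIMSEQ_root_const [of C], of "\<lambda>k. 2 * k"]
    by (simp add: C_def strict_mono_def o_def add_nonneg_pos)
  then have "limsup (\<lambda>k. ereal (root (2 * k) C)) = 1"
    by (intro lim_imp_Limsup) (auto simp: one_ereal_def)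
  moreover have "L \<le> limsup (\<lambda>k. ereal (root (2 * k) C))"
    unfolding L_def
    by (rule Limsup_mono)
       (use eventually_gt_at_top [of 0] in \<open>eventually_elim, auto intro!: real_root_le_mono s\<close>)
  ultimately have "L \<le> 1" by simp
  then have "1 \<le> inverse L"
    using \<open>0 \<le> L\<close> by (cases L) (auto simp: one_ereal_def field_simps)
  then show ?thesis by (simp add: ps_radius_def L_def s_def)
qed

lemma hom_part_sums_ps_eval:
  "summable (\<lambda>k. norm (hom_part p X k)) \<Longrightarrow> hom_part p X sums ps_eval p X"
  unfolding ps_eval_def by (rule summable_sums, rule summable_norm_cancel)

subsection \<open>Polynomials in operators\<close>

lemma poly_op_eq_sum:
  "finite A \<Longrightarrow> (\<And>\<alpha>. \<alpha> \<notin> A \<Longrightarrow> p \<alpha> = 0) \<Longrightarrow> poly_op p X = (\<Sum>\<alpha>\<in>A. op_scaleC (p \<alpha>) (op_word X \<alpha>))"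
  unfolding poly_op_def by (rule sum.mono_neutral_left) auto

lemma poly_op_eq_sum_less:
  fixes p :: "'n::finite ncps"
  assumes "\<And>\<alpha>. n \<le> length \<alpha> \<Longrightarrow> p \<alpha> = 0"
  shows "poly_op p X = (\<Sum>k<n. hom_part p X k)"
proof -
  have "poly_op p X = (\<Sum>\<alpha> | length \<alpha> < n. op_scaleC (p \<alpha>) (op_word X \<alpha>))"
    by (rule poly_op_eq_sum [OF finite_length_less]) (use assms in auto)
  also have "\<dots> = (\<Sum>k<n. \<Sum>\<alpha>\<in>{\<alpha> \<in> {\<alpha>. length \<alpha> < n}. length \<alpha> = k}. op_scaleC (p \<alpha>) (op_word X \<alpha>))"
    by (rule sum.group [symmetric]) (auto simp: finite_length_less)
  also have "\<dots> = (\<Sum>k<n. hom_part p X k)"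
    unfolding hom_part_def by (intro sum.cong) auto
  finally show ?thesis .
qed

lemma hom_part_sums_poly_op:
  fixes p :: "'n::finite ncps"
  assumes "ps_polynomial p"
  shows "hom_part p X sums poly_op p X"
proof -
  obtain n where n: "\<And>\<alpha>. n \<le> length \<alpha> \<Longrightarrow> p \<alpha> = 0" using ps_polynomial_bound [OF assms] by blast
  have "hom_part p X sums (\<Sum>k<n. hom_part p X k)"
    by (rule sums_finite) (auto simp: hom_part_def n not_less)
  then show ?thesis using poly_op_eq_sum_less [of n p X] n by simp
qed

lemma ps_eval_polynomial:
  "ps_polynomial (p :: 'n::finite ncps) \<Longrightarrow> ps_eval p X = poly_op p X"
  using hom_part_sums_poly_op [of p X] by (simp add: ps_eval_def sums_iff)

lemma poly_op_one: "poly_op ps_one X = id_blinfun"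
  by (subst poly_op_eq_sum [of "{[]}"]) (auto simp: ps_one_def)

lemma poly_op_var: "poly_op (ps_var i) X = X i"
  by (subst poly_op_eq_sum [of "{[i]}"]) (auto simp: ps_var_def)

lemma poly_op_scale: "poly_op (\<lambda>\<alpha>. c * p \<alpha>) X = op_scaleC c (poly_op p X)"
  by (cases "c = 0") (simp_all add: poly_op_def op_scaleC_op_scaleC op_scaleC_sum_right)

lemma poly_op_zero: "poly_op (\<lambda>\<alpha>. 0) X = 0"
  by (simp add: poly_op_def)

lemma poly_op_add:
  assumes "ps_polynomial p" "ps_polynomial q"
  shows "poly_op (\<lambda>\<alpha>. p \<alpha> + q \<alpha>) X = poly_op p X + poly_op q X"
proof -
  define A where "A = {\<alpha>. p \<alpha> \<noteq> 0} \<union> {\<alpha>. q \<alpha> \<noteq> 0}"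
  have A: "finite A" using assms by (simp add: A_def ps_polynomial_def)
  show ?thesis
    by (subst (1 2 3) poly_op_eq_sum [OF A]) (auto simp: A_def op_scaleC_add_left sum.distrib)
qed

lemma poly_op_sum:
  "(\<And>a. a \<in> A \<Longrightarrow> ps_polynomial (p a)) \<Longrightarrow>
    poly_op (\<lambda>\<alpha>. \<Sum>a\<in>A. p a \<alpha>) X = (\<Sum>a\<in>A. poly_op (p a) X)"
  by (induction A rule: infinite_finite_induct)
    (simp_all add: poly_op_zero poly_op_add ps_polynomial_sum)

lemma poly_op_mult:
  assumes X: "\<And>i. clinear_op (X i)" and "ps_polynomial p" "ps_polynomial q"
  shows "poly_op (ps_mult p q) X = poly_op p X o\<^sub>L poly_op q X"
proof -
  define P where "P = {\<alpha>. p \<alpha> \<noteq> 0}"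
  define Q where "Q = {\<alpha>. q \<alpha> \<noteq> 0}"
  define app where "app z = fst z @ snd z" for z :: "'a list \<times> 'a list"
  have fin: "finite P" "finite Q" using assms by (simp_all add: P_def Q_def ps_polynomial_def)
  have pq: "ps_mult p q \<alpha> = (\<Sum>z\<in>{z\<in>P\<times>Q. app z = \<alpha>}. p (fst z) * q (snd z))" for \<alpha>
    unfolding ps_mult_eq_sum_splits app_def
    by (rule sum.mono_neutral_right [OF finite_splits]) (auto simp: P_def Q_def mem_Times_iff)
  have "poly_op (ps_mult p q) X = (\<Sum>\<alpha>\<in>app ` (P \<times> Q). op_scaleC (ps_mult p q \<alpha>) (op_word X \<alpha>))"
    by (rule poly_op_eq_sum) (use fin in \<open>auto simp: pq intro!: sum.neutral\<close>)
  also have "\<dots> = (\<Sum>\<alpha>\<in>app ` (P \<times> Q). \<Sum>z\<in>{z\<in>P\<times>Q. app z = \<alpha>}.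
      op_scaleC (p (fst z) * q (snd z)) (op_word X (app z)))"
    by (intro sum.cong refl) (simp add: pq op_scaleC_sum_left)
  also have "\<dots> = (\<Sum>z\<in>P\<times>Q. op_scaleC (p (fst z) * q (snd z)) (op_word X (app z)))"
    by (rule sum.group) (use fin in auto)
  also have "\<dots> = (\<Sum>u\<in>P. \<Sum>v\<in>Q. op_scaleC (p u) (op_word X u) o\<^sub>L op_scaleC (q v) (op_word X v))"
    by (simp add: sum.cartesian_product split_beta app_def op_word_append op_scaleC_compose_left
        op_scaleC_compose_right clinear_op_word X op_scaleC_op_scaleC)
  also have "\<dots> = poly_op p X o\<^sub>L poly_op q X"
    by (simp only: poly_op_def P_def Q_def compose_sum_left) (simp only: compose_sum_right)
  finally show ?thesis .
qed

lemma clinear_op_poly_op: "(\<And>i. clinear_op (X i)) \<Longrightarrow> clinear_op (poly_op p X)"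
  unfolding poly_op_def by (intro clinear_op_sum clinear_op_scaleC clinear_op_word)

lemma poly_op_word:
  assumes "\<And>i. clinear_op (X i)" "\<And>i. ps_polynomial (f i)"
  shows "poly_op (ps_word f \<alpha>) X = op_word (\<lambda>i. poly_op (f i) X) \<alpha>"
  by (induction \<alpha>) (simp_all add: poly_op_one poly_op_mult assms ps_polynomial_word)

lemma ps_polynomial_comp:
  assumes "ps_polynomial p" "\<And>i. ps_polynomial (f i)"
  shows "ps_polynomial (ps_comp p f)"
  by (subst ps_comp_eq_sum_polynomial [of "{\<alpha>. p \<alpha> \<noteq> 0}"])
    (use assms in \<open>auto simp: ps_polynomial_def [of p]
      intro!: ps_polynomial_sum ps_polynomial_scale [where c = "\<lambda>_. p _"] ps_polynomial_word\<close>)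

text \<open>For polynomials, substitution can be checked by evaluation at operators, constant terms
  included. This takes the place of formal composition in the case of polynomial
  automorphisms.\<close>

lemma poly_op_comp:
  assumes "\<And>i. clinear_op (X i)" "ps_polynomial p" "\<And>i. ps_polynomial (f i)"
  shows "poly_op (ps_comp p f) X = poly_op p (\<lambda>i. poly_op (f i) X)"
proof -
  have "poly_op (ps_comp p f) X = (\<Sum>\<alpha> | p \<alpha> \<noteq> 0. poly_op (\<lambda>\<beta>. p \<alpha> * ps_word f \<alpha> \<beta>) X)"
    by (subst ps_comp_eq_sum_polynomial [of "{\<alpha>. p \<alpha> \<noteq> 0}"])
      (use assms in \<open>auto simp: ps_polynomial_def [of p]
        intro!: poly_op_sum ps_polynomial_scale ps_polynomial_word\<close>)
  then show ?thesis by (simp add: poly_op_scale poly_op_word assms poly_op_def [of p])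
qed

subsection \<open>Scalar tuples\<close>

text \<open>Scalar points become operator tuples on the one-dimensional Hilbert space, so that the
  row operator estimates apply to them.\<close>

definition scal :: "complex ^ 'n \<Rightarrow> 'n \<Rightarrow> complex \<Rightarrow>\<^sub>L complex" where
  "scal z i = op_scaleC (z $ i) id_blinfun"

lemma clinear_op_scal: "clinear_op (scal z i)"
  by (simp add: scal_def clinear_op_scaleC clinear_op_id)

lemma op_scaleC_id_apply: "blinfun_apply (op_scaleC c id_blinfun) x = c * (x :: complex)"
  by (simp add: scaleC_complex_def)

lemma clinear_op_complex: "clinear_op T \<Longrightarrow> T = op_scaleC (blinfun_apply T 1) (id_blinfun :: complex \<Rightarrow>\<^sub>L complex)"
proof (rule blinfun_eqI)
  fix x assume "clinear_op T"
  then have "blinfun_apply T (x *\<^sub>C 1) = x *\<^sub>C blinfun_apply T 1" by (simp add: clinear_op_def)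
  then show "blinfun_apply T x = blinfun_apply (op_scaleC (blinfun_apply T 1) id_blinfun) x"
    by (simp add: scaleC_complex_def mult.commute)
qed

lemma op_word_scal: "op_word (scal z) \<alpha> = op_scaleC (prod_list (map (\<lambda>i. z $ i) \<alpha>)) id_blinfun"
  by (induction \<alpha>) (simp_all add: scal_def op_scaleC_compose_left op_scaleC_op_scaleC)

lemma poly_scalar_eq: "poly_scalar p z = poly_op p (scal z) 1"
  by (simp add: poly_scalar_def poly_op_def op_word_scal op_scaleC_op_scaleC blinfun.sum_left
      scaleC_complex_def)

lemma row_norm_scal: "row_norm (scal z) = norm z"
proof (rule antisym)
  show "row_norm (scal z) \<le> norm z"
  proof (rule row_norm_le)
    fix v :: "'a \<Rightarrow> complex"
    have "norm (\<Sum>i\<in>UNIV. scal z i (v i)) \<le> (\<Sum>i\<in>UNIV. cmod (z $ i) * cmod (v i))"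
      by (rule sum_norm_le) (simp add: scal_def scaleC_complex_def norm_mult)
    also have "\<dots> \<le> L2_set (\<lambda>i. cmod (z $ i)) UNIV * L2_set (\<lambda>i. cmod (v i)) UNIV"
      using L2_set_mult_ineq [of "\<lambda>i. cmod (z $ i)" "\<lambda>i. cmod (v i)" UNIV] by simp
    finally show "norm (\<Sum>i\<in>UNIV. scal z i (v i))
        \<le> norm z * L2_set (\<lambda>i. norm (v i)) UNIV"
      by (simp add: norm_vec_def)
  qed simp
  \<comment> \<open>The conjugate vector attains equality in the Cauchy-Schwarz inequality.\<close>
  have "(norm z)\<^sup>2 = cmod (\<Sum>i\<in>UNIV. scal z i (cnj (z $ i)))"
  proof -
    have "(\<Sum>i\<in>UNIV. scal z i (cnj (z $ i))) = of_real (\<Sum>i\<in>UNIV. (cmod (z $ i))\<^sup>2)"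
      by (simp add: scal_def scaleC_complex_def complex_norm_square del: of_real_power)
    then show ?thesis
      by (simp add: norm_vec_def L2_set_def sum_nonneg del: of_real_sum of_real_power)
  qed
  also have "\<dots> \<le> row_norm (scal z) * norm z"
    using norm_row_le [of "scal z" "\<lambda>i. cnj (z $ i)"] by (simp add: norm_vec_def)
  finally show "norm z \<le> row_norm (scal z)"
    using row_norm_nonneg [of "scal z"] by (cases "z = 0") (auto simp: power2_eq_square)
qed

section \<open>Left multiplications on square-summable families\<close>

lemma cmod_coord_le: "cmod (coord x i) \<le> norm x"
  by (simp add: norm_ell2_def ell2_coord_le_norm)

lemma bounded_linear_coord: "bounded_linear (\<lambda>x :: 'a ell2. coord x i)"
  by (rule bounded_linear_intro [where K = 1])
    (simp_all add: coord_simps cmod_coord_le scaleR_conv_of_real)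

lemma coord_sum: "coord (\<Sum>a\<in>A. x a) i = (\<Sum>a\<in>A. coord (x a) i)"
  by (induction A rule: infinite_finite_induct) (simp_all add: coord_simps)

lemmas tendsto_coord = bounded_linear.tendsto [OF bounded_linear_coord]
lemmas sums_coord = bounded_linear.sums [OF bounded_linear_coord]

definition ket :: "'a \<Rightarrow> 'a ell2" where
  "ket a = Abs_ell2 (\<lambda>b. if b = a then 1 else 0)"

lemma ell2_seq_finite_support:
  assumes "finite {i. x i \<noteq> 0}"
  shows "ell2_seq x"
  unfolding ell2_seq_def
  by (rule summable_on_cong_neutral [THEN iffD1, OF _ _ _ summable_on_finite [OF assms]]) auto

lemma coord_ket: "coord (ket a) b = (if b = a then 1 else 0)"
proof -
  have "ell2_seq (\<lambda>b. if b = a then 1 else 0)"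
    by (rule ell2_seq_finite_support) simp
  then show ?thesis by (simp add: ket_def coord_Abs_ell2)
qed

lemma norm_ket: "norm (ket a) \<le> 1"
proof -
  have "L2_set (\<lambda>b. cmod (coord (ket a) b)) F \<le> 1" if "finite F" for F
    using that by (simp add: L2_set_def coord_ket if_distrib [of "\<lambda>x. (cmod x)\<^sup>2"] cong: if_cong)
  then show ?thesis unfolding norm_ell2_def by (rule ell2_bound(2))
qed

definition restrict_ell2 :: "'a set \<Rightarrow> 'a ell2 \<Rightarrow> 'a ell2" where
  "restrict_ell2 F x = (\<Sum>a\<in>F. coord x a *\<^sub>C ket a)"

lemma coord_restrict_ell2:
  "finite F \<Longrightarrow> coord (restrict_ell2 F x) b = (if b \<in> F then coord x b else 0)"
  by (simp add: restrict_ell2_def coord_sum coord_scaleC coord_ket if_distrib [of "\<lambda>y. _ * y"]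
      cong: if_cong)

text \<open>The squared norm of the remainder is at most the total square sum minus its part over
  \<open>F\<close>, and this difference tends to zero along the finite sets.\<close>

lemma restrict_ell2_tendsto:
  "((\<lambda>F. restrict_ell2 F x) \<longlongrightarrow> x) (finite_subsets_at_top UNIV)"
proof -
  have has: "((\<lambda>i. (cmod (coord x i))\<^sup>2) has_sum (norm x)\<^sup>2) UNIV"
    using ell2_seq_coord [of x]
    by (simp add: norm_ell2_def ell2_norm_def ell2_seq_def infsum_nonneg has_sum_infsum)
  have bound: "norm (restrict_ell2 F x - x) \<le> sqrt ((norm x)\<^sup>2 - (\<Sum>i\<in>F. (cmod (coord x i))\<^sup>2))"
    if F: "finite F" for F
  proof -
    have "L2_set (\<lambda>i. cmod (coord (restrict_ell2 F x - x) i)) G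
        \<le> sqrt ((norm x)\<^sup>2 - (\<Sum>i\<in>F. (cmod (coord x i))\<^sup>2))" if G: "finite G" for G
    proof -
      have "(\<Sum>i\<in>G. (cmod (coord (restrict_ell2 F x - x) i))\<^sup>2) = (\<Sum>i\<in>G - F. (cmod (coord x i))\<^sup>2)"
        by (rule sum.mono_neutral_cong_right) (auto simp: G F coord_simps coord_restrict_ell2)
      moreover have "(\<Sum>i\<in>F \<union> (G - F). (cmod (coord x i))\<^sup>2) \<le> (norm x)\<^sup>2"
        using F G by (intro has_sum_mono_neutral [OF has_sum_finite has]) auto
      moreover have "(\<Sum>i\<in>F \<union> (G - F). (cmod (coord x i))\<^sup>2)
          = (\<Sum>i\<in>F. (cmod (coord x i))\<^sup>2) + (\<Sum>i\<in>G - F. (cmod (coord x i))\<^sup>2)"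
        using F G by (intro sum.union_disjoint) auto
      ultimately show ?thesis by (simp add: L2_set_def)
    qed
    then show ?thesis unfolding norm_ell2_def [of "restrict_ell2 F x - x"] by (rule ell2_bound(2))
  qed
  have "((\<lambda>F. sqrt ((norm x)\<^sup>2 - (\<Sum>i\<in>F. (cmod (coord x i))\<^sup>2))) \<longlongrightarrow> sqrt ((norm x)\<^sup>2 - (norm x)\<^sup>2))
      (finite_subsets_at_top UNIV)"
    using has unfolding has_sum_def by (intro tendsto_intros)
  then have "((\<lambda>F. restrict_ell2 F x - x) \<longlongrightarrow> 0) (finite_subsets_at_top UNIV)"
    by (intro Lim_null_comparison [OF eventually_finite_subsets_at_top_weakI [OF bound]]) simp_all
  then show ?thesis by (rule LIM_zero_cancel)
qed

text \<open>The index type \<open>'b\<close> contains the words through an injection \<open>enc\<close>: the case \<open>enc = id\<close> is the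
  model space, the case \<open>'b = nat\<close> serves to evaluate free holomorphic functions.\<close>

definition row_shift :: "('n list \<Rightarrow> 'b) \<Rightarrow> ('n \<Rightarrow> 'b ell2) \<Rightarrow> 'b \<Rightarrow> complex" where
  "row_shift enc v b =
    (if b \<in> range enc then case inv enc b of [] \<Rightarrow> 0 | j # \<beta> \<Rightarrow> coord (v j) (enc \<beta>) else 0)"

lemma row_shift_enc:
  "inj enc \<Longrightarrow> row_shift enc v (enc \<alpha>) = (case \<alpha> of [] \<Rightarrow> 0 | j # \<beta> \<Rightarrow> coord (v j) (enc \<beta>))"
  by (simp add: row_shift_def)

text \<open>Words with different first letters are different, so the shifted vectors occupy disjoint
  sets of coordinates and their square sums add up. In operator terms, the shifts have orthogonal
  ranges.\<close>

lemma row_shift_bound: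
  fixes enc :: "'n::finite list \<Rightarrow> 'b"
  assumes "inj enc"
  shows "ell2_seq (row_shift enc v)" "ell2_norm (row_shift enc v) \<le> L2_set (\<lambda>j. norm (v j)) UNIV"
proof -
  have *: "L2_set (\<lambda>b. cmod (row_shift enc v b)) F \<le> L2_set (\<lambda>j. norm (v j)) UNIV"
    if F: "finite F" for F
  proof -
    define F' where "F' = {\<alpha>. \<alpha> \<noteq> [] \<and> enc \<alpha> \<in> F}"
    define T where "T = tl ` F'"
    define G where "G z = (cmod (coord (v (fst z)) (enc (snd z))))\<^sup>2" for z
    have "finite (enc -` F)" using F assms by (rule finite_vimageI)
    then have F': "finite F'" by (rule rev_finite_subset) (auto simp: F'_def)
    have "(\<Sum>b\<in>F. (cmod (row_shift enc v b))\<^sup>2) = (\<Sum>b\<in>enc ` F'. (cmod (row_shift enc v b))\<^sup>2)"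
    proof (rule sum.mono_neutral_right [OF F])
      show "\<forall>b\<in>F - enc ` F'. (cmod (row_shift enc v b))\<^sup>2 = 0"
      proof
        fix b assume b: "b \<in> F - enc ` F'"
        show "(cmod (row_shift enc v b))\<^sup>2 = 0"
        proof (cases "b \<in> range enc")
          case True
          then obtain \<alpha> where "b = enc \<alpha>" by auto
          with b have "\<alpha> = []" by (auto simp: F'_def)
          with \<open>b = enc \<alpha>\<close> show ?thesis by (simp add: row_shift_enc assms)
        qed (simp add: row_shift_def)
      qed
    qed (auto simp: F'_def)
    also have "\<dots> = (\<Sum>\<alpha>\<in>F'. G (hd \<alpha>, tl \<alpha>))"
      using assms
      by (subst sum.reindex)
        (auto simp: inj_on_def row_shift_enc F'_def G_def neq_Nil_conv intro!: sum.cong)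
    also have "\<dots> = (\<Sum>z\<in>(\<lambda>\<alpha>. (hd \<alpha>, tl \<alpha>)) ` F'. G z)"
      by (subst sum.reindex) (auto simp: inj_on_def F'_def intro: list.expand)
    also have "\<dots> \<le> (\<Sum>z\<in>UNIV \<times> T. G z)"
      by (rule sum_mono2) (auto simp: G_def T_def F')
    also have "\<dots> = (\<Sum>j\<in>UNIV. \<Sum>\<gamma>\<in>T. G (j, \<gamma>))"
      by (simp add: sum.cartesian_product)
    also have "\<dots> \<le> (\<Sum>j\<in>UNIV. (norm (v j))\<^sup>2)"
    proof (rule sum_mono)
      fix j
      have "(\<Sum>\<gamma>\<in>T. G (j, \<gamma>)) = (\<Sum>b\<in>enc ` T. (cmod (coord (v j) b))\<^sup>2)"
        using assms by (subst sum.reindex) (auto simp: G_def inj_on_def)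
      also have "\<dots> \<le> (norm (v j))\<^sup>2"
        using L2_set_le_ell2_norm [OF ell2_seq_coord, of "enc ` T" "v j"]
        unfolding L2_set_def norm_ell2_def by (intro sqrt_le_D) (simp add: F' T_def)
      finally show "(\<Sum>\<gamma>\<in>T. G (j, \<gamma>)) \<le> (norm (v j))\<^sup>2" .
    qed
    finally show ?thesis by (simp add: L2_set_def)
  qed
  show "ell2_seq (row_shift enc v)" "ell2_norm (row_shift enc v) \<le> L2_set (\<lambda>j. norm (v j)) UNIV"
    using ell2_bound [OF *] by auto
qed

text \<open>The left creation operator transported along \<open>enc\<close>. Coordinates outside
  \<open>range enc\<close> are discarded, so it acts on the whole space over
  \<open>'b\<close>.\<close>

definition lshift :: "('n::finite list \<Rightarrow> 'b) \<Rightarrow> 'n \<Rightarrow> 'b ell2 \<Rightarrow>\<^sub>L 'b ell2" where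
  "lshift enc i = Blinfun (\<lambda>x. Abs_ell2 (row_shift enc (\<lambda>j. if j = i then x else 0)))"

lemma coord_lshift_raw:
  fixes enc :: "'n::finite list \<Rightarrow> 'b"
  assumes "inj enc"
  shows "coord (lshift enc i x) = row_shift enc (\<lambda>j. if j = i then x else 0)"
proof -
  let ?f = "\<lambda>x. Abs_ell2 (row_shift enc (\<lambda>j. if j = i then x else 0))"
  have c: "coord (?f x) = row_shift enc (\<lambda>j. if j = i then x else 0)" for x
    by (rule coord_Abs_ell2 [OF row_shift_bound(1) [OF assms]])
  have "bounded_linear ?f"
  proof (rule bounded_linear_intro [where K = 1])
    show "?f (x + y) = ?f x + ?f y" for x y
      by (rule ell2_eqI)
        (auto simp: coord_plus c row_shift_def coord_zero split: list.split)
    show "?f (r *\<^sub>R x) = r *\<^sub>R ?f x" for r x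
      by (rule ell2_eqI)
        (auto simp: coord_scaleR c row_shift_def coord_zero split: list.split)
    show "norm (?f x) \<le> norm x * 1" for x
    proof -
      have "L2_set (\<lambda>j. norm (if j = i then x else 0)) UNIV = norm x"
        by (simp add: L2_set_def if_distrib [of "\<lambda>y. (norm y)\<^sup>2"] cong: if_cong)
      then show ?thesis
        using row_shift_bound(2) [OF assms, of "\<lambda>j. if j = i then x else 0"]
        by (simp add: norm_ell2_def c)
    qed
  qed
  then show ?thesis by (simp add: lshift_def bounded_linear_Blinfun_apply c)
qed

lemma coord_lshift:
  fixes enc :: "'n::finite list \<Rightarrow> 'b"
  assumes "inj enc"
  shows "coord (lshift enc i x) (enc \<alpha>)
    = (case \<alpha> of [] \<Rightarrow> 0 | j # \<beta> \<Rightarrow> if j = i then coord x (enc \<beta>) else 0)"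
  by (auto simp: coord_lshift_raw row_shift_enc assms coord_zero split: list.split)

lemma clinear_op_lshift:
  fixes enc :: "'n::finite list \<Rightarrow> 'b"
  assumes "inj enc"
  shows "clinear_op (lshift enc i)"
  unfolding clinear_op_def
  by (intro allI ell2_eqI)
    (auto simp: coord_lshift_raw assms coord_scaleC row_shift_def coord_zero split: list.split)

lemma row_norm_lshift:
  fixes enc :: "'n::finite list \<Rightarrow> 'b"
  assumes "inj enc"
  shows "row_norm (lshift enc) \<le> 1"
proof (rule row_norm_le)
  fix v :: "'n \<Rightarrow> 'b ell2"
  have "coord (\<Sum>i\<in>UNIV. lshift enc i (v i)) = row_shift enc v"
  proof
    fix b
    have *: "coord (if j = i then v i else 0) c = (if j = i then coord (v j) c else 0)" for i j c
      by (simp add: coord_zero)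
    show "coord (\<Sum>i\<in>UNIV. lshift enc i (v i)) b = row_shift enc v b"
      by (simp add: coord_sum coord_lshift_raw assms row_shift_def * split: list.split)
  qed
  then show "norm (\<Sum>i\<in>UNIV. lshift enc i (v i))
      \<le> 1 * L2_set (\<lambda>i. norm (v i)) UNIV"
    using row_shift_bound(2) [OF assms, of v] by (simp add: norm_ell2_def)
qed simp

text \<open>\<open>t\<close> is the symbol of \<open>T\<close> as a left multiplication operator on
  the Fock space. Only coordinates that encode words are compared, so the symbol determines the
  operator when \<open>enc\<close> is the identity, but in general not otherwise.\<close>

definition lmul :: "('n list \<Rightarrow> 'b) \<Rightarrow> ('b ell2 \<Rightarrow>\<^sub>L 'b ell2) \<Rightarrow> 'n ncps \<Rightarrow> bool" where
  "lmul enc T t \<longleftrightarrow> (\<forall>x \<beta>. coord (T x) (enc \<beta>) = ps_mult t (\<lambda>\<alpha>. coord x (enc \<alpha>)) \<beta>)"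

lemma lmul_apply: "lmul enc T t \<Longrightarrow> coord (T x) (enc \<beta>) = ps_mult t (\<lambda>\<alpha>. coord x (enc \<alpha>)) \<beta>"
  by (simp add: lmul_def)

lemma lmul_lshift:
  fixes enc :: "'n::finite list \<Rightarrow> 'b"
  shows "inj enc \<Longrightarrow> lmul enc (lshift enc i) (ps_var i)"
  by (simp add: lmul_def coord_lshift ps_mult_var_left)

lemma lmul_id: "lmul enc id_blinfun ps_one"
  by (simp add: lmul_def ps_mult_one_left)

lemma lmul_zero: "lmul enc 0 (\<lambda>_. 0)"
  by (simp add: lmul_def ps_mult_zero_left coord_zero)

lemma lmul_add: "lmul enc S s \<Longrightarrow> lmul enc T t \<Longrightarrow> lmul enc (S + T) (\<lambda>\<alpha>. s \<alpha> + t \<alpha>)"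
  by (simp add: lmul_def blinfun.add_left coord_plus ps_mult_add_left)

lemma lmul_scaleC: "lmul enc T t \<Longrightarrow> lmul enc (op_scaleC c T) (\<lambda>\<alpha>. c * t \<alpha>)"
  by (simp add: lmul_def coord_scaleC ps_mult_scale_left)

lemma lmul_sum:
  "(\<And>a. a \<in> A \<Longrightarrow> lmul enc (T a) (t a)) \<Longrightarrow> lmul enc (\<Sum>a\<in>A. T a) (\<lambda>\<alpha>. \<Sum>a\<in>A. t a \<alpha>)"
  by (induction A rule: infinite_finite_induct) (simp_all add: lmul_zero lmul_add)

lemma lmul_compose: "lmul enc S s \<Longrightarrow> lmul enc T t \<Longrightarrow> lmul enc (S o\<^sub>L T) (ps_mult s t)"
  by (simp add: lmul_def ps_mult_assoc)

lemma lmul_op_word: "(\<And>i. lmul enc (X i) (t i)) \<Longrightarrow> lmul enc (op_word X \<alpha>) (ps_word t \<alpha>)"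
  by (induction \<alpha>) (simp_all add: lmul_id lmul_compose)

lemma lmul_hom_part:
  "(\<And>i. lmul enc (X i) (t i)) \<Longrightarrow>
    lmul enc (hom_part p X k) (\<lambda>\<beta>. \<Sum>\<alpha> | length \<alpha> = k. p \<alpha> * ps_word t \<alpha> \<beta>)"
  unfolding hom_part_def by (intro lmul_sum lmul_scaleC lmul_op_word)

lemma lmul_poly_op:
  "ps_polynomial p \<Longrightarrow> (\<And>i. lmul enc (X i) (t i)) \<Longrightarrow> lmul enc (poly_op p X) (ps_comp p t)"
  by (subst ps_comp_eq_sum_polynomial [of "{\<alpha>. p \<alpha> \<noteq> 0}"])
    (auto simp: ps_polynomial_def poly_op_def intro!: lmul_sum lmul_scaleC lmul_op_word)

text \<open>The vacuum vector represents the series 1, and multiplying 1 by the symbol returns the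
  symbol.\<close>

lemma lmul_symbol:
  assumes "inj enc" "lmul enc T t"
  shows "coord (T (ket (enc []))) (enc \<beta>) = t \<beta>"
proof -
  have "(\<lambda>\<alpha>. coord (ket (enc [])) (enc \<alpha>)) = ps_one"
    using assms(1) by (auto simp: coord_ket ps_one_def inj_eq)
  then show ?thesis using assms(2) by (simp add: lmul_apply ps_mult_one_right)
qed

lemma lmul_symbol_id: "lmul id T t \<Longrightarrow> coord (T (ket [])) = t"
  using lmul_symbol [of id T t] by auto

lemma lmul_unique:
  assumes "lmul id S t" "lmul id T t"
  shows "S = T"
  by (rule blinfun_eqI, rule ell2_eqI) (use lmul_apply [OF assms(1)] lmul_apply [OF assms(2)] in simp)

lemma lmul_sums_symbol:
  assumes "inj enc" "T sums T'" "\<And>k. lmul enc (T k) (t k)"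
  shows "(\<lambda>k. t k \<beta>) sums coord (T' (ket (enc []))) (enc \<beta>)"
  using sums_coord [OF sums_blinfun_apply [OF assms(2)], of "ket (enc [])" "enc \<beta>"]
  by (simp add: lmul_symbol [OF assms(1,3)])

text \<open>A coefficient of a product involves only finitely many coefficients of the symbol, so
  coefficientwise convergence of the symbols is enough.\<close>

lemma lmul_sums:
  assumes "T sums T'" "\<And>k. lmul enc (T k) (t k)" "\<And>\<beta>. (\<lambda>k. t k \<beta>) sums s \<beta>"
  shows "lmul enc T' s"
  unfolding lmul_def
proof (intro allI)
  fix x \<beta>
  have "(\<lambda>k. coord (T k x) (enc \<beta>)) sums coord (T' x) (enc \<beta>)"
    by (rule sums_coord [OF sums_blinfun_apply [OF assms(1)]])
  moreover have "(\<lambda>k. ps_mult (t k) (\<lambda>\<alpha>. coord x (enc \<alpha>)) \<beta>)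
      sums ps_mult s (\<lambda>\<alpha>. coord x (enc \<alpha>)) \<beta>"
    unfolding ps_mult_def by (intro sums_sum sums_mult2 assms(3))
  ultimately show "coord (T' x) (enc \<beta>) = ps_mult s (\<lambda>\<alpha>. coord x (enc \<alpha>)) \<beta>"
    using sums_unique2 by (simp add: lmul_apply [OF assms(2)]) blast
qed

lemma ps_word_var: "ps_word ps_var \<alpha> \<beta> = (if \<beta> = \<alpha> then 1 else 0)"
  by (induction \<alpha> arbitrary: \<beta>)
    (auto simp: ps_one_def ps_mult_var_left split: list.split)

text \<open>A word in the shifts multiplies by the monomial of that word. Evaluation at scaled
  shifts therefore cuts out one homogeneous component of \<open>p\<close> and dilates it.\<close>

lemma lmul_hom_part_lshift:
  fixes enc :: "'n::finite list \<Rightarrow> 'b"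
  assumes "inj enc"
  shows "lmul enc (hom_part p (\<lambda>i. op_scaleC c (lshift enc i)) k)
    (\<lambda>\<beta>. if length \<beta> = k then c ^ length \<beta> * p \<beta> else 0)"
proof -
  have "lmul enc (hom_part p (lshift enc) k)
      (\<lambda>\<beta>. \<Sum>\<alpha> | length \<alpha> = k. p \<alpha> * ps_word ps_var \<alpha> \<beta>)"
    by (rule lmul_hom_part) (rule lmul_lshift [OF assms])
  moreover have "(\<Sum>\<alpha> | length \<alpha> = k. p \<alpha> * ps_word ps_var \<alpha> \<beta>)
      = (if length \<beta> = k then p \<beta> else 0)" for \<beta>
    by (simp add: ps_word_var if_distrib [of "\<lambda>y. _ * y"] sum.delta' finite_length_eq cong: if_cong)
  ultimately have "lmul enc (hom_part p (lshift enc) k) (\<lambda>\<beta>. if length \<beta> = k then p \<beta> else 0)"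
    by simp
  from lmul_scaleC [OF this, of "c ^ k"] show ?thesis
    by (simp add: hom_part_scaleC clinear_op_lshift assms if_distrib [of "\<lambda>y. _ * y"] cong: if_cong)
qed

lemma lmul_ps_eval_lshift:
  fixes enc :: "'n::finite list \<Rightarrow> 'b"
  assumes "inj enc" "hom_part p (\<lambda>i. op_scaleC c (lshift enc i)) sums T"
  shows "lmul enc T (\<lambda>\<beta>. c ^ length \<beta> * p \<beta>)"
  by (rule lmul_sums [OF assms(2) lmul_hom_part_lshift [OF assms(1)]])
    (use sums_single [of "length _" "\<lambda>_. c ^ length _ * p _"] in \<open>simp add: eq_commute\<close>)

lemma lmul_poly_op_lshift:
  fixes enc :: "'n::finite list \<Rightarrow> 'b"
  assumes "inj enc" "ps_polynomial p"
  shows "lmul enc (poly_op p (lshift enc)) p"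
  using lmul_ps_eval_lshift [OF assms(1), of p 1] hom_part_sums_poly_op [OF assms(2), of "lshift enc"]
  by simp

abbreviation creation :: "'n::finite \<Rightarrow> 'n list ell2 \<Rightarrow>\<^sub>L 'n list ell2" where
  "creation \<equiv> lshift id"

lemmas clinear_op_creation = clinear_op_lshift [OF inj_on_id]
lemmas row_norm_creation = row_norm_lshift [OF inj_on_id]

text \<open>The vacuum vector reads off all coefficients, so the creation operators satisfy no
  polynomial identity.\<close>

lemma poly_op_creation_inject:
  fixes p :: "'n::finite ncps"
  assumes "ps_polynomial p" "ps_polynomial q" "poly_op p creation = poly_op q creation"
  shows "p = q"
proof -
  have "coord (poly_op p creation (ket [])) = p" "coord (poly_op q creation (ket [])) = q"
    using assms(1,2) by (simp_all only: lmul_symbol_id [OF lmul_poly_op_lshift [OF inj_on_id]])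
  then show ?thesis using assms(3) by metis
qed

text \<open>Each coefficient of a product with \<open>t\<close> depends on finitely many coordinates
  of \<open>x\<close>, so both sides are continuous in \<open>x\<close> even if \<open>t\<close> is
  not square summable; agreement on the basis extends through finite truncations.\<close>

lemma lmul_from_basis:
  fixes T :: "'n::finite list ell2 \<Rightarrow>\<^sub>L 'n list ell2"
  assumes "clinear_op T" "\<And>\<alpha>. coord (T (ket \<alpha>)) = ps_mult t (coord (ket \<alpha>))"
  shows "lmul id T t"
  unfolding lmul_def
proof (intro allI)
  fix x \<beta>
  have coords: "ps_mult t (coord x) \<beta> = (\<Sum>k\<le>length \<beta>. t (take k \<beta>) * coord x (drop k \<beta>))" for x
    by (simp add: ps_mult_def)
  have fin: "coord (T (restrict_ell2 F x)) \<beta> = ps_mult t (coord (restrict_ell2 F x)) \<beta>"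
    if "finite F" for F
  proof -
    have "T (restrict_ell2 F x) = (\<Sum>a\<in>F. coord x a *\<^sub>C T (ket a))"
      using assms(1) by (simp add: restrict_ell2_def blinfun.sum_right clinear_op_def)
    then have "coord (T (restrict_ell2 F x)) \<beta> = (\<Sum>a\<in>F. coord x a * ps_mult t (coord (ket a)) \<beta>)"
      by (simp add: coord_sum coord_scaleC assms(2))
    also have "\<dots> = ps_mult t (coord (restrict_ell2 F x)) \<beta>"
      by (simp add: ps_mult_def restrict_ell2_def coord_sum coord_scaleC sum_distrib_left mult_ac)
         (rule sum.swap)
    finally show ?thesis .
  qed
  have "((\<lambda>F. coord (T (restrict_ell2 F x)) \<beta>) \<longlongrightarrow> coord (T x) \<beta>) (finite_subsets_at_top UNIV)"
    by (intro tendsto_coord bounded_linear.tendsto [OF blinfun.bounded_linear_right]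
        restrict_ell2_tendsto)
  moreover have "((\<lambda>F. ps_mult t (coord (restrict_ell2 F x)) \<beta>) \<longlongrightarrow> ps_mult t (coord x) \<beta>)
      (finite_subsets_at_top UNIV)"
    unfolding coords by (intro tendsto_sum tendsto_mult tendsto_const tendsto_coord restrict_ell2_tendsto)
  then have "((\<lambda>F. coord (T (restrict_ell2 F x)) \<beta>) \<longlongrightarrow> ps_mult t (coord x) \<beta>)
      (finite_subsets_at_top UNIV)"
    by (rule Lim_transform_eventually)
      (auto intro!: eventually_finite_subsets_at_top_weakI simp: fin)
  ultimately show "coord (T x) (id \<beta>) = ps_mult t (\<lambda>\<alpha>. coord x (id \<alpha>)) \<beta>"
    using tendsto_unique [OF finite_subsets_at_top_neq_bot] by fastforce
qed

text \<open>\<open>dilation r x\<close> is the left multiplication by \<open>\<Sum> r\<^bsup>|\<alpha>|\<^esup> x\<^sub>\<alpha> Z\<^sub>\<alpha>\<close>. Its operator norm is controlled by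
  the Hilbert space norm of \<open>x\<close>, which turns strong into norm convergence.\<close>

definition dilation :: "real \<Rightarrow> 'n::finite list ell2 \<Rightarrow> ('n list ell2 \<Rightarrow>\<^sub>L 'n list ell2)" where
  "dilation r x = ps_eval (coord x) (\<lambda>i. op_scaleC r (creation i))"

context
  fixes r :: real
  assumes r: "0 \<le> r" "r < 1"
begin

lemma norm_hom_part_dilation:
  "norm (hom_part (coord x) (\<lambda>i. op_scaleC r (creation i)) k) \<le> norm x * r ^ k"
proof -
  have "row_norm (\<lambda>i :: 'a. op_scaleC r (creation i)) \<le> r"
    using order_trans [OF row_norm_scaleC_le [of "of_real r" "creation :: 'a \<Rightarrow> _"]
        mult_left_mono [OF row_norm_creation]] r
    by simp
  then have "norm x * row_norm (\<lambda>i :: 'a. op_scaleC r (creation i)) ^ k \<le> norm x * r ^ k"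
    by (intro mult_left_mono power_mono) (simp_all add: row_norm_nonneg)
  moreover have "norm (hom_part (coord x) (\<lambda>i. op_scaleC r (creation i)) k)
      \<le> ell2_norm (coord x) * row_norm (\<lambda>i :: 'a. op_scaleC r (creation i)) ^ k"
    by (rule norm_hom_part_ell2_le) (simp_all add: clinear_op_scaleC clinear_op_creation ell2_seq_coord)
  ultimately show ?thesis by (simp add: norm_ell2_def)
qed

lemma summable_dilation:
  "summable (\<lambda>k. norm (hom_part (coord x) (\<lambda>i. op_scaleC r (creation i)) k))"
  by (rule summable_comparison_test' [where g = "\<lambda>k. norm x * r ^ k"])
    (use r norm_hom_part_dilation in \<open>auto intro!: summable_mult summable_geometric\<close>)

lemma hom_part_sums_dilation:
  "hom_part (coord x) (\<lambda>i. op_scaleC r (creation i)) sums dilation r x"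
  unfolding dilation_def by (rule hom_part_sums_ps_eval [OF summable_dilation])

lemma lmul_dilation: "lmul id (dilation r x) (\<lambda>\<beta>. of_real r ^ length \<beta> * coord x \<beta>)"
  by (rule lmul_ps_eval_lshift [OF inj_on_id hom_part_sums_dilation])

text \<open>Creation operators scaled by \<open>r\<close> have row norm at most \<open>r\<close>;
  the constant \<open>1 / (1 - r)\<close> sums the resulting geometric bounds of the homogeneous
  parts.\<close>

lemma bounded_linear_dilation: "bounded_linear (dilation r)"
proof (rule bounded_linear_intro [where K = "1 / (1 - r)"])
  fix x y :: "'a list ell2" and s :: real
  show "dilation r (x + y) = dilation r x + dilation r y"
    by (rule lmul_unique [OF lmul_dilation])
      (use lmul_add [OF lmul_dilation lmul_dilation, of x y] in \<open>simp add: coord_plus distrib_left\<close>)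
  show "dilation r (s *\<^sub>R x) = s *\<^sub>R dilation r x"
    by (rule lmul_unique [OF lmul_dilation])
      (use lmul_scaleC [OF lmul_dilation, of "of_real s" x]
       in \<open>simp add: coord_scaleR op_scaleC_of_real mult_ac\<close>)
  have "norm (dilation r x)
      \<le> (\<Sum>k. norm (hom_part (coord x) (\<lambda>i. op_scaleC r (creation i)) k))"
    unfolding dilation_def ps_eval_def by (rule summable_norm [OF summable_dilation])
  also have "\<dots> \<le> (\<Sum>k. norm x * r ^ k)"
    by (rule suminf_le [OF norm_hom_part_dilation summable_dilation])
       (use r in \<open>auto intro!: summable_mult summable_geometric\<close>)
  also have "\<dots> = norm x * (1 / (1 - r))"
    using r by (simp add: suminf_mult suminf_geometric)
  finally show "norm (dilation r x) \<le> norm x * (1 / (1 - r))" .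
qed

text \<open>The vector \<open>T (ket [])\<close> carries the whole symbol \<open>t\<close>, from
  which \<open>dilation r\<close> rebuilds the operator with the dilated symbol. Thus
  \<open>T'\<close> depends norm-continuously on one vector, which is how strong limits become norm
  limits.\<close>

lemma dilation_lmul:
  assumes "lmul id T t" "lmul id T' (\<lambda>\<beta>. of_real r ^ length \<beta> * t \<beta>)"
  shows "dilation r (T (ket [])) = T'"
  by (rule lmul_unique [OF lmul_dilation]) (simp add: lmul_symbol_id [OF assms(1)] assms(2))

end

section \<open>The universal model as a tuple of left multiplications\<close>

lemma ps_polynomial_coord_ket: "ps_polynomial (coord (ket \<alpha>))"
  unfolding ps_polynomial_def by (rule finite_subset [of _ "{\<alpha>}"]) (auto simp: coord_ket)

lemma model_A_lmul:
  fixes f g :: "'n::finite \<Rightarrow> 'n ncps"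
  assumes "clinear_op (M i)" "model_A f g M"
  shows "lmul id (M i) (g i)"
proof (rule lmul_from_basis [OF assms(1)])
  fix \<alpha> :: "'n list"
  have pf: "ps_polynomial (f j)" and pg: "ps_polynomial (g j)"
    and fg: "ps_comp (f j) g = ps_var j" for j
    using assms(2) by (auto simp: model_A_def)
  define G where "G j = poly_op (g j) creation" for j
  define x where "x = coord (ket \<alpha>)"
  define y where "y = coord (M i (ket \<alpha>))"
  have x: "ps_polynomial x" by (simp add: x_def ps_polynomial_coord_ket)
  then have y: "ps_polynomial y" "ps_comp y f = ps_mult (ps_var i) (ps_comp x f)"
    using assms(2) by (auto simp: model_A_def x_def y_def)
  have G: "clinear_op (G j)" for j
    unfolding G_def by (rule clinear_op_poly_op) (rule clinear_op_creation)
  have FG: "(\<lambda>j. poly_op (f j) G) = creation"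
  proof
    fix j
    have "poly_op (ps_comp (f j) g) creation = poly_op (f j) G"
      unfolding G_def by (rule poly_op_comp [OF clinear_op_creation pf pg])
    then show "poly_op (f j) G = creation j" by (simp add: fg poly_op_var)
  qed
  have "poly_op y creation = poly_op (ps_comp y f) G"
    by (simp add: poly_op_comp [OF G y(1) pf] FG)
  also have "\<dots> = G i o\<^sub>L poly_op (ps_comp x f) G"
    by (simp add: y(2) poly_op_mult [OF G ps_polynomial_var ps_polynomial_comp [OF x pf]] poly_op_var)
  also have "\<dots> = poly_op (ps_mult (g i) x) creation"
    by (simp add: poly_op_comp [OF G x pf] FG poly_op_mult [OF clinear_op_creation pg x])
       (simp add: G_def)
  finally show "y = ps_mult (g i) x"
    by (intro poly_op_creation_inject y ps_polynomial_mult pg x)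
qed

text \<open>The symbol of f(M) is \<open>ps_comp (f j) g = ps_var j\<close>, that of a creation
  operator, and the series is a finite sum.\<close>

lemma model_A_value:
  assumes "\<And>i. lmul id (M i) (g i)" "model_A f g M"
  shows "has_value f M creation"
proof -
  have "hom_part (f j) M sums creation j" for j
  proof -
    have f: "ps_polynomial (f j)" "ps_comp (f j) g = ps_var j"
      using assms(2) by (auto simp: model_A_def)
    have "lmul id (poly_op (f j) M) (ps_var j)"
      using lmul_poly_op [of "f j" id M g, OF f(1) assms(1)] by (simp add: f(2))
    then have "poly_op (f j) M = creation j"
      by (rule lmul_unique [OF _ lmul_lshift [OF inj_on_id]])
    with hom_part_sums_poly_op [OF f(1), of M] show ?thesis by simp
  qed
  then show ?thesis by (simp add: has_value_def sot_value_def sums_blinfun_apply)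
qed

section \<open>Formal power series\<close>

lemma model_S_unique:
  fixes f g :: "'n::finite \<Rightarrow> 'n ncps"
  assumes "model_S f g M" "ps_comp p f = ps_comp q f"
  shows "p = q"
proof -
  have f0: "f i [] = 0" and gf: "ps_comp (g i) f = ps_var i" for i
    using assms(1) by (auto simp: model_S_def)
  have "(\<lambda>\<alpha>. p \<alpha> - q \<alpha>) = (\<lambda>_. 0)"
    by (rule ps_comp_eq_0D [of f g, OF f0 gf])
      (simp add: fun_eq_iff ps_comp_diff [of f, OF f0] assms(2))
  then show ?thesis by (simp add: fun_eq_iff)
qed

text \<open>Composition with \<open>f\<close> is an injective homomorphism sending
  \<open>g i\<close> to \<open>ps_var i\<close> and \<open>ps_var j\<close> to \<open>f j\<close>.
  Pulled back along it, multiplication by an indeterminate is multiplication by \<open>g i\<close>,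
  and multiplication by \<open>f j\<close> is a creation operator.\<close>

lemma model_S_lmul:
  fixes f g :: "'n::finite \<Rightarrow> 'n ncps"
  assumes "model_S f g M"
  shows "lmul id (M i) (g i)" "has_value f M creation"
proof -
  have f0: "f i [] = 0" and gf: "ps_comp (g i) f = ps_var i" for i
    using assms by (auto simp: model_S_def)
  have "coord (M i x) = ps_mult (g i) (coord x)" for i x
  proof (rule model_S_unique [OF assms])
    have "ps_comp (coord (M i x)) f = ps_mult (ps_var i) (ps_comp (coord x) f)"
      using assms unfolding model_S_def by blast
    then show "ps_comp (coord (M i x)) f = ps_comp (ps_mult (g i) (coord x)) f"
      by (simp only: ps_comp_mult [of f, OF f0] gf)
  qed
  then show "lmul id (M i) (g i)" by (simp add: lmul_def)
  obtain N where N: "\<And>j x. ps_comp (coord (blinfun_apply (N j) x)) f = ps_mult (f j) (ps_comp (coord x) f)"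
    "has_value f M N"
    using assms unfolding model_S_def by blast
  have "coord (N j x) = ps_mult (ps_var j) (coord x)" for j x
    by (rule model_S_unique [OF assms])
      (simp only: ps_comp_mult [of f, OF f0] ps_comp_var [of f, OF f0] N)
  then have "lmul id (N j) (ps_var j)" for j by (simp add: lmul_def)
  then have "N j = creation j" for j
    by (rule lmul_unique [OF _ lmul_lshift [OF inj_on_id]])
  with N(2) show "has_value f M creation" by (metis ext)
qed

section \<open>Free holomorphic functions\<close>

lemma ps_mult_ket:
  "ps_mult p (coord (ket \<beta>)) \<alpha>
    = (if \<exists>u. \<alpha> = u @ \<beta> then p (take (length \<alpha> - length \<beta>) \<alpha>) else 0)"
proof (cases "\<exists>u. \<alpha> = u @ \<beta>")
  case True
  then obtain u where u: "\<alpha> = u @ \<beta>" by blast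
  have "(\<Sum>k\<le>length \<alpha>. p (take k \<alpha>) * coord (ket \<beta>) (drop k \<alpha>))
      = (\<Sum>k\<in>{length u}. p (take k \<alpha>) * coord (ket \<beta>) (drop k \<alpha>))"
  proof (rule sum.mono_neutral_right)
    show "\<forall>k\<in>{..length \<alpha>} - {length u}. p (take k \<alpha>) * coord (ket \<beta>) (drop k \<alpha>) = 0"
    proof
      fix k assume k: "k \<in> {..length \<alpha>} - {length u}"
      have "length (drop k \<alpha>) \<noteq> length \<beta>" using k by (auto simp: u)
      then show "p (take k \<alpha>) * coord (ket \<beta>) (drop k \<alpha>) = 0" by (auto simp: coord_ket)
    qed
  qed (auto simp: u)
  then show ?thesis by (simp add: ps_mult_def u coord_ket)
next
  case False
  then have "drop k \<alpha> \<noteq> \<beta>" for k by (metis append_take_drop_id)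
  then show ?thesis using False by (simp add: ps_mult_def coord_ket)
qed

text \<open>Right multiplication by a word relabels coefficients injectively. A product with an
  arbitrary square-summable series offers no such guarantee, so multiplications are tested on basis
  vectors.\<close>

lemma ell2_seq_mult_ket:
  assumes "ell2_seq p"
  shows "ell2_seq (ps_mult p (coord (ket \<beta>)))"
proof (rule ell2_bound(1))
  fix F :: "'a list set" assume F: "finite F"
  define U where "U = {u. u @ \<beta> \<in> F}"
  have "finite U"
    using finite_vimageI [OF F, of "\<lambda>u. u @ \<beta>"] by (simp add: U_def vimage_def inj_def)
  have "(\<Sum>\<alpha>\<in>F. (cmod (ps_mult p (coord (ket \<beta>)) \<alpha>))\<^sup>2)
      = (\<Sum>\<alpha>\<in>(\<lambda>u. u @ \<beta>) ` U. (cmod (ps_mult p (coord (ket \<beta>)) \<alpha>))\<^sup>2)"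
    by (rule sum.mono_neutral_right [OF F]) (auto simp: U_def ps_mult_ket)
  also have "\<dots> = (\<Sum>u\<in>U. (cmod (p u))\<^sup>2)"
    by (subst sum.reindex) (auto simp: inj_on_def ps_mult_ket)
  finally show "L2_set (\<lambda>\<alpha>. cmod (ps_mult p (coord (ket \<beta>)) \<alpha>)) F \<le> ell2_norm p"
    using L2_set_le_ell2_norm [OF assms \<open>finite U\<close>] by (simp add: L2_set_def)
qed

lemma hom_part_mult_ket:
  fixes Y :: "'n::finite \<Rightarrow> 'h::chilbert \<Rightarrow>\<^sub>L 'h"
  assumes Y: "\<And>i. clinear_op (Y i)"
  shows "hom_part (ps_mult p (coord (ket \<beta>))) Y (k + length \<beta>) = hom_part p Y k o\<^sub>L op_word Y \<beta>"
proof -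
  let ?q = "ps_mult p (coord (ket \<beta>))"
  have "hom_part ?q Y (k + length \<beta>)
      = (\<Sum>\<alpha>\<in>(\<lambda>u. u @ \<beta>) ` {u. length u = k}. op_scaleC (?q \<alpha>) (op_word Y \<alpha>))"
    unfolding hom_part_def
    by (rule sum.mono_neutral_right [OF finite_length_eq]) (auto simp: ps_mult_ket)
  also have "\<dots> = hom_part p Y k o\<^sub>L op_word Y \<beta>"
    by (subst sum.reindex)
      (auto simp: inj_on_def ps_mult_ket op_word_append op_scaleC_compose_left compose_sum_left
        hom_part_def)
  finally show ?thesis .
qed

lemma sums_compose_left: "T sums T' \<Longrightarrow> (\<lambda>k. S o\<^sub>L T k) sums (S o\<^sub>L T')"
  by (rule bounded_linear.sums [OF
        bounded_bilinear.bounded_linear_right [OF bounded_bilinear_blinfun_compose]])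

lemma sums_compose_right: "T sums T' \<Longrightarrow> (\<lambda>k. T k o\<^sub>L S) sums (T' o\<^sub>L S)"
  by (rule bounded_linear.sums [OF
        bounded_bilinear.bounded_linear_left [OF bounded_bilinear_blinfun_compose]])

lemma mult_ket_sums:
  fixes Y :: "'n::finite \<Rightarrow> 'h::chilbert \<Rightarrow>\<^sub>L 'h"
  assumes Y: "\<And>i. clinear_op (Y i)" and "hom_part p Y sums T"
  shows "hom_part (ps_mult p (coord (ket \<beta>))) Y sums (T o\<^sub>L op_word Y \<beta>)"
proof -
  let ?q = "ps_mult p (coord (ket \<beta>))"
  have "(\<lambda>k. hom_part ?q Y (k + length \<beta>)) sums (T o\<^sub>L op_word Y \<beta>)"
    unfolding hom_part_mult_ket [of Y, OF Y] by (rule sums_compose_right [OF assms(2)])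
  \<comment> \<open>Every word in the support ends in \<open>\<beta>\<close>, so the index shift by
    \<open>length \<beta>\<close> skips only zero terms.\<close>
  moreover have "(\<Sum>k<length \<beta>. hom_part ?q Y k) = 0"
    unfolding hom_part_def by (intro sum.neutral ballI) (auto simp: ps_mult_ket)
  ultimately show ?thesis by (simp add: sums_iff_shift)
qed

lemma mult_letter_sums:
  fixes Y :: "'n::finite \<Rightarrow> 'h::chilbert \<Rightarrow>\<^sub>L 'h"
  assumes Y: "\<And>i. clinear_op (Y i)" and "hom_part p Y sums T"
  shows "hom_part (ps_mult (ps_var j) p) Y sums (Y j o\<^sub>L T)"
  using sums_Suc [of "hom_part (ps_mult (ps_var j) p) Y" "Y j o\<^sub>L T"] sums_compose_left [OF assms(2), of "Y j"]
  by (simp add: hom_part_mult_letter [of Y, OF Y])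

definition ps_map :: "('n::finite \<Rightarrow> 'n ncps) \<Rightarrow> ('n \<Rightarrow> 'h::chilbert \<Rightarrow>\<^sub>L 'h) \<Rightarrow> 'n \<Rightarrow> 'h \<Rightarrow>\<^sub>L 'h" where
  "ps_map f X j = ps_eval (f j) X"

lemma op_ball_sums:
  assumes "Y \<in> op_ball 1" "ell2_seq p"
  shows "hom_part p Y sums ps_eval p Y"
  using assms by (intro hom_part_sums_ps_eval summable_hom_part_ell2) (auto simp: op_ball_def)

text \<open>Collects the two clauses of \<open>model_F\<close> that allow a free holomorphic
  function on the unit ball to be recovered from its composition with \<open>f\<close>.\<close>

definition composition_injective :: "('n::finite \<Rightarrow> 'n ncps) \<Rightarrow> real \<Rightarrow> bool" where
  "composition_injective f \<gamma> \<longleftrightarrow> (\<forall>X\<in>op_ball \<gamma>. ps_map f X \<in> op_ball 1) \<and>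
     (\<forall>G. 1 \<le> ps_radius G \<and> G \<noteq> (\<lambda>_. 0) \<longrightarrow> (\<exists>X\<in>op_ball \<gamma>. ps_eval G (ps_map f X) \<noteq> 0))"

context
  fixes f :: "'n::finite \<Rightarrow> 'n ncps" and \<gamma> :: real
  assumes inj: "composition_injective f \<gamma>"
begin

lemma composition_ball: "X \<in> op_ball \<gamma> \<Longrightarrow> ps_map f X \<in> op_ball 1"
  and composition_eq_0: "1 \<le> ps_radius G \<Longrightarrow> (\<And>X. X \<in> op_ball \<gamma> \<Longrightarrow> ps_eval G (ps_map f X) = 0) \<Longrightarrow>
    G = (\<lambda>_. 0)"
  using inj unfolding composition_injective_def by blast+

text \<open>The difference of two square-summable families has radius at least 1, so it falls under
  the nondegeneracy clause.\<close>

lemma model_F_unique: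
  assumes p: "ell2_seq p" and q: "ell2_seq q"
    and eq: "\<And>X. X \<in> op_ball \<gamma> \<Longrightarrow> ps_eval p (ps_map f X) = ps_eval q (ps_map f X)"
  shows "p = q"
proof -
  define G where "G \<alpha> = p \<alpha> - q \<alpha>" for \<alpha>
  have "ell2_seq (\<lambda>\<alpha>. p \<alpha> + (-1) * q \<alpha>)" by (intro ell2_triangle ell2_scale p q)
  then have G: "ell2_seq G" by (simp add: G_def [abs_def])
  have "ps_eval G (ps_map f X) = 0" if "X \<in> op_ball \<gamma>" for X
  proof -
    have "hom_part G (ps_map f X) sums (ps_eval p (ps_map f X) - ps_eval q (ps_map f X))"
      unfolding G_def hom_part_diff using that p q composition_ball by (intro sums_diff op_ball_sums)
    then show ?thesis using that eq by (simp add: ps_eval_def sums_iff)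
  qed
  from composition_eq_0 [OF ps_radius_ell2 [OF G] this] show ?thesis by (simp add: G_def fun_eq_iff)
qed

text \<open>At every point of the ball, the vector \<open>T (ket \<beta>)\<close> and the product of
  \<open>t\<close> with the word \<open>\<beta>\<close> evaluate to the same operator. Injectivity
  compares their coefficients, and \<open>lmul_from_basis\<close> passes from words to all
  vectors.\<close>

lemma model_F_lmul_aux:
  assumes "clinear_op T" "ell2_seq t"
    and t: "\<And>X. X \<in> op_ball \<gamma> \<Longrightarrow> ps_eval t (ps_map f X) = X i"
    and T: "\<And>x X. X \<in> op_ball \<gamma> \<Longrightarrow>
      ps_eval (coord (blinfun_apply T x)) (ps_map f X) = X i o\<^sub>L ps_eval (coord x) (ps_map f X)"
  shows "lmul id T t"
proof (rule lmul_from_basis [OF assms(1)])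
  fix \<beta>
  show "coord (T (ket \<beta>)) = ps_mult t (coord (ket \<beta>))"
  proof (rule model_F_unique [OF ell2_seq_coord ell2_seq_mult_ket [OF assms(2)]])
    fix X :: "'n \<Rightarrow> nat ell2 \<Rightarrow>\<^sub>L nat ell2" assume X: "X \<in> op_ball \<gamma>"
    let ?Y = "ps_map f X"
    have Y: "clinear_op (?Y j)" for j using composition_ball [OF X] by (simp add: op_ball_def)
    have "ps_eval (coord (ket \<beta>)) ?Y = op_word ?Y \<beta>"
      by (simp add: ps_eval_polynomial ps_polynomial_coord_ket)
        (subst poly_op_eq_sum [of "{\<beta>}"], auto simp: coord_ket)
    moreover have "hom_part (ps_mult t (coord (ket \<beta>))) ?Y sums (ps_eval t ?Y o\<^sub>L op_word ?Y \<beta>)"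
      by (rule mult_ket_sums [OF Y op_ball_sums [OF composition_ball [OF X] assms(2)]])
    ultimately show "ps_eval (coord (T (ket \<beta>))) ?Y = ps_eval (ps_mult t (coord (ket \<beta>))) ?Y"
      by (simp add: T [OF X] t [OF X] ps_eval_def [of "ps_mult _ _"] sums_iff)
  qed
qed

lemma model_F_creation:
  assumes T: "\<And>x X. X \<in> op_ball \<gamma> \<Longrightarrow>
      ps_eval (coord (blinfun_apply T x)) (ps_map f X) = ps_map f X j o\<^sub>L ps_eval (coord x) (ps_map f X)"
  shows "T = creation j"
proof (rule blinfun_eqI)
  fix x
  have c: "coord (creation j x) = ps_mult (ps_var j) (coord x)"
    using lmul_apply [OF lmul_lshift [OF inj_on_id], of j x] by auto
  have "coord (T x) = coord (creation j x)"
  proof (rule model_F_unique [OF ell2_seq_coord ell2_seq_coord])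
    fix X :: "'n \<Rightarrow> nat ell2 \<Rightarrow>\<^sub>L nat ell2" assume X: "X \<in> op_ball \<gamma>"
    have Y: "clinear_op (ps_map f X j)" for j using composition_ball [OF X] by (simp add: op_ball_def)
    show "ps_eval (coord (T x)) (ps_map f X) = ps_eval (coord (creation j x)) (ps_map f X)"
      using mult_letter_sums [of "ps_map f X" "coord x" _ j, OF Y op_ball_sums [OF composition_ball [OF X] ell2_seq_coord]]
      by (simp add: T [OF X] c ps_eval_def [of "ps_mult _ _"] sums_iff)
  qed
  then show "T x = creation j x" by (simp add: coord_inject)
qed

end

lemma model_F_E:
  assumes "model_F f g M"
  obtains \<gamma> N where "0 < \<gamma>" "\<And>j. ereal \<gamma> \<le> ps_radius (f j)"
    "composition_injective f \<gamma>" "\<And>i. ell2_seq (g i)"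
    "\<And>i X. X \<in> op_ball \<gamma> \<Longrightarrow> ps_eval (g i) (ps_map f X) = X i"
    "\<And>i x X. X \<in> op_ball \<gamma> \<Longrightarrow>
      ps_eval (coord (blinfun_apply (M i) x)) (ps_map f X) = X i o\<^sub>L ps_eval (coord x) (ps_map f X)"
    "\<And>j x X. X \<in> op_ball \<gamma> \<Longrightarrow>
      ps_eval (coord (blinfun_apply (N j) x)) (ps_map f X)
        = ps_map f X j o\<^sub>L ps_eval (coord x) (ps_map f X)"
    "has_value f M N"
proof -
  have eq: "(\<lambda>j. ps_eval (f j) X) = ps_map f X" for X :: "'a \<Rightarrow> nat ell2 \<Rightarrow>\<^sub>L nat ell2"
    by (simp add: fun_eq_iff ps_map_def)
  obtain \<gamma> where \<gamma>: "0 < \<gamma>" "\<forall>j. ereal \<gamma> \<le> ps_radius (f j)"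
    "composition_injective f \<gamma>"
    "\<forall>i. ell2_seq (g i) \<and> (\<forall>X\<in>op_ball \<gamma>. ps_eval (g i) (ps_map f X) = X i)"
    "\<forall>i x. \<forall>X\<in>op_ball \<gamma>. ps_eval (coord (blinfun_apply (M i) x)) (ps_map f X)
      = X i o\<^sub>L ps_eval (coord x) (ps_map f X)"
    "\<exists>N. (\<forall>j x. \<forall>X\<in>op_ball \<gamma>. ps_eval (coord (blinfun_apply (N j) x)) (ps_map f X)
      = ps_map f X j o\<^sub>L ps_eval (coord x) (ps_map f X)) \<and> has_value f M N"
    using assms unfolding model_F_def Let_def composition_injective_def ps_map_def [symmetric] eq by blast
  from \<gamma>(6) obtain N where N: "\<forall>j x. \<forall>X\<in>op_ball \<gamma>. ps_eval (coord (blinfun_apply (N j) x)) (ps_map f X)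
      = ps_map f X j o\<^sub>L ps_eval (coord x) (ps_map f X)" "has_value f M N"
    by blast
  show ?thesis
    by (rule that [of \<gamma> N]) (use \<gamma>(1-5) N in blast)+
qed

text \<open>Common form of the three variants: the model has symbols \<open>g\<close>, and f(M) is
  the creation tuple. Only the study of the inverse of a dilated tuple returns to the separate
  variants.\<close>

lemma universal_model_lmul:
  fixes f g :: "'n::finite \<Rightarrow> 'n ncps"
  assumes "universal_model f g M"
  shows "ell2_seq (g i)" "lmul id (M i) (g i)" "has_value f M creation"
proof -
  have M: "clinear_op (M i)" for i using assms by (simp add: universal_model_def)
  consider "model_A f g M" | "model_S f g M" | "model_F f g M"
    using assms by (auto simp: universal_model_def)
  then have "ell2_seq (g i) \<and> lmul id (M i) (g i) \<and> has_value f M creation" for i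
  proof cases
    case 1
    then show ?thesis
      using model_A_lmul [OF M 1] model_A_value [OF model_A_lmul [OF M 1] 1]
      by (auto simp: model_A_def ps_polynomial_def intro: ell2_seq_finite_support)
  next
    case 2
    then show ?thesis using model_S_lmul [OF 2] by (auto simp: model_S_def)
  next
    case 3
    then show ?thesis
    proof (rule model_F_E)
      fix \<gamma> N
      assume *: "composition_injective f \<gamma>"
      assume g: "\<And>i. ell2_seq (g i)"
        "\<And>i X. X \<in> op_ball \<gamma> \<Longrightarrow> ps_eval (g i) (ps_map f X) = X i"
      assume M': "\<And>i x X. X \<in> op_ball \<gamma> \<Longrightarrow>
        ps_eval (coord (blinfun_apply (M i) x)) (ps_map f X) = X i o\<^sub>L ps_eval (coord x) (ps_map f X)"
      assume N: "\<And>j x X. X \<in> op_ball \<gamma> \<Longrightarrow> ps_eval (coord (blinfun_apply (N j) x)) (ps_map f X)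
        = ps_map f X j o\<^sub>L ps_eval (coord x) (ps_map f X)"
      assume v: "has_value f M N"
      have "N j = creation j" for j
        by (rule model_F_creation [OF *]) (rule N)
      then have "N = creation" by (rule ext)
      moreover have "lmul id (M i) (g i)"
        by (rule model_F_lmul_aux [OF * M g(1)]) (fact g(2) M')+
      ultimately show ?thesis using g(1) v by simp
    qed
  qed
  then show "ell2_seq (g i)" "lmul id (M i) (g i)" "has_value f M creation" by auto
qed

text \<open>Evaluation at a multiple of the left shifts extracts Taylor coefficients.\<close>

lemma model_F_formal_inverse:
  fixes f g :: "'n::finite \<Rightarrow> 'n ncps"
  assumes f0: "\<And>j. f j [] = 0" and "0 < \<gamma>"
    and rad: "\<And>j. ereal \<gamma> \<le> ps_radius (f j)"
    and inj: "composition_injective f \<gamma>"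
    and g: "ell2_seq (g i)" "\<And>X. X \<in> op_ball \<gamma> \<Longrightarrow> ps_eval (g i) (ps_map f X) = X i"
  shows "ps_comp (g i) f = ps_var i"
proof
  fix \<beta>
  \<comment> \<open>The balls consist of operators on \<open>nat ell2\<close>, so the shifts indexed
    by words are transported along an enumeration of the words.\<close>
  define enc where "enc = (to_nat :: 'n list \<Rightarrow> nat)"
  have enc: "inj enc" by (simp add: enc_def)
  \<comment> \<open>Any positive number below \<open>\<gamma>\<close> would do: the shifts have row
    norm at most 1, so this scaling puts them in the ball.\<close>
  define \<epsilon> where "\<epsilon> = \<gamma> / 2"
  have \<epsilon>: "0 < \<epsilon>" "\<epsilon> < \<gamma>" using assms(2) by (auto simp: \<epsilon>_def)
  define c where "c = complex_of_real \<epsilon>"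
  define X where "X i = op_scaleC c (lshift enc i)" for i :: 'n
  have X: "clinear_op (X i)" for i
    by (simp add: X_def clinear_op_scaleC clinear_op_lshift enc)
  have "row_norm X \<le> \<epsilon> * 1"
    using order_trans [OF row_norm_scaleC_le [of c "lshift enc"] mult_left_mono [OF row_norm_lshift [OF enc]]] \<epsilon>
    by (simp add: X_def [abs_def] c_def)
  then have Xb: "X \<in> op_ball \<gamma>" "row_norm X < \<gamma>" using \<epsilon> X by (auto simp: op_ball_def)
  have "hom_part (f j) X sums ps_map f X j" for j
    unfolding ps_map_def using Xb(2) rad [of j]
    by (intro hom_part_sums_ps_eval summable_hom_part_radius X less_le_trans [OF _ rad]) simp
  then have F: "lmul enc (ps_map f X j) (\<lambda>\<beta>. c ^ length \<beta> * f j \<beta>)" for j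
    unfolding X_def [abs_def] by (intro lmul_ps_eval_lshift enc)
  let ?t = "\<lambda>k. \<Sum>\<alpha> | length \<alpha> = k. g i \<alpha> * ps_word (\<lambda>j \<beta>. c ^ length \<beta> * f j \<beta>) \<alpha> \<beta>"
  have w: "ps_word (\<lambda>j \<beta>. c ^ length \<beta> * f j \<beta>) \<alpha> \<beta> = c ^ length \<beta> * ps_word f \<alpha> \<beta>" for \<alpha>
    by (simp add: ps_word_dilate)
  have 1: "?t sums coord (X i (ket (enc []))) (enc \<beta>)"
    using lmul_sums_symbol [OF enc op_ball_sums [OF composition_ball [OF inj Xb(1)] g(1)], OF lmul_hom_part [OF F], of \<beta>]
    by (simp add: g(2) [OF Xb(1)])
  have 2: "coord (X i (ket (enc []))) (enc \<beta>) = c * ps_var i \<beta>"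
    using lmul_symbol [OF enc lmul_scaleC [OF lmul_lshift [OF enc]]] by (simp add: X_def)
  have 3: "?t sums (\<Sum>k\<le>length \<beta>. ?t k)"
    by (rule sums_finite) (auto simp: w intro!: sum.neutral ps_word_eq_0 [where f = f, OF f0])
  have "(\<Sum>k\<le>length \<beta>. ?t k)
      = (\<Sum>k\<le>length \<beta>. \<Sum>\<alpha>\<in>{\<alpha> \<in> {\<alpha>. length \<alpha> \<le> length \<beta>}. length \<alpha> = k}.
          c ^ length \<beta> * (g i \<alpha> * ps_word f \<alpha> \<beta>))"
    by (intro sum.cong) (auto simp: w)
  also have "\<dots> = (\<Sum>\<alpha> | length \<alpha> \<le> length \<beta>. c ^ length \<beta> * (g i \<alpha> * ps_word f \<alpha> \<beta>))"
    by (rule sum.group) (auto simp: finite_length_le)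
  also have "\<dots> = c ^ length \<beta> * ps_comp (g i) f \<beta>"
    by (simp add: ps_comp_eq_sum_le [of f, OF f0 order_refl] sum_distrib_left)
  finally have "c ^ length \<beta> * ps_comp (g i) f \<beta> = c * ps_var i \<beta>"
    using sums_unique2 [OF 1 3] 2 by simp
  \<comment> \<open>\<open>ps_var i\<close> is supported on a word of length 1, where both powers of
    \<open>c\<close> agree.\<close>
  moreover have "c * ps_var i \<beta> = c ^ length \<beta> * ps_var i \<beta>"
    by (simp add: ps_var_def)
  moreover have "c \<noteq> 0" using \<epsilon> by (simp add: c_def)
  ultimately show "ps_comp (g i) f \<beta> = ps_var i \<beta>" by simp
qed

lemma universal_model_formal_inverse:
  fixes f g :: "'n::finite \<Rightarrow> 'n ncps"
  assumes "universal_model f g M" and f0: "\<And>j. f j [] = 0"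
  shows "ps_comp (g i) f = ps_var i"
proof -
  consider "model_A f g M" | "model_S f g M" | "model_F f g M"
    using assms by (auto simp: universal_model_def)
  then show ?thesis
  proof cases
    case 3
    then show ?thesis by (rule model_F_E) (rule model_F_formal_inverse [of f, OF f0])
  qed (auto simp: model_A_def model_S_def)
qed

section \<open>The identity theorem along complex lines\<close>

text \<open>Polynomials in one complex variable with operator coefficients. Complex linearity of the
  coefficients lets powers of the variable move through compositions.\<close>

inductive op_polynomial :: "(complex \<Rightarrow> 'h::chilbert \<Rightarrow>\<^sub>L 'h) \<Rightarrow> bool" where
  monomial: "clinear_op A \<Longrightarrow> op_polynomial (\<lambda>z. op_scaleC (z ^ k) A)"
| add: "op_polynomial P \<Longrightarrow> op_polynomial Q \<Longrightarrow> op_polynomial (\<lambda>z. P z + Q z)"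

lemma op_polynomial_const: "clinear_op A \<Longrightarrow> op_polynomial (\<lambda>z. A)"
  using op_polynomial.monomial [of A 0] by simp

lemma op_polynomial_compose:
  assumes "op_polynomial P" "op_polynomial Q"
  shows "op_polynomial (\<lambda>z. P z o\<^sub>L Q z)"
  using assms(1)
proof (induction rule: op_polynomial.induct)
  case (monomial A k)
  from assms(2) show ?case
  proof (induction rule: op_polynomial.induct)
    case (monomial B l)
    with \<open>clinear_op A\<close> show ?case
      using op_polynomial.monomial [OF clinear_op_compose, of A B "k + l"]
      by (simp add: op_scaleC_compose_left op_scaleC_compose_right op_scaleC_op_scaleC power_add)
  next
    case (add P Q)
    then show ?case
      using op_polynomial.add
      by (auto simp: bounded_bilinear.add_right [OF bounded_bilinear_blinfun_compose])
  qed
next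
  case (add P P')
  then show ?case
    using op_polynomial.add
    by (auto simp: bounded_bilinear.add_left [OF bounded_bilinear_blinfun_compose])
qed

lemma continuous_on_op_scaleC:
  assumes "continuous_on S c"
  shows "continuous_on S (\<lambda>z. op_scaleC (c z) A)"
proof (rule continuous_on_compose2 [OF _ assms subset_UNIV])
  have "bounded_linear (\<lambda>c. op_scaleC c A)"
    by (rule bounded_linear_intro [where K = "norm A"])
      (simp_all add: op_scaleC_add_left norm_op_scaleC_le op_scaleC_op_scaleC
        scaleR_conv_of_real flip: op_scaleC_of_real)
  then show "continuous_on UNIV (\<lambda>c. op_scaleC c A)"
    by (rule linear_continuous_on)
qed

lemma op_polynomial_continuous: "op_polynomial P \<Longrightarrow> continuous_on S P"
  by (induction rule: op_polynomial.induct) (auto intro!: continuous_intros continuous_on_op_scaleC)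

lemma op_polynomial_coord_holomorphic:
  fixes P :: "complex \<Rightarrow> 'b ell2 \<Rightarrow>\<^sub>L 'b ell2"
  shows "op_polynomial P \<Longrightarrow> (\<lambda>z. coord (P z h) b) holomorphic_on S"
  by (induction rule: op_polynomial.induct)
    (auto simp: coord_scaleC coord_plus blinfun.add_left intro!: holomorphic_intros)

text \<open>Uniform approximability by operator polynomials on a closed disc serves as
  operator-valued analyticity: it is stable under sums, compositions and uniform limits, and it
  makes every matrix coordinate holomorphic inside the disc.\<close>

definition op_analytic :: "real \<Rightarrow> (complex \<Rightarrow> 'h::chilbert \<Rightarrow>\<^sub>L 'h) \<Rightarrow> bool" where
  "op_analytic s T \<longleftrightarrow> (\<forall>e>0. \<exists>P. op_polynomial P \<and> (\<forall>z\<in>cball 0 s. norm (T z - P z) < e))"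

lemma op_analyticD:
  assumes "op_analytic s T" "0 < e"
  obtains P where "op_polynomial P" "\<And>z. z \<in> cball 0 s \<Longrightarrow> norm (T z - P z) < e"
  using assms unfolding op_analytic_def by blast

lemma op_analytic_polynomial: "op_polynomial P \<Longrightarrow> op_analytic s P"
  unfolding op_analytic_def by force

lemma op_analytic_add:
  assumes "op_analytic s S" "op_analytic s T"
  shows "op_analytic s (\<lambda>z. S z + T z)"
  unfolding op_analytic_def
proof (intro allI impI)
  fix e :: real assume e: "0 < e"
  obtain P where P: "op_polynomial P" "\<And>z. z \<in> cball 0 s \<Longrightarrow> norm (S z - P z) < e / 2"
    using op_analyticD [OF assms(1) half_gt_zero [OF e]] by blast
  obtain Q where Q: "op_polynomial Q" "\<And>z. z \<in> cball 0 s \<Longrightarrow> norm (T z - Q z) < e / 2"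
    using op_analyticD [OF assms(2) half_gt_zero [OF e]] by blast
  have "norm (S z + T z - (P z + Q z)) < e" if "z \<in> cball 0 s" for z
    using norm_triangle_ineq [of "S z - P z" "T z - Q z"] P(2) [OF that] Q(2) [OF that]
    by (simp add: algebra_simps)
  then show "\<exists>R. op_polynomial R \<and> (\<forall>z\<in>cball 0 s. norm (S z + T z - R z) < e)"
    using op_polynomial.add [OF P(1) Q(1)] by blast
qed

lemma op_analytic_limit:
  assumes "\<And>e. 0 < e \<Longrightarrow> \<exists>S. op_analytic s S \<and> (\<forall>z\<in>cball 0 s. norm (T z - S z) < e)"
  shows "op_analytic s T"
  unfolding op_analytic_def
proof (intro allI impI)
  fix e :: real assume e: "0 < e"
  obtain S where S: "op_analytic s S" "\<And>z. z \<in> cball 0 s \<Longrightarrow> norm (T z - S z) < e / 2"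
    using assms [OF half_gt_zero [OF e]] by blast
  obtain P where P: "op_polynomial P" "\<And>z. z \<in> cball 0 s \<Longrightarrow> norm (S z - P z) < e / 2"
    using op_analyticD [OF S(1) half_gt_zero [OF e]] by blast
  have "norm (T z - P z) < e" if "z \<in> cball 0 s" for z
    using norm_triangle_ineq [of "T z - S z" "S z - P z"] S(2) [OF that] P(2) [OF that] by simp
  then show "\<exists>P. op_polynomial P \<and> (\<forall>z\<in>cball 0 s. norm (T z - P z) < e)"
    using P(1) by blast
qed

lemma op_analytic_bounded:
  assumes "op_analytic s T"
  obtains B where "0 < B" "\<And>z. z \<in> cball 0 s \<Longrightarrow> norm (T z) \<le> B"
proof -
  obtain P where P: "op_polynomial P" "\<And>z. z \<in> cball 0 s \<Longrightarrow> norm (T z - P z) < 1"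
    using op_analyticD [OF assms zero_less_one] by blast
  have "bounded (P ` cball 0 s)"
    by (intro compact_imp_bounded compact_continuous_image op_polynomial_continuous P compact_cball)
  then obtain C where C: "0 < C" "\<And>z. z \<in> cball 0 s \<Longrightarrow> norm (P z) \<le> C"
    unfolding bounded_pos by auto
  have "norm (T z) \<le> C + 1" if "z \<in> cball 0 s" for z
    using norm_triangle_ineq [of "T z - P z" "P z"] P(2) [OF that] C(2) [OF that] by simp
  with C(1) show ?thesis by (intro that [of "C + 1"]) auto
qed

lemma op_analytic_compose:
  assumes "op_analytic s S" "op_analytic s T"
  shows "op_analytic s (\<lambda>z. S z o\<^sub>L T z)"
  unfolding op_analytic_def
proof (intro allI impI)
  fix e :: real assume e: "0 < e"
  obtain B where B: "0 < B" "\<And>z. z \<in> cball 0 s \<Longrightarrow> norm (T z) \<le> B"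
    using op_analytic_bounded [OF assms(2)] by blast
  obtain P where P: "op_polynomial P" "\<And>z. z \<in> cball 0 s \<Longrightarrow> norm (S z - P z) < e / 2 / B"
    using op_analyticD [OF assms(1), of "e / 2 / B"] e B(1) by auto
  \<comment> \<open>The second error gets multiplied by \<open>P\<close>, so its tolerance can be
    fixed only after \<open>P\<close> has been chosen and bounded.\<close>
  obtain C where C: "0 < C" "\<And>z. z \<in> cball 0 s \<Longrightarrow> norm (P z) \<le> C"
    using op_analytic_bounded [OF op_analytic_polynomial [OF P(1)]] by blast
  obtain Q where Q: "op_polynomial Q" "\<And>z. z \<in> cball 0 s \<Longrightarrow> norm (T z - Q z) < e / 2 / C"
    using op_analyticD [OF assms(2), of "e / 2 / C"] e C(1) by auto
  have "norm ((S z o\<^sub>L T z) - (P z o\<^sub>L Q z)) < e" if z: "z \<in> cball 0 s" for z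
  proof -
    have "(S z o\<^sub>L T z) - (P z o\<^sub>L Q z) = ((S z - P z) o\<^sub>L T z) + (P z o\<^sub>L (T z - Q z))"
      by (rule blinfun_eqI) (simp add: blinfun.diff_left blinfun.add_left blinfun.diff_right)
    also have "norm \<dots> \<le> norm (S z - P z) * norm (T z) + norm (P z) * norm (T z - Q z)"
      by (intro norm_triangle_mono norm_compose_le)
    also have "\<dots> \<le> norm (S z - P z) * B + C * norm (T z - Q z)"
      using B(2) [OF z] C(2) [OF z] by (intro add_mono mult_left_mono mult_right_mono) auto
    also have "\<dots> < e / 2 / B * B + C * (e / 2 / C)"
      using P(2) [OF z] Q(2) [OF z] B(1) C(1)
      by (intro add_strict_mono mult_strict_right_mono mult_strict_left_mono) auto
    also have "\<dots> = e" using B(1) C(1) by simp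
    finally show ?thesis .
  qed
  then show "\<exists>R. op_polynomial R \<and> (\<forall>z\<in>cball 0 s. norm ((S z o\<^sub>L T z) - R z) < e)"
    using op_polynomial_compose [OF P(1) Q(1)] by blast
qed

lemma op_analytic_const: "clinear_op A \<Longrightarrow> op_analytic s (\<lambda>z. A)"
  by (intro op_analytic_polynomial op_polynomial_const)

lemma op_analytic_scaleC: "op_analytic s T \<Longrightarrow> op_analytic s (\<lambda>z. op_scaleC c (T z))"
  using op_analytic_compose [OF op_analytic_const [OF clinear_op_scaleC [OF clinear_op_id]], of s T c]
  by (simp add: op_scaleC_compose_left)

lemma op_analytic_sum:
  "(\<And>a. a \<in> A \<Longrightarrow> op_analytic s (T a)) \<Longrightarrow> op_analytic s (\<lambda>z. \<Sum>a\<in>A. T a z)"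
  by (induction A rule: infinite_finite_induct)
    (auto simp: op_analytic_add op_analytic_const clinear_op_zero)

lemma op_analytic_suminf:
  assumes "\<And>k. op_analytic s (T k)" "summable m"
    and "\<And>k z. z \<in> cball 0 s \<Longrightarrow> norm (T k z) \<le> m k"
  shows "op_analytic s (\<lambda>z. \<Sum>k. T k z)"
proof (rule op_analytic_limit)
  fix e :: real assume e: "0 < e"
  have "uniform_limit (cball 0 s) (\<lambda>n z. \<Sum>k<n. T k z) (\<lambda>z. \<Sum>k. T k z) sequentially"
    by (rule Weierstrass_m_test) (use assms in auto)
  from uniform_limitD [OF this e] obtain n
    where "\<forall>z\<in>cball 0 s. dist (\<Sum>k<n. T k z) (\<Sum>k. T k z) < e"
    by (auto simp: eventually_sequentially)
  then show "\<exists>S. op_analytic s S \<and> (\<forall>z\<in>cball 0 s. norm ((\<Sum>k. T k z) - S z) < e)"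
    using op_analytic_sum [of "{..<n}" s T] assms(1)
    by (intro exI [of _ "\<lambda>z. \<Sum>k<n. T k z"]) (auto simp: dist_norm norm_minus_commute)
qed

lemma op_analytic_op_word:
  "(\<And>i. op_analytic s (\<lambda>z. Y z i)) \<Longrightarrow> op_analytic s (\<lambda>z. op_word (Y z) \<alpha>)"
  by (induction \<alpha>) (auto intro: op_analytic_const clinear_op_id op_analytic_compose)

lemma op_analytic_hom_part:
  "(\<And>i. op_analytic s (\<lambda>z. Y z i)) \<Longrightarrow> op_analytic s (\<lambda>z. hom_part p (Y z) k)"
  unfolding hom_part_def by (intro op_analytic_sum op_analytic_scaleC op_analytic_op_word)

lemma op_analytic_approx:
  assumes "op_analytic s T"
  obtains P where "\<And>n. op_polynomial (P n)" "uniform_limit (cball 0 s) P T sequentially"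
proof -
  have "\<forall>n. \<exists>P. op_polynomial P \<and> (\<forall>z\<in>cball 0 s. norm (T z - P z) < inverse (real (Suc n)))"
    using assms unfolding op_analytic_def by auto
  then obtain P where P: "\<And>n. op_polynomial (P n)"
    "\<And>n z. z \<in> cball 0 s \<Longrightarrow> norm (T z - P n z) < inverse (real (Suc n))"
    by metis
  have "uniform_limit (cball 0 s) P T sequentially"
  proof (rule uniform_limitI)
    fix e :: real assume e: "0 < e"
    have "\<forall>\<^sub>F n in sequentially. inverse (real (Suc n)) < e"
      using order_tendstoD(2) [OF LIMSEQ_inverse_real_of_nat e] .
    then show "\<forall>\<^sub>F n in sequentially. \<forall>z\<in>cball 0 s. dist (P n z) (T z) < e"
      by eventually_elim (metis P(2) dist_norm norm_minus_commute order_less_trans)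
  qed
  with P(1) show ?thesis by (rule that)
qed

lemma op_analytic_continuous:
  assumes "op_analytic s T"
  shows "continuous_on (cball 0 s) T"
proof -
  obtain P where "\<And>n. op_polynomial (P n)" "uniform_limit (cball 0 s) P T sequentially"
    using op_analytic_approx [OF assms] by blast
  then show ?thesis
    by (intro uniform_limit_theorem [of _ P]) (auto simp: op_polynomial_continuous)
qed

lemma op_analytic_coord_holomorphic:
  fixes T :: "complex \<Rightarrow> 'b ell2 \<Rightarrow>\<^sub>L 'b ell2"
  assumes "op_analytic s T"
  shows "(\<lambda>z. coord (T z h) b) holomorphic_on ball 0 s"
proof -
  obtain P where P: "\<And>n. op_polynomial (P n)" "uniform_limit (cball 0 s) P T sequentially"
    using op_analytic_approx [OF assms] by blast
  have "bounded_linear (\<lambda>S :: 'b ell2 \<Rightarrow>\<^sub>L 'b ell2. coord (S h) b)"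
    by (rule bounded_linear_compose [OF bounded_linear_coord blinfun.bounded_linear_left])
  then have "uniform_limit (cball 0 s) (\<lambda>n z. coord (P n z h) b) (\<lambda>z. coord (T z h) b) sequentially"
    by (rule bounded_linear.uniform_limit [OF _ P(2)])
  with always_eventually show ?thesis
    by (rule holomorphic_uniform_limit)
      (auto intro!: holomorphic_on_imp_continuous_on op_polynomial_coord_holomorphic P)
qed

lemma continuous_on_row_norm:
  fixes Y :: "'z::topological_space \<Rightarrow> 'n::finite \<Rightarrow> 'h::chilbert \<Rightarrow>\<^sub>L 'h"
  assumes "\<And>i. continuous_on S (\<lambda>z. Y z i)"
  shows "continuous_on S (\<lambda>z. row_norm (Y z))"
  unfolding continuous_on_def
proof (intro ballI)
  fix z assume z: "z \<in> S"
  have "((\<lambda>w. \<Sum>i\<in>UNIV. norm (Y w i - Y z i)) \<longlongrightarrow> (\<Sum>i\<in>UNIV. norm (Y z i - Y z i))) (at z within S)"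
    using assms z by (intro tendsto_intros) (auto simp: continuous_on_def)
  then have lim: "((\<lambda>w. \<Sum>i\<in>UNIV. norm (Y w i - Y z i)) \<longlongrightarrow> 0) (at z within S)" by simp
  have "norm (row_norm (Y w) - row_norm (Y z)) \<le> (\<Sum>i\<in>UNIV. norm (Y w i - Y z i))" for w
    using row_norm_triangle [of "Y w" "Y z"] row_norm_triangle [of "Y z" "Y w"]
    by (simp add: abs_le_iff norm_minus_commute)
  then have "((\<lambda>w. row_norm (Y w) - row_norm (Y z)) \<longlongrightarrow> 0) (at z within S)"
    by (intro Lim_null_comparison [OF always_eventually lim]) auto
  then show "((\<lambda>w. row_norm (Y w)) \<longlongrightarrow> row_norm (Y z)) (at z within S)"
    by (rule LIM_zero_cancel)
qed

text \<open>On the complex line through \<open>X\<close>, the coordinates of the composition are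
  holomorphic on a disc containing 1 and vanish near 0, where the line lies in the smaller ball. The
  identity theorem gives zero at 1. The work lies in analyticity: \<open>G\<close> converges only
  inside the open unit ball, so a uniform bound below 1 is needed along the line.\<close>

lemma free_holomorphic_identity:
  fixes f :: "'n::finite \<Rightarrow> 'n ncps"
  assumes rad: "\<And>j. ereal \<gamma> \<le> ps_radius (f j)"
    and ball: "\<And>X. X \<in> op_ball \<gamma> \<Longrightarrow> ps_map f X \<in> op_ball 1"
    and G: "ell2_seq G"
    and "0 < \<gamma>'" and zero: "\<And>X. X \<in> op_ball \<gamma>' \<Longrightarrow> ps_eval G (ps_map f X) = 0"
    and X: "X \<in> op_ball \<gamma>"
  shows "ps_eval G (ps_map f X) = 0"
proof -
  define x where "x = row_norm X"
  have x: "0 \<le> x" "x < \<gamma>" and Xc: "clinear_op (X i)" for i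
    using X by (auto simp: x_def row_norm_nonneg op_ball_def)
  \<comment> \<open>Chosen so that \<open>1 < s\<close> and \<open>s * x < \<gamma>\<close>: the
    point 1 is interior to the disc, and the line stays in the ball. The summand 1 in
    \<open>x + 1\<close> covers \<open>x = 0\<close>.\<close>
  define s where "s = 1 + (\<gamma> - x) / (2 * (x + 1))"
  have s1: "1 < s" using x by (simp add: s_def)
  have "(\<gamma> - x) * x < (\<gamma> - x) * (2 * (x + 1))" using x by (intro mult_strict_left_mono) auto
  then have sx: "s * x < \<gamma>" using x by (simp add: s_def field_simps)
  define Z where "Z z i = op_scaleC z (X i)" for z and i
  have Zc: "clinear_op (Z z i)" for z i by (simp add: Z_def clinear_op_scaleC Xc)
  have rZ: "row_norm (Z z) \<le> cmod z * x" for z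
    unfolding Z_def [abs_def] x_def by (rule row_norm_scaleC_le)
  have Zb: "Z z \<in> op_ball \<delta>" if "cmod z * x < \<delta>" for z \<delta>
    using that rZ [of z] Zc by (auto simp: op_ball_def)
  have Zs: "Z z \<in> op_ball \<gamma>" if "z \<in> cball 0 s" for z
  proof (rule Zb)
    have "cmod z * x \<le> s * x" using that x by (intro mult_right_mono) auto
    with sx show "cmod z * x < \<gamma>" by simp
  qed
  define Y where "Y z = ps_map f (Z z)" for z
  have Yc: "clinear_op (Y z i)" and Y1: "row_norm (Y z) < 1" if "z \<in> cball 0 s" for z :: complex and i
    using ball [OF Zs [OF that]] by (auto simp: Y_def op_ball_def)
  have Ya: "op_analytic s (\<lambda>z. Y z j)" for j
  proof -
    have h: "hom_part (f j) (Z z) k = op_scaleC (z ^ k) (hom_part (f j) X k)" for z k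
      unfolding Z_def by (rule hom_part_scaleC) (rule Xc)
    \<comment> \<open>Absolute convergence at the extreme point \<open>s\<close> provides the
      majorant for the whole disc.\<close>
    have "ereal (row_norm (Z (of_real s))) < ps_radius (f j)"
      using rZ [of "of_real s"] s1 sx by (intro less_le_trans [OF _ rad]) simp
    then have "summable (\<lambda>k. norm (hom_part (f j) (Z (of_real s)) k))"
      by (intro summable_hom_part_radius Zc)
    then have m: "summable (\<lambda>k. s ^ k * norm (hom_part (f j) X k))"
      using s1 by (simp add: h op_scaleC_of_real flip: of_real_power)
    have "op_analytic s (\<lambda>z. \<Sum>k. hom_part (f j) (Z z) k)"
    proof (rule op_analytic_suminf [OF _ m])
      show "op_analytic s (\<lambda>z. hom_part (f j) (Z z) k)" for k
        unfolding h by (intro op_analytic_polynomial op_polynomial.monomial clinear_op_hom_part Xc)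
      fix k and z :: complex assume "z \<in> cball 0 s"
      then have "cmod (z ^ k) * norm (hom_part (f j) X k) \<le> s ^ k * norm (hom_part (f j) X k)"
        by (intro mult_right_mono) (auto simp: norm_power intro: power_mono)
      then show "norm (hom_part (f j) (Z z) k) \<le> s ^ k * norm (hom_part (f j) X k)"
        unfolding h by (rule order_trans [OF norm_op_scaleC_le])
    qed
    then show ?thesis by (simp add: Y_def ps_map_def ps_eval_def)
  qed
  \<comment> \<open>On the compact disc the maximum is attained, which turns the pointwise strict
    bound into a uniform \<open>\<rho> < 1\<close>.\<close>
  have "continuous_on (cball 0 s) (\<lambda>z. row_norm (Y z))"
    by (intro continuous_on_row_norm op_analytic_continuous Ya)
  then obtain z\<^sub>0 where z0: "z\<^sub>0 \<in> cball 0 s" "\<And>z. z \<in> cball 0 s \<Longrightarrow> row_norm (Y z) \<le> row_norm (Y z\<^sub>0)"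
    using continuous_attains_sup [of "cball 0 s" "\<lambda>z. row_norm (Y z)"] s1 by auto
  define \<rho> where "\<rho> = row_norm (Y z\<^sub>0)"
  have \<rho>: "0 \<le> \<rho>" "\<rho> < 1" using Y1 [OF z0(1)] by (auto simp: \<rho>_def row_norm_nonneg)
  have T: "op_analytic s (\<lambda>z. ps_eval G (Y z))"
    unfolding ps_eval_def
  proof (rule op_analytic_suminf)
    show "op_analytic s (\<lambda>z. hom_part G (Y z) k)" for k
      by (rule op_analytic_hom_part) (rule Ya)
    show "summable (\<lambda>k. ell2_norm G * \<rho> ^ k)"
      using \<rho> by (intro summable_mult summable_geometric) simp
    fix k and z :: complex assume z: "z \<in> cball 0 s"
    have "norm (hom_part G (Y z) k) \<le> ell2_norm G * row_norm (Y z) ^ k"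
      by (rule norm_hom_part_ell2_le [OF Yc [OF z] G])
    also have "\<dots> \<le> ell2_norm G * \<rho> ^ k"
      using z0(2) [OF z]
      by (intro mult_left_mono power_mono) (auto simp: \<rho>_def row_norm_nonneg ell2_norm_nonneg)
    finally show "norm (hom_part G (Y z) k) \<le> ell2_norm G * \<rho> ^ k" .
  qed
  define \<delta> where "\<delta> = min s (\<gamma>' / (x + 1))"
  have \<delta>: "0 < \<delta>" "\<delta> \<le> s" using s1 assms(4) x by (auto simp: \<delta>_def)
  have Y0: "ps_eval G (Y z) = 0" if "z \<in> ball 0 \<delta>" for z
    unfolding Y_def
  proof (intro zero Zb)
    have "cmod z < \<gamma>' / (x + 1)" using that by (simp add: \<delta>_def)
    then have "cmod z * (x + 1) < \<gamma>'" using x by (simp add: field_simps)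
    moreover have "cmod z * x \<le> cmod z * (x + 1)" by (intro mult_left_mono) auto
    ultimately show "cmod z * x < \<gamma>'" by linarith
  qed
  have "coord (ps_eval G (Y 1) h) b = 0" for h b
  proof (rule analytic_continuation_open [of "ball 0 \<delta>" "ball 0 s" "\<lambda>z. coord (ps_eval G (Y z) h) b" "\<lambda>_. 0" 1])
    show "(\<lambda>z. coord (ps_eval G (Y z) h) b) holomorphic_on ball 0 s"
      by (rule op_analytic_coord_holomorphic [OF T])
  qed (use \<delta> s1 Y0 in \<open>auto simp: coord_zero\<close>)
  then have "ps_eval G (Y 1) = 0"
    by (intro blinfun_eqI ell2_eqI) (simp add: coord_zero)
  then show ?thesis by (simp add: Y_def Z_def [abs_def])
qed

section \<open>Inverses of dilated tuples\<close>

lemma poly_op_dilate: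
  fixes p :: "'n::finite ncps"
  assumes "ps_polynomial p" "\<And>i. clinear_op (X i)"
  shows "poly_op (\<lambda>\<alpha>. c ^ length \<alpha> * p \<alpha>) X = poly_op p (\<lambda>i. op_scaleC c (X i))"
proof (rule sums_unique2)
  show "hom_part (\<lambda>\<alpha>. c ^ length \<alpha> * p \<alpha>) X sums poly_op (\<lambda>\<alpha>. c ^ length \<alpha> * p \<alpha>) X"
    by (intro hom_part_sums_poly_op ps_polynomial_scale assms)
  show "hom_part (\<lambda>\<alpha>. c ^ length \<alpha> * p \<alpha>) X sums poly_op p (\<lambda>i. op_scaleC c (X i))"
    using hom_part_sums_poly_op [OF assms(1), of "\<lambda>i. op_scaleC c (X i)"]
    by (simp add: hom_part_dilate hom_part_scaleC assms(2) cong: sums_cong)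
qed

lemma model_A_inverse:
  fixes f g :: "'n::finite \<Rightarrow> 'n ncps"
  assumes "model_A f g M" "\<And>i. clinear_op (X i)"
  shows "poly_op (g i) (\<lambda>j. poly_op (f j) X) = X i"
    and "poly_op (f i) (\<lambda>j. poly_op (g j) X) = X i"
proof -
  have fg: "ps_polynomial (f j)" "ps_polynomial (g j)" "ps_comp (f j) g = ps_var j"
    "ps_comp (g j) f = ps_var j" for j
    using assms(1) by (auto simp: model_A_def)
  show "poly_op (g i) (\<lambda>j. poly_op (f j) X) = X i"
    using poly_op_comp [of X "g i" f] assms(2) fg by (simp add: poly_op_var)
  show "poly_op (f i) (\<lambda>j. poly_op (g j) X) = X i"
    using poly_op_comp [of X "f i" g] assms(2) fg by (simp add: poly_op_var)
qed

lemma ell2_seq_polynomial: "ps_polynomial p \<Longrightarrow> ell2_seq p"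
  by (simp add: ps_polynomial_def ell2_seq_finite_support)

lemma ell2_seq_dilate:
  assumes "ell2_seq p" "0 \<le> r" "r \<le> 1"
  shows "ell2_seq (\<lambda>\<alpha>. complex_of_real r ^ length \<alpha> * p \<alpha>)"
proof (rule ell2_bound(1))
  fix F :: "'a list set" assume F: "finite F"
  have "L2_set (\<lambda>\<alpha>. cmod (complex_of_real r ^ length \<alpha> * p \<alpha>)) F \<le> L2_set (\<lambda>\<alpha>. cmod (p \<alpha>)) F"
    using assms(2,3)
    by (intro L2_set_mono) (auto simp: norm_mult norm_power mult_le_cancel_right1 intro!: mult_left_le_one_le power_le_one)
  also have "\<dots> \<le> ell2_norm p" by (rule L2_set_le_ell2_norm [OF assms(1) F])
  finally show "L2_set (\<lambda>\<alpha>. cmod (complex_of_real r ^ length \<alpha> * p \<alpha>)) F \<le> ell2_norm p" .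
qed

text \<open>The series \<open>p\<close>, that is g'(rZ), satisfies p(f) = g'(r f) = Z = g(f), so
  injectivity of composition with \<open>f\<close> gives p = g. The cases arise because the variants
  behind \<open>f\<close> and \<open>r f\<close> may differ. Without constant terms formal
  composition covers them all; otherwise variant S is excluded and four combinations of A and F
  remain.\<close>

lemma inverse_of_dilated:
  fixes f g g' :: "'n::finite \<Rightarrow> 'n ncps"
  assumes r: "0 < r" "r \<le> 1"
    and um: "universal_model f g M"
    and um': "universal_model (\<lambda>j \<alpha>. complex_of_real r * f j \<alpha>) g' M'"
  shows "complex_of_real r ^ length \<alpha> * g' i \<alpha> = g i \<alpha>"
proof -
  define c where "c = complex_of_real r"
  define f' where "f' j \<alpha> = c * f j \<alpha>" for j \<alpha>
  define p where "p \<alpha> = c ^ length \<alpha> * g' i \<alpha>" for \<alpha>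
  have c0: "c \<noteq> 0" using r by (simp add: c_def)
  have um': "universal_model f' g' M'"
    using um' by (simp add: f'_def [abs_def] c_def)
  have g: "ell2_seq (g i)" and g': "ell2_seq (g' i)" for i
    using universal_model_lmul(1) [OF um] universal_model_lmul(1) [OF um'] by auto
  have p: "ell2_seq p"
    unfolding p_def c_def using r by (intro ell2_seq_dilate g') auto
  have poly_f': "poly_op (f' j) X = op_scaleC c (poly_op (f j) X)" for X :: "'n \<Rightarrow> 'h::chilbert \<Rightarrow>\<^sub>L 'h" and j
    unfolding f'_def by (rule poly_op_scale)
  have map_f': "ps_map f' X j = op_scaleC c (ps_map f X j)"
    if "X \<in> op_ball \<gamma>" "\<And>j. ereal \<gamma> \<le> ps_radius (f j)" for X j and \<gamma>
  proof -
    have "hom_part (f j) X sums ps_map f X j"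
      unfolding ps_map_def using that
      by (intro hom_part_sums_ps_eval summable_hom_part_radius less_le_trans [OF _ that(2)])
        (auto simp: op_ball_def)
    then have "(\<lambda>k. op_scaleC c (hom_part (f j) X k)) sums op_scaleC c (ps_map f X j)"
      by (rule bounded_linear.sums [OF bounded_linear_op_scaleC])
    moreover have "hom_part (f' j) X = (\<lambda>k. op_scaleC c (hom_part (f j) X k))"
      by (simp add: f'_def [abs_def] hom_part_scale fun_eq_iff)
    ultimately have "hom_part (f' j) X sums op_scaleC c (ps_map f X j)" by simp
    then show ?thesis by (simp add: ps_map_def [of f'] ps_eval_def [of "f' j"] sums_iff)
  qed
  have eval_p: "ps_eval p Y = ps_eval (g' i) (\<lambda>j. op_scaleC c (Y j))"
    if "\<And>j. clinear_op (Y j)" for Y :: "'n \<Rightarrow> nat ell2 \<Rightarrow>\<^sub>L nat ell2"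
    using that by (simp add: ps_eval_def p_def [abs_def] hom_part_dilate hom_part_scaleC)
  have "p = g i"
  proof (cases "\<forall>j. f j [] = 0")
    case True
    then have f0: "f j [] = 0" "f' j [] = 0" for j by (auto simp: f'_def)
    have gf: "ps_comp (g i) f = ps_var i" for i
      by (rule universal_model_formal_inverse [OF um f0(1)])
    have "ps_word f' \<alpha> = (\<lambda>\<beta>. c ^ length \<alpha> * ps_word f \<alpha> \<beta>)" for \<alpha>
      unfolding f'_def [abs_def] by (rule ps_word_scale)
    then have "g' i \<alpha> * ps_word f' \<alpha> \<beta> = p \<alpha> * ps_word f \<alpha> \<beta>" for \<alpha> \<beta>
      by (simp add: p_def)
    then have "ps_comp p f \<beta> = ps_comp (g' i) f' \<beta>" for \<beta>
      by (simp only: ps_comp_def)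
    then have pf: "ps_comp p f \<beta> = ps_var i \<beta>" for \<beta>
      by (simp only: universal_model_formal_inverse [OF um' f0(2)])
    have "(\<lambda>\<alpha>. p \<alpha> - g i \<alpha>) = (\<lambda>_. 0)"
    proof (rule ps_comp_eq_0D [of f g, OF f0(1) gf])
      show "ps_comp (\<lambda>\<alpha>. p \<alpha> - g i \<alpha>) f = (\<lambda>_. 0)"
        by (simp only: fun_eq_iff ps_comp_diff [of f, OF f0(1)] gf pf) simp
    qed
    then show ?thesis by (simp add: fun_eq_iff)
  next
    case False
    then have "\<not> model_S f g M" "\<not> model_S f' g' M'"
      using c0 by (auto simp: model_S_def f'_def)
    then consider "model_A f g M" "model_A f' g' M'" | "model_A f g M" "model_F f' g' M'"
      | "model_F f g M" "model_A f' g' M'" | "model_F f g M" "model_F f' g' M'"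
      using um um' by (auto simp: universal_model_def)
    then show ?thesis
    proof cases
      case 1
      \<comment> \<open>At this tuple \<open>f\<close> takes the creation operators as value, and
        these determine a polynomial.\<close>
      define X where "X j = poly_op (g j) creation" for j
      have X: "clinear_op (X j)" for j
        unfolding X_def by (rule clinear_op_poly_op) (rule clinear_op_creation)
      have fX: "poly_op (f j) X = creation j" for j
        unfolding X_def by (rule model_A_inverse(2) [OF 1(1) clinear_op_creation])
      have pg: "ps_polynomial (g i)" "ps_polynomial (g' i)"
        using 1 by (auto simp: model_A_def)
      have "poly_op (g' i) (\<lambda>j. op_scaleC c (creation j)) = X i"
        using model_A_inverse(1) [of f' g' M' X i, OF 1(2) X] by (simp add: poly_f' fX)
      then have "poly_op p creation = poly_op (g i) creation"
        using poly_op_dilate [OF pg(2), of creation c] by (simp add: p_def [abs_def] clinear_op_creation X_def)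
      then show ?thesis
        by (intro poly_op_creation_inject pg) (auto simp: p_def [abs_def] pg ps_polynomial_scale)
    next
      case 2
      \<comment> \<open>Injectivity is known for \<open>f'\<close> only, so the comparison is
        reversed. Dilation by the inverse of \<open>c\<close> increases coefficients, which is
        harmless as \<open>g i\<close> is a polynomial.\<close>
      define q where "q \<alpha> = inverse c ^ length \<alpha> * g i \<alpha>" for \<alpha>
      have pg: "ps_polynomial (g i)" "ps_polynomial q"
        using 2(1) by (auto simp: model_A_def q_def [abs_def] ps_polynomial_scale)
      have pf: "ps_polynomial (f j)" "ps_polynomial (f' j)" for j
        using 2(1) by (auto simp: model_A_def f'_def [abs_def] ps_polynomial_scale)
      from 2(2) have "g' i = q"
      proof (rule model_F_E)
        fix \<gamma>
        assume *: "composition_injective f' \<gamma>"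
          "\<And>i X. X \<in> op_ball \<gamma> \<Longrightarrow> ps_eval (g' i) (ps_map f' X) = X i"
        show "g' i = q"
        proof (rule model_F_unique [OF *(1) g' ell2_seq_polynomial [OF pg(2)]])
          fix X :: "'n \<Rightarrow> nat ell2 \<Rightarrow>\<^sub>L nat ell2" assume X: "X \<in> op_ball \<gamma>"
          have Xc: "clinear_op (X j)" "clinear_op (poly_op (f j) X)" for j
            using X by (auto simp: op_ball_def intro: clinear_op_poly_op)
          have m: "ps_map f' X = (\<lambda>j. op_scaleC c (poly_op (f j) X))"
            by (simp add: fun_eq_iff ps_map_def ps_eval_polynomial pf poly_f')
          have "poly_op q (ps_map f' X) = X i"
            using model_A_inverse(1) [of f g M X i, OF 2(1) Xc(1)] c0
            by (simp add: q_def [abs_def] poly_op_dilate pg m clinear_op_scaleC Xc op_scaleC_op_scaleC)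
          then show "ps_eval (g' i) (ps_map f' X) = ps_eval q (ps_map f' X)"
            by (simp add: *(2) [OF X] ps_eval_polynomial pg)
        qed
      qed
      then show ?thesis
        using c0 by (auto simp: p_def q_def fun_eq_iff power_inverse)
    next
      case 3
      have pg: "ps_polynomial (g' i)" and pp: "ps_polynomial p"
        using 3(2) by (auto simp: model_A_def p_def [abs_def] ps_polynomial_scale)
      have pf': "ps_polynomial (f' j)" for j using 3(2) by (auto simp: model_A_def)
      have pf: "ps_polynomial (f j)" for j
        using ps_polynomial_scale [OF pf', of "\<lambda>_. inverse c" j] c0 by (simp add: f'_def mult.assoc [symmetric])
      from 3(1) show ?thesis
      proof (rule model_F_E)
        fix \<gamma>
        assume *: "composition_injective f \<gamma>"
          "\<And>i X. X \<in> op_ball \<gamma> \<Longrightarrow> ps_eval (g i) (ps_map f X) = X i"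
        show "p = g i"
        proof (rule model_F_unique [OF *(1) p g])
          fix X :: "'n \<Rightarrow> nat ell2 \<Rightarrow>\<^sub>L nat ell2" assume X: "X \<in> op_ball \<gamma>"
          have Xc: "clinear_op (X j)" "clinear_op (poly_op (f j) X)" for j
            using X by (auto simp: op_ball_def intro: clinear_op_poly_op)
          have m: "ps_map f X = (\<lambda>j. poly_op (f j) X)"
            by (simp add: fun_eq_iff ps_map_def ps_eval_polynomial pf)
          have "poly_op p (ps_map f X) = X i"
            using model_A_inverse(1) [of f' g' M' X i, OF 3(2) Xc(1)]
            by (simp add: p_def [abs_def] poly_op_dilate pg m Xc poly_f')
          then show "ps_eval p (ps_map f X) = ps_eval (g i) (ps_map f X)"
            by (simp add: *(2) [OF X] ps_eval_polynomial pp)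
        qed
      qed
    next
      case 4
      from 4(2) have "\<exists>\<gamma>'>0. \<forall>X\<in>op_ball \<gamma>'. ps_eval (g' i) (ps_map f' X) = X i"
      proof (rule model_F_E)
        fix \<gamma>'
        assume "0 < \<gamma>'" "\<And>i X. X \<in> op_ball \<gamma>' \<Longrightarrow> ps_eval (g' i) (ps_map f' X) = X i"
        then show ?thesis by blast
      qed
      then obtain \<gamma>' where \<gamma>': "0 < \<gamma>'"
        "\<And>X. X \<in> op_ball \<gamma>' \<Longrightarrow> ps_eval (g' i) (ps_map f' X) = X i"
        by blast
      from 4(1) show ?thesis
      proof (rule model_F_E)
        fix \<gamma>
        assume \<gamma>: "0 < \<gamma>" and rad: "\<And>j. ereal \<gamma> \<le> ps_radius (f j)"
        assume *: "composition_injective f \<gamma>"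
          "\<And>i X. X \<in> op_ball \<gamma> \<Longrightarrow> ps_eval (g i) (ps_map f X) = X i"
        define G where "G \<alpha> = p \<alpha> - g i \<alpha>" for \<alpha>
        have "ell2_seq (\<lambda>\<alpha>. p \<alpha> + (-1) * g i \<alpha>)" by (intro ell2_triangle ell2_scale p g)
        then have G: "ell2_seq G" by (simp add: G_def [abs_def])
        have ev: "ps_eval G (ps_map f X) = ps_eval p (ps_map f X) - X i" if X: "X \<in> op_ball \<gamma>" for X
        proof -
          have "hom_part G (ps_map f X) sums (ps_eval p (ps_map f X) - ps_eval (g i) (ps_map f X))"
            unfolding G_def hom_part_diff using composition_ball [OF *(1) X] p g by (intro sums_diff op_ball_sums)
          then show ?thesis by (simp add: ps_eval_def [of G] sums_iff *(2) [OF X])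
        qed
        have "ps_eval G (ps_map f X) = 0" if X: "X \<in> op_ball (min \<gamma> \<gamma>')" for X
        proof -
          have X': "X \<in> op_ball \<gamma>" "X \<in> op_ball \<gamma>'" using X by (auto simp: op_ball_def)
          have Yc: "clinear_op (ps_map f X j)" for j using composition_ball [OF *(1) X'(1)] by (simp add: op_ball_def)
          have "ps_map f' X = (\<lambda>j. op_scaleC c (ps_map f X j))"
            by (rule ext) (rule map_f' [OF X'(1) rad])
          with \<gamma>'(2) [OF X'(2)] have "ps_eval p (ps_map f X) = X i"
            by (simp add: eval_p [of "ps_map f X", OF Yc])
          then show ?thesis by (simp add: ev [OF X'(1)])
        qed
        note vanish = this
        \<comment> \<open>Both inverses are known to be valid only on the smaller ball, whereas
          injectivity asks for vanishing on the whole ball of radius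
          \<open>\<gamma>\<close>.\<close>
        have "ps_eval G (ps_map f X) = 0" if "X \<in> op_ball \<gamma>" for X
        proof (rule free_holomorphic_identity [where f = f and \<gamma> = \<gamma> and \<gamma>' = "min \<gamma> \<gamma>'"])
          show "0 < min \<gamma> \<gamma>'" using \<gamma> \<gamma>'(1) by simp
        qed (fact rad composition_ball [OF *(1)] G vanish that)+
        from composition_eq_0 [OF *(1) ps_radius_ell2 [OF G] this] show "p = g i" by (simp add: G_def fun_eq_iff)
      qed
    qed
  qed
  then show ?thesis by (simp add: p_def c_def fun_eq_iff)
qed

section \<open>Norm convergence of the power series at the universal model\<close>

text \<open>The norm analogue of \<open>has_value\<close>. Characters are controlled by the operator
  norm, so a value must be attained in norm before a character can be applied to it.\<close>

definition norm_value :: "('n::finite \<Rightarrow> 'n ncps) \<Rightarrow> ('n \<Rightarrow> 'h::chilbert \<Rightarrow>\<^sub>L 'h) \<Rightarrow>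
    ('n \<Rightarrow> 'h \<Rightarrow>\<^sub>L 'h) \<Rightarrow> bool" where
  "norm_value f X Y \<longleftrightarrow> (\<forall>j. hom_part (f j) X sums Y j) \<or>
     (\<exists>\<delta>\<in>{0<..<1}. \<forall>r\<in>{\<delta><..<1}. \<forall>j. summable (hom_part (f j) (\<lambda>i. r *\<^sub>R X i))) \<and>
     (\<forall>j. ((\<lambda>r. ps_eval (f j) (\<lambda>i. r *\<^sub>R X i)) \<longlongrightarrow> Y j) (at_left 1))"

context
  fixes f g g' :: "'n::finite \<Rightarrow> 'n ncps" and r :: real
    and M M' :: "'n \<Rightarrow> 'n list ell2 \<Rightarrow>\<^sub>L 'n list ell2"
  assumes r: "0 < r" "r < 1"
    and M: "\<And>i. clinear_op (M i)" "\<And>i. lmul id (M i) (g i)"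
    and M': "\<And>i. clinear_op (M' i)" "\<And>i. lmul id (M' i) (g' i)"
    and g': "\<And>i. ell2_seq (g' i)" "\<And>i \<alpha>. complex_of_real r ^ length \<alpha> * g' i \<alpha> = g i \<alpha>"
    and val: "has_value (\<lambda>j \<alpha>. complex_of_real r * f j \<alpha>) M' creation"
begin

text \<open>The coefficients of \<open>g i\<close> are the square-summable ones of
  \<open>g' i\<close> damped by \<open>r ^ length \<alpha>\<close>, so g(S) is
  \<open>dilation r\<close> of the vector \<open>g' i\<close> and converges absolutely.\<close>

lemma summable_inverse_creation: "summable (\<lambda>k. norm (hom_part (g i) creation k))"
  and inverse_creation_sums: "hom_part (g i) creation sums M i"
proof -
  define x where "x = Abs_ell2 (g' i)"
  have x: "coord x = g' i" unfolding x_def by (rule coord_Abs_ell2 [OF g'(1)])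
  have "g i = (\<lambda>\<alpha>. complex_of_real r ^ length \<alpha> * coord x \<alpha>)"
    by (simp add: x g'(2))
  then have h: "hom_part (g i) creation
      = hom_part (coord x) (\<lambda>i. op_scaleC (complex_of_real r) (creation i))"
    by (simp only:) (simp add: fun_eq_iff hom_part_dilate hom_part_scaleC clinear_op_creation)
  have "dilation r x = M i"
    using r by (intro lmul_unique [OF lmul_dilation]) (simp_all add: x g'(2) M(2))
  then show "hom_part (g i) creation sums M i"
    using hom_part_sums_dilation [of r x] r h by simp
  show "summable (\<lambda>k. norm (hom_part (g i) creation k))"
    using summable_dilation [of r x] r h by simp
qed

text \<open>Words in \<open>g\<close> are dilations by \<open>r\<close> of words in
  \<open>g'\<close>, so \<open>dilation r\<close> sends the vacuum value of an expression in
  \<open>M'\<close> to the same expression in \<open>M\<close>. The factor \<open>s\<close> is there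
  for radial limits.\<close>

lemma dilation_hom_part:
  "dilation r (hom_part p (\<lambda>i. s *\<^sub>R M' i) k (ket []))
    = hom_part p (\<lambda>i. s *\<^sub>R M i) k"
proof (rule dilation_lmul)
  let ?s = "complex_of_real s" and ?r = "complex_of_real r"
  have m: "lmul id (s *\<^sub>R M' i) (\<lambda>\<alpha>. ?s * g' i \<alpha>)" "lmul id (s *\<^sub>R M i) (\<lambda>\<alpha>. ?s * g i \<alpha>)" for i
    using lmul_scaleC [OF M'(2), of ?s i] lmul_scaleC [OF M(2), of ?s i]
    by (simp_all add: op_scaleC_of_real)
  show "lmul id (hom_part p (\<lambda>i. s *\<^sub>R M' i) k)
      (\<lambda>\<beta>. \<Sum>\<alpha> | length \<alpha> = k. p \<alpha> * ps_word (\<lambda>i \<alpha>. ?s * g' i \<alpha>) \<alpha> \<beta>)"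
    by (rule lmul_hom_part) (rule m)
  have 2: "lmul id (hom_part p (\<lambda>i. s *\<^sub>R M i) k)
      (\<lambda>\<beta>. \<Sum>\<alpha> | length \<alpha> = k. p \<alpha> * ps_word (\<lambda>i \<alpha>. ?s * g i \<alpha>) \<alpha> \<beta>)"
    by (rule lmul_hom_part) (rule m)
  have "ps_word g \<alpha> \<beta> = ?r ^ length \<beta> * ps_word g' \<alpha> \<beta>" for \<alpha> \<beta>
    using ps_word_dilate [of ?r g' \<alpha>] by (simp add: g'(2))
  then have "(\<Sum>\<alpha> | length \<alpha> = k. p \<alpha> * ps_word (\<lambda>i \<alpha>. ?s * g i \<alpha>) \<alpha> \<beta>)
      = ?r ^ length \<beta> * (\<Sum>\<alpha> | length \<alpha> = k. p \<alpha> * ps_word (\<lambda>i \<alpha>. ?s * g' i \<alpha>) \<alpha> \<beta>)" for \<beta>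
    by (simp add: ps_word_scale sum_distrib_left mult_ac)
  then show "lmul id (hom_part p (\<lambda>i. s *\<^sub>R M i) k)
      (\<lambda>\<beta>. ?r ^ length \<beta> * (\<Sum>\<alpha> | length \<alpha> = k. p \<alpha> * ps_word (\<lambda>i \<alpha>. ?s * g' i \<alpha>) \<alpha> \<beta>))"
    using 2 by simp
qed (use r in auto)

lemma dilation_creation: "dilation r (creation j (ket [])) = r *\<^sub>R creation j"
proof (rule dilation_lmul)
  show "lmul id (creation j) (ps_var j)" by (rule lmul_lshift) simp
  have "(\<lambda>\<beta>. complex_of_real r ^ length \<beta> * ps_var j \<beta>) = (\<lambda>\<beta>. complex_of_real r * ps_var j \<beta>)"
    by (simp add: ps_var_def fun_eq_iff)
  then show "lmul id (r *\<^sub>R creation j) (\<lambda>\<beta>. complex_of_real r ^ length \<beta> * ps_var j \<beta>)"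
    using lmul_scaleC [OF lmul_lshift [OF inj_on_id], of "complex_of_real r" j]
    by (simp only: op_scaleC_of_real)
qed (use r in auto)

text \<open>The convergence given for the model of \<open>r f\<close> is read at the vacuum vector
  and pushed through the bounded map \<open>(1 / r) *\<^sub>R dilation r\<close>. The factor
  \<open>1 / r\<close> cancels the \<open>r\<close> in \<open>r f\<close> on one side and the
  \<open>r\<close> from dilating a creation operator on the other.\<close>

lemma norm_value_creation: "norm_value f M creation"
proof -
  let ?f = "\<lambda>j \<alpha>. complex_of_real r * f j \<alpha>"
  let ?F = "\<lambda>j s. ps_eval (?f j) (\<lambda>i. s *\<^sub>R M' i)"
  have hom: "hom_part (?f j) X k = r *\<^sub>R hom_part (f j) X k"
    for j k and X :: "'n \<Rightarrow> 'n list ell2 \<Rightarrow>\<^sub>L 'n list ell2"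
    by (simp add: hom_part_scale op_scaleC_of_real)
  have bl: "bounded_linear (dilation r :: 'n list ell2 \<Rightarrow> _)"
    using r by (intro bounded_linear_dilation) auto
  have bl': "bounded_linear (\<lambda>x. (1 / r) *\<^sub>R dilation r x :: 'n list ell2 \<Rightarrow>\<^sub>L 'n list ell2)"
    by (rule bounded_linear_compose [OF bounded_linear_scaleR_right bl])
  have d: "(1 / r) *\<^sub>R dilation r (hom_part (?f j) (\<lambda>i. s *\<^sub>R M' i) k (ket []))
      = hom_part (f j) (\<lambda>i. s *\<^sub>R M i) k" for j s k
    using r by (simp only: dilation_hom_part) (simp add: hom)
  have dc: "(1 / r) *\<^sub>R dilation r (creation j (ket [])) = creation j" for j :: 'n
    using r by (simp add: dilation_creation)
  from val consider "sot_value ?f M' creation" | "rad_value ?f M' creation"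
    by (auto simp: has_value_def)
  then show ?thesis
  proof cases
    case 1
    have "hom_part (f j) M sums creation j" for j
    proof -
      have "(\<lambda>k. hom_part (?f j) M' k (ket [])) sums creation j (ket [])"
        using 1 by (simp add: sot_value_def)
      from bounded_linear.sums [OF bl' this] show ?thesis
        using d [of j 1] by (simp add: dc)
    qed
    then show ?thesis by (simp add: norm_value_def)
  next
    case 2
    then obtain \<delta> where \<delta>: "\<delta> \<in> {0<..<1}"
      "\<And>s j. s \<in> {\<delta><..<1} \<Longrightarrow> summable (hom_part (?f j) (\<lambda>i. s *\<^sub>R M' i))"
      unfolding rad_value_def by auto
    have lim: "((\<lambda>s. ?F j s h)
        \<longlongrightarrow> creation j h) (at_left 1)" for j h
      using 2 by (simp only: rad_value_def)
    have sums: "hom_part (f j) (\<lambda>i. s *\<^sub>R M i)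
        sums ((1 / r) *\<^sub>R dilation r (?F j s (ket [])))"
      if "s \<in> {\<delta><..<1}" for s j
    proof -
      have "hom_part (?f j) (\<lambda>i. s *\<^sub>R M' i) sums ?F j s"
        unfolding ps_eval_def by (rule summable_sums [OF \<delta>(2) [OF that]])
      from bounded_linear.sums [OF bl' sums_blinfun_apply [OF this, of "ket []"]]
      show ?thesis by (simp only: d)
    qed
    have "((\<lambda>s. ps_eval (f j) (\<lambda>i. s *\<^sub>R M i)) \<longlongrightarrow> creation j) (at_left 1)" for j
    proof (rule Lim_transform_eventually)
      show "((\<lambda>s. (1 / r) *\<^sub>R dilation r (?F j s (ket [])))
          \<longlongrightarrow> creation j) (at_left 1)"
        using bounded_linear.tendsto [OF bl' lim [of j "ket []"]] by (simp only: dc)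
      have "\<forall>\<^sub>F s in at_left 1. s \<in> {\<delta><..<1}"
        using \<delta>(1) by (intro eventually_at_leftI [of \<delta>]) auto
      then show "\<forall>\<^sub>F s in at_left 1.
          (1 / r) *\<^sub>R dilation r (?F j s (ket []))
            = ps_eval (f j) (\<lambda>i. s *\<^sub>R M i)"
        by eventually_elim (use sums in \<open>auto simp: ps_eval_def [of "f j"] sums_iff\<close>)
    qed
    moreover have "summable (hom_part (f j) (\<lambda>i. s *\<^sub>R M i))" if "s \<in> {\<delta><..<1}" for s j
      using sums [OF that] by (rule sums_summable)
    ultimately show ?thesis
      using \<delta>(1) unfolding norm_value_def by (intro disjI2 conjI bexI [of _ \<delta>]) auto
  qed
qed

end

section \<open>The domain algebra\<close>

lemma poly_op_in_domain_algebra: "ps_polynomial p \<Longrightarrow> poly_op p X \<in> domain_algebra X"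
  unfolding domain_algebra_def by (rule subsetD [OF closure_subset]) auto

lemma closed_domain_algebra: "closed (domain_algebra X)"
  by (simp add: domain_algebra_def)

lemma domain_algebraE:
  assumes "T \<in> domain_algebra X"
  obtains p where "\<And>n. ps_polynomial (p n)" "(\<lambda>n. poly_op (p n) X) \<longlonglongrightarrow> T"
proof -
  obtain S where S: "\<And>n. S n \<in> {poly_op p X |p. ps_polynomial p}" "S \<longlonglongrightarrow> T"
    using assms unfolding domain_algebra_def closure_sequential by blast
  have "\<forall>n. \<exists>p. ps_polynomial p \<and> S n = poly_op p X" using S(1) by blast
  then obtain p where "\<And>n. ps_polynomial (p n)" "\<And>n. S n = poly_op (p n) X" by metis
  moreover from this(2) have "S = (\<lambda>n. poly_op (p n) X)" by (rule ext)
  ultimately show ?thesis using S(2) by (intro that [of p]) simp_all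
qed

lemma domain_algebra_limit:
  assumes "(T \<longlongrightarrow> T') F" "\<forall>\<^sub>F n in F. T n \<in> domain_algebra X" "F \<noteq> bot"
  shows "T' \<in> domain_algebra X"
  by (rule Lim_in_closed_set [OF closed_domain_algebra assms(2,3,1)])

lemma domain_algebra_add:
  assumes "S \<in> domain_algebra X" "T \<in> domain_algebra X"
  shows "S + T \<in> domain_algebra X"
proof -
  obtain p where p: "\<And>n. ps_polynomial (p n)" "(\<lambda>n. poly_op (p n) X) \<longlonglongrightarrow> S"
    using domain_algebraE [OF assms(1)] by blast
  obtain q where q: "\<And>n. ps_polynomial (q n)" "(\<lambda>n. poly_op (q n) X) \<longlonglongrightarrow> T"
    using domain_algebraE [OF assms(2)] by blast
  show ?thesis
    by (rule domain_algebra_limit [OF tendsto_add [OF p(2) q(2)]])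
      (auto simp: p q poly_op_add [symmetric] intro!: always_eventually poly_op_in_domain_algebra ps_polynomial_add)
qed

lemma domain_algebra_scaleC:
  assumes "T \<in> domain_algebra X"
  shows "op_scaleC c T \<in> domain_algebra X"
proof -
  obtain q where q: "\<And>n. ps_polynomial (q n)" "(\<lambda>n. poly_op (q n) X) \<longlonglongrightarrow> T"
    using domain_algebraE [OF assms] by blast
  show ?thesis
    by (rule domain_algebra_limit [OF bounded_linear.tendsto [OF bounded_linear_op_scaleC q(2)]])
      (auto simp: q poly_op_scale [symmetric] intro!: always_eventually poly_op_in_domain_algebra ps_polynomial_scale)
qed

lemma domain_algebra_scaleR: "T \<in> domain_algebra X \<Longrightarrow> s *\<^sub>R T \<in> domain_algebra X"
  using domain_algebra_scaleC [of T X "of_real s"] by (simp add: op_scaleC_of_real)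

lemma tendsto_blinfun_compose:
  "(S \<longlongrightarrow> S') F \<Longrightarrow> (T \<longlongrightarrow> T') F \<Longrightarrow> ((\<lambda>n. S n o\<^sub>L T n) \<longlongrightarrow> S' o\<^sub>L T') F"
  by (rule bounded_bilinear.tendsto [OF bounded_bilinear_blinfun_compose])

lemma domain_algebra_compose:
  assumes "\<And>i. clinear_op (X i)" "S \<in> domain_algebra X" "T \<in> domain_algebra X"
  shows "S o\<^sub>L T \<in> domain_algebra X"
proof -
  obtain p where p: "\<And>n. ps_polynomial (p n)" "(\<lambda>n. poly_op (p n) X) \<longlonglongrightarrow> S"
    using domain_algebraE [OF assms(2)] by blast
  obtain q where q: "\<And>n. ps_polynomial (q n)" "(\<lambda>n. poly_op (q n) X) \<longlonglongrightarrow> T"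
    using domain_algebraE [OF assms(3)] by blast
  show ?thesis
    by (rule domain_algebra_limit [OF tendsto_blinfun_compose [OF p(2) q(2)]])
      (auto simp: p q poly_op_mult [symmetric] assms(1)
        intro!: always_eventually poly_op_in_domain_algebra ps_polynomial_mult)
qed

lemma domain_algebra_id: "id_blinfun \<in> domain_algebra X"
  using poly_op_in_domain_algebra [OF ps_polynomial_one, of X] by (simp add: poly_op_one)

lemma domain_algebra_generator: "X i \<in> domain_algebra X"
  using poly_op_in_domain_algebra [OF ps_polynomial_var, of i X] by (simp add: poly_op_var)

lemma domain_algebra_zero: "0 \<in> domain_algebra X"
  using domain_algebra_scaleC [OF domain_algebra_id, of 0] by simp

lemma domain_algebra_sum:
  "(\<And>a. a \<in> A \<Longrightarrow> T a \<in> domain_algebra X) \<Longrightarrow> (\<Sum>a\<in>A. T a) \<in> domain_algebra X"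
  by (induction A rule: infinite_finite_induct) (auto simp: domain_algebra_zero domain_algebra_add)

lemma domain_algebra_sums:
  assumes "T sums T'" "\<And>k. T k \<in> domain_algebra X"
  shows "T' \<in> domain_algebra X"
  using assms unfolding sums_def
  by (intro domain_algebra_limit [of _ T' sequentially]) (auto intro!: always_eventually domain_algebra_sum)

context
  fixes X :: "'n \<Rightarrow> 'h::chilbert \<Rightarrow>\<^sub>L 'h"
  assumes X: "\<And>i. clinear_op (X i)"
begin

lemma domain_algebra_op_word:
  "(\<And>i. Y i \<in> domain_algebra X) \<Longrightarrow> op_word Y \<alpha> \<in> domain_algebra X"
  by (induction \<alpha>) (auto simp: domain_algebra_id intro: domain_algebra_compose X)

lemma domain_algebra_hom_part:
  "(\<And>i. Y i \<in> domain_algebra X) \<Longrightarrow> hom_part p Y k \<in> domain_algebra X"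
  unfolding hom_part_def by (intro domain_algebra_sum domain_algebra_scaleC domain_algebra_op_word)

lemma domain_algebra_subset:
  "(\<And>i. Y i \<in> domain_algebra X) \<Longrightarrow> domain_algebra Y \<subseteq> domain_algebra X"
  unfolding domain_algebra_def [of Y]
  by (rule closure_minimal [OF _ closed_domain_algebra])
    (auto simp: poly_op_def intro!: domain_algebra_sum domain_algebra_scaleC domain_algebra_op_word)

end

section \<open>Characters\<close>

context
  fixes X :: "'n::finite \<Rightarrow> 'h::chilbert \<Rightarrow>\<^sub>L 'h" and \<phi> :: "('h \<Rightarrow>\<^sub>L 'h) \<Rightarrow> complex"
  assumes X: "\<And>i. clinear_op (X i)" and \<phi>: "\<phi> \<in> characters (domain_algebra X)"
begin

lemma character_add: "S \<in> domain_algebra X \<Longrightarrow> T \<in> domain_algebra X \<Longrightarrow> \<phi> (S + T) = \<phi> S + \<phi> T"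
  and character_scaleC: "T \<in> domain_algebra X \<Longrightarrow> \<phi> (op_scaleC c T) = c * \<phi> T"
  and character_compose: "S \<in> domain_algebra X \<Longrightarrow> T \<in> domain_algebra X \<Longrightarrow> \<phi> (S o\<^sub>L T) = \<phi> S * \<phi> T"
  and character_extensional: "\<phi> \<in> extensional (domain_algebra X)"
  using \<phi> by (auto simp: characters_def)

lemma character_id: "\<phi> id_blinfun = 1"
proof -
  obtain T where T: "T \<in> domain_algebra X" "\<phi> T \<noteq> 0" using \<phi> by (auto simp: characters_def)
  then show ?thesis using character_compose [OF domain_algebra_id T(1)] by simp
qed

lemma character_zero: "\<phi> 0 = 0"
  using character_scaleC [OF domain_algebra_id, of 0] by simp

lemma character_sum:
  "(\<And>a. a \<in> A \<Longrightarrow> T a \<in> domain_algebra X) \<Longrightarrow> \<phi> (\<Sum>a\<in>A. T a) = (\<Sum>a\<in>A. \<phi> (T a))"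
  by (induction A rule: infinite_finite_induct)
    (auto simp: character_zero character_add domain_algebra_sum)

lemma domain_algebra_diff:
  "S \<in> domain_algebra X \<Longrightarrow> T \<in> domain_algebra X \<Longrightarrow> S - T \<in> domain_algebra X"
  using domain_algebra_add [OF _ domain_algebra_scaleC, of S X T "-1"]
  by (simp add: op_scaleC_minus_one)

lemma character_diff:
  "S \<in> domain_algebra X \<Longrightarrow> T \<in> domain_algebra X \<Longrightarrow> \<phi> (S - T) = \<phi> S - \<phi> T"
  using character_add [OF _ domain_algebra_scaleC, of S T "-1"] character_scaleC [of T "-1"]
  by (simp add: op_scaleC_minus_one)

text \<open>If \<open>\<phi> T = 1\<close> and \<open>\<parallel>T\<parallel> < 1\<close>, the Neumann series \<open>R = T + T\<^sup>2 + \<dots>\<close> satisfies \<open>R = T + T R\<close>, hence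
  \<open>\<phi> R = 1 + \<phi> R\<close>.\<close>

lemma character_contractive:
  assumes T: "T \<in> domain_algebra X"
  shows "cmod (\<phi> T) \<le> norm T"
proof (rule ccontr)
  assume "\<not> cmod (\<phi> T) \<le> norm T"
  then have less: "norm T < cmod (\<phi> T)" by simp
  then have nz: "\<phi> T \<noteq> 0" by (auto dest: order_le_less_trans [OF norm_ge_zero])
  define S where "S = op_scaleC (1 / \<phi> T) T"
  have S: "S \<in> domain_algebra X" and \<phi>S: "\<phi> S = 1"
    using T nz by (simp_all add: S_def domain_algebra_scaleC character_scaleC)
  have "norm S \<le> cmod (1 / \<phi> T) * norm T" unfolding S_def by (rule norm_op_scaleC_le)
  also have "\<dots> < 1" using less nz by (simp add: norm_divide divide_simps)
  finally have S1: "norm S < 1" .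
  define W where "W k = ((\<lambda>R. S o\<^sub>L R) ^^ k) id_blinfun" for k
  have W: "W 0 = id_blinfun" "W (Suc k) = S o\<^sub>L W k" for k by (simp_all add: W_def)
  have WA: "W k \<in> domain_algebra X" for k
    by (induction k) (auto simp: W domain_algebra_id intro: domain_algebra_compose X S)
  have Wn: "norm (W k) \<le> norm S ^ k" for k
  proof (induction k)
    case 0
    show ?case by (simp add: W norm_blinfun_id_le)
  next
    case (Suc k)
    show ?case
      unfolding W power_Suc by (rule order_trans [OF norm_compose_le mult_left_mono [OF Suc]]) simp
  qed
  have "summable W"
    by (rule summable_comparison_test' [where g = "\<lambda>k. norm S ^ k"])
      (use S1 Wn in \<open>auto intro: summable_geometric\<close>)
  then obtain R where R: "W sums R" using summable_sums by blast
  have RA: "R \<in> domain_algebra X" by (rule domain_algebra_sums [OF R WA])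
  have "(\<lambda>k. W (Suc k)) sums (R - id_blinfun)"
    using sums_iff_shift' [of W 1 R] R by (simp add: W)
  moreover have "(\<lambda>k. W (Suc k)) sums (S o\<^sub>L R)"
    unfolding W by (rule sums_compose_left [OF R])
  ultimately have "S o\<^sub>L R = R - id_blinfun" by (rule sums_unique2 [symmetric])
  then have "\<phi> R = \<phi> R - 1"
    using character_compose [OF S RA] character_diff [OF RA domain_algebra_id]
    by (simp add: \<phi>S character_id)
  then show False by simp
qed

lemma character_tendsto:
  assumes "(T \<longlongrightarrow> T') F" "\<forall>\<^sub>F n in F. T n \<in> domain_algebra X" "T' \<in> domain_algebra X"
  shows "((\<lambda>n. \<phi> (T n)) \<longlongrightarrow> \<phi> T') F"
proof -
  have lim: "((\<lambda>n. norm (T n - T')) \<longlongrightarrow> 0) F"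
    using assms(1) by (simp add: tendsto_norm_zero_iff LIM_zero_iff)
  have "\<forall>\<^sub>F n in F. norm (\<phi> (T n) - \<phi> T') \<le> norm (T n - T')"
    using assms(2)
    by eventually_elim
      (metis assms(3) character_contractive character_diff domain_algebra_diff)
  then have "((\<lambda>n. \<phi> (T n) - \<phi> T') \<longlongrightarrow> 0) F"
    by (rule Lim_null_comparison [OF _ lim])
  then show ?thesis by (rule LIM_zero_cancel)
qed

lemma character_sums:
  assumes "T sums T'" "\<And>k. T k \<in> domain_algebra X"
  shows "(\<lambda>k. \<phi> (T k)) sums \<phi> T'"
proof -
  have "(\<lambda>n. \<phi> (\<Sum>k<n. T k)) \<longlonglongrightarrow> \<phi> T'"
    using assms domain_algebra_sums [OF assms]
    by (intro character_tendsto) (auto simp: sums_def intro!: always_eventually domain_algebra_sum)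
  then show ?thesis by (simp add: sums_def character_sum assms(2))
qed

lemma character_continuous: "continuous_on (domain_algebra X) \<phi>"
  unfolding continuous_on_def
  by (auto intro!: character_tendsto tendsto_ident_at simp: eventually_at_filter)

lemma character_op_word:
  assumes "\<And>i. Y i \<in> domain_algebra X" "\<And>i. \<phi> (Y i) = z $ i"
  shows "op_word (scal z) \<alpha> = op_scaleC (\<phi> (op_word Y \<alpha>)) id_blinfun"
  by (induction \<alpha>)
    (simp_all add: character_id character_compose assms domain_algebra_op_word X scal_def
      op_scaleC_compose_left op_scaleC_op_scaleC)

lemma character_hom_part:
  assumes "\<And>i. Y i \<in> domain_algebra X" "\<And>i. \<phi> (Y i) = z $ i"
  shows "hom_part p (scal z) k = op_scaleC (\<phi> (hom_part p Y k)) id_blinfun"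
  unfolding hom_part_def
  by (subst character_sum)
    (auto simp: domain_algebra_scaleC domain_algebra_op_word X assms character_scaleC
      character_op_word [OF assms] op_scaleC_op_scaleC op_scaleC_sum_left)

lemma character_poly_op:
  assumes "\<And>i. Y i \<in> domain_algebra X" "\<And>i. \<phi> (Y i) = z $ i"
  shows "\<phi> (poly_op p Y) = poly_scalar p z"
proof -
  have "poly_op p (scal z) = op_scaleC (\<phi> (poly_op p Y)) id_blinfun"
    unfolding poly_op_def
    by (subst character_sum)
      (auto simp: domain_algebra_scaleC domain_algebra_op_word X assms character_scaleC
        character_op_word [OF assms] op_scaleC_op_scaleC op_scaleC_sum_left)
  then show ?thesis by (simp add: poly_scalar_eq scaleC_complex_def)
qed

text \<open>Contractivity lets the character pass through norm limits, and multiplicativity turns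
  homogeneous parts at \<open>Y\<close> into homogeneous parts at the scalar point. In the radial
  alternative the same \<delta> remains valid.\<close>

lemma character_has_value:
  assumes "norm_value f Y Z" "\<And>i. Y i \<in> domain_algebra X" "\<And>i. Z i \<in> domain_algebra X"
    and z: "\<And>i. \<phi> (Y i) = z $ i" and w: "\<And>i. \<phi> (Z i) = w $ i"
  shows "has_value f (scal z) (scal w)"
proof -
  have bl: "bounded_linear (\<lambda>c. op_scaleC c (id_blinfun :: complex \<Rightarrow>\<^sub>L complex))"
    by (rule bounded_linear_intro [where K = 1])
      (simp_all add: op_scaleC_add_left op_scaleC_op_scaleC scaleR_conv_of_real
        order_trans [OF norm_op_scaleC_le] flip: op_scaleC_of_real)
  consider "\<forall>j. hom_part (f j) Y sums Z j"
    | \<delta> where "\<delta> \<in> {0<..<1}" "\<And>s j. s \<in> {\<delta><..<1} \<Longrightarrow> summable (hom_part (f j) (\<lambda>i. s *\<^sub>R Y i))"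
      "\<And>j. ((\<lambda>s. ps_eval (f j) (\<lambda>i. s *\<^sub>R Y i)) \<longlongrightarrow> Z j) (at_left 1)"
    using assms(1) unfolding norm_value_def by auto
  then show ?thesis
  proof cases
    case 1
    have "hom_part (f j) (scal z) sums scal w j" for j
    proof -
      have "hom_part (f j) (scal z) = (\<lambda>k. op_scaleC (\<phi> (hom_part (f j) Y k)) id_blinfun)"
        by (rule ext) (rule character_hom_part [OF assms(2) z])
      then show ?thesis
        using bounded_linear.sums [OF bl character_sums [OF 1 [rule_format, of j]]] assms(2)
        by (simp add: domain_algebra_hom_part X scal_def [of w] w)
    qed
    then show ?thesis by (simp add: has_value_def sot_value_def sums_blinfun_apply)
  next
    case 2
    let ?F = "\<lambda>j s. ps_eval (f j) (\<lambda>i. s *\<^sub>R Y i)"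
    have YA: "s *\<^sub>R Y i \<in> domain_algebra X" for s i by (intro domain_algebra_scaleR assms)
    have zs: "\<phi> (s *\<^sub>R Y i) = (s *\<^sub>R z) $ i" for s i
      using character_scaleC [OF assms(2), of "of_real s" i]
      by (simp add: op_scaleC_of_real z) (simp add: scaleR_conv_of_real)
    have sc: "(\<lambda>i. s *\<^sub>R scal z i) = scal (s *\<^sub>R z)" for s
      by (simp add: fun_eq_iff scal_def op_scaleC_op_scaleC flip: op_scaleC_of_real)
        (simp add: scaleR_conv_of_real)
    have ev: "hom_part (f j) (\<lambda>i. s *\<^sub>R Y i) sums ?F j s"
      "?F j s \<in> domain_algebra X"
      "hom_part (f j) (\<lambda>i. s *\<^sub>R scal z i) sums
        op_scaleC (\<phi> (?F j s)) id_blinfun" if "s \<in> {\<delta><..<1}" for s j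
    proof -
      show 1: "hom_part (f j) (\<lambda>i. s *\<^sub>R Y i) sums ?F j s"
        unfolding ps_eval_def by (rule summable_sums [OF 2(2) [OF that]])
      show "?F j s \<in> domain_algebra X"
        by (rule domain_algebra_sums [OF 1]) (intro domain_algebra_hom_part X YA)
      show "hom_part (f j) (\<lambda>i. s *\<^sub>R scal z i) sums
          op_scaleC (\<phi> (?F j s)) id_blinfun"
        using bounded_linear.sums [OF bl character_sums [OF 1]]
        by (simp add: sc character_hom_part [OF YA zs] domain_algebra_hom_part X YA cong: sums_cong)
    qed
    have \<delta>: "\<forall>\<^sub>F s in at_left 1. s \<in> {\<delta><..<1}"
      using 2(1) by (intro eventually_at_leftI [of \<delta>]) auto
    have "((\<lambda>s. ps_eval (f j) (\<lambda>i. s *\<^sub>R scal z i)) \<longlongrightarrow> scal w j) (at_left 1)" for j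
    proof (rule Lim_transform_eventually)
      have "\<forall>\<^sub>F s in at_left 1. ?F j s \<in> domain_algebra X"
        using \<delta> by eventually_elim (rule ev)
      then have "((\<lambda>s. \<phi> (?F j s)) \<longlongrightarrow> \<phi> (Z j)) (at_left 1)"
        by (rule character_tendsto [OF 2(3) _ assms(3)])
      from bounded_linear.tendsto [OF bl this]
      show "((\<lambda>s. op_scaleC (\<phi> (?F j s)) id_blinfun) \<longlongrightarrow> scal w j) (at_left 1)"
        by (simp add: w scal_def)
      show "\<forall>\<^sub>F s in at_left 1. op_scaleC (\<phi> (?F j s)) id_blinfun
          = ps_eval (f j) (\<lambda>i. s *\<^sub>R scal z i)"
        using \<delta> by eventually_elim (use ev(3) in \<open>auto simp: ps_eval_def [of _ "\<lambda>i. _ *\<^sub>R scal z i"] sums_iff\<close>)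
    qed
    moreover have "summable (hom_part (f j) (\<lambda>i. s *\<^sub>R scal z i))" if "s \<in> {\<delta><..<1}" for s j
      using ev(3) [OF that] by (rule sums_summable)
    ultimately have "rad_value f (scal z) (scal w)"
      unfolding rad_value_def using 2(1)
      by (intro conjI bexI [of _ \<delta>] ballI allI tendsto_blinfun_apply)
    then show ?thesis by (simp add: has_value_def)
  qed
qed

lemma continuous_eq_character:
  assumes "\<psi> \<in> extensional (domain_algebra X)" "continuous_on (domain_algebra X) \<psi>"
    and "\<And>p. ps_polynomial p \<Longrightarrow> \<psi> (poly_op p X) = \<phi> (poly_op p X)"
  shows "\<psi> = \<phi>"
proof (rule extensionalityI [OF assms(1) character_extensional])
  fix T assume T: "T \<in> domain_algebra X"
  obtain p where p: "\<And>n. ps_polynomial (p n)" "(\<lambda>n. poly_op (p n) X) \<longlonglongrightarrow> T"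
    using domain_algebraE [OF T] by blast
  have "(\<lambda>n. \<psi> (poly_op (p n) X)) \<longlonglongrightarrow> \<psi> T" "(\<lambda>n. \<phi> (poly_op (p n) X)) \<longlonglongrightarrow> \<phi> T"
    using continuous_on_tendsto_compose [OF assms(2) p(2) T]
      continuous_on_tendsto_compose [OF character_continuous p(2) T] p(1)
    by (auto simp: poly_op_in_domain_algebra)
  then show "\<psi> T = \<phi> T" by (simp add: assms(3) p(1) LIMSEQ_unique)
qed

text \<open>A character is continuous and agrees with evaluation on polynomials, which are dense, so
  it is the unique function that \<open>THE\<close> selects; only its values at the generators need
  checking.\<close>

lemma point_character_eq:
  assumes "\<And>i. \<phi> (X i) = z $ i"
  shows "point_character X z = \<phi>"
  unfolding point_character_def
proof (rule the_equality)
  show "\<phi> \<in> extensional (domain_algebra X) \<and> continuous_on (domain_algebra X) \<phi>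
      \<and> (\<forall>p. ps_polynomial p \<longrightarrow> \<phi> (poly_op p X) = poly_scalar p z)"
    by (simp add: character_extensional character_continuous
        character_poly_op [OF domain_algebra_generator assms])
  fix \<psi> assume "\<psi> \<in> extensional (domain_algebra X) \<and> continuous_on (domain_algebra X) \<psi>
      \<and> (\<forall>p. ps_polynomial p \<longrightarrow> \<psi> (poly_op p X) = poly_scalar p z)"
  then show "\<psi> = \<phi>"
    by (intro continuous_eq_character)
      (auto simp: character_poly_op [OF domain_algebra_generator assms])
qed

end

lemma character_unique:
  fixes X :: "'n::finite \<Rightarrow> 'h::chilbert \<Rightarrow>\<^sub>L 'h"
  assumes "\<And>i. clinear_op (X i)" "\<phi> \<in> characters (domain_algebra X)"
    and "\<psi> \<in> characters (domain_algebra X)" "\<And>i. \<phi> (X i) = \<psi> (X i)"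
  shows "\<phi> = \<psi>"
  using point_character_eq [OF assms(1,2), of "\<chi> i. \<phi> (X i)"]
    point_character_eq [OF assms(1,3), of "\<chi> i. \<phi> (X i)"] assms(4) by simp

lemma continuous_on_poly_scalar:
  fixes p :: "'n::finite ncps"
  shows "continuous_on D (poly_scalar p)"
proof -
  have "continuous_on D (\<lambda>z :: complex ^ 'n. prod_list (map (\<lambda>i. z $ i) \<alpha>))" for \<alpha>
    by (induction \<alpha>) (auto intro!: continuous_intros)
  then show ?thesis
    unfolding poly_scalar_def [abs_def] by (intro continuous_intros)
qed

text \<open>Contractivity makes polynomial approximation of \<open>T\<close> uniform over all
  characters involved, so the function is a uniform limit of polynomials in z.\<close>

lemma continuous_on_characters:
  fixes X :: "'n::finite \<Rightarrow> 'h::chilbert \<Rightarrow>\<^sub>L 'h"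
  assumes X: "\<And>i. clinear_op (X i)"
    and \<phi>: "\<And>z. z \<in> D \<Longrightarrow> \<phi> z \<in> characters (domain_algebra X)"
    and gen: "\<And>z i. z \<in> D \<Longrightarrow> \<phi> z (X i) = z $ i"
    and T: "T \<in> domain_algebra X"
  shows "continuous_on D (\<lambda>z. \<phi> z T)"
proof -
  obtain p where p: "\<And>n. ps_polynomial (p n)" "(\<lambda>n. poly_op (p n) X) \<longlonglongrightarrow> T"
    using domain_algebraE [OF T] by blast
  have "uniform_limit D (\<lambda>n. poly_scalar (p n)) (\<lambda>z. \<phi> z T) sequentially"
  proof (rule uniform_limitI)
    fix e :: real assume "0 < e"
    with p(2) have "\<forall>\<^sub>F n in sequentially. dist (poly_op (p n) X) T < e" by (rule tendstoD)
    then show "\<forall>\<^sub>F n in sequentially. \<forall>z\<in>D. dist (poly_scalar (p n) z) (\<phi> z T) < e"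
    proof eventually_elim
      case (elim n)
      show ?case
      proof
        fix z assume z: "z \<in> D"
        have pA: "poly_op (p n) X \<in> domain_algebra X"
          by (rule poly_op_in_domain_algebra [OF p(1)])
        have "dist (poly_scalar (p n) z) (\<phi> z T) = cmod (\<phi> z (poly_op (p n) X - T))"
          by (simp add: dist_norm character_diff [OF X \<phi> [OF z] pA T]
              character_poly_op [OF X \<phi> [OF z] domain_algebra_generator gen [OF z]])
        also have "\<dots> \<le> norm (poly_op (p n) X - T)"
          by (intro character_contractive [OF X \<phi> [OF z]] domain_algebra_diff [OF X \<phi> [OF z]] pA T)
        finally show "dist (poly_scalar (p n) z) (\<phi> z T) < e" using elim by (simp add: dist_norm)
      qed
    qed
  qed
  then show ?thesis
    by (rule uniform_limit_theorem [OF always_eventually, rotated])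
      (auto intro: continuous_on_poly_scalar)
qed

section \<open>Evaluation characters of the closed ball\<close>

text \<open>If b were less than a, the powers of b/a would decay exponentially and overcome the
  linear factor.\<close>

lemma le_of_power_le_linear:
  fixes a b :: real
  assumes "0 \<le> a" "0 \<le> b" "\<And>m. a ^ m \<le> (real m * d + 1) * b ^ m"
  shows "a \<le> b"
proof (rule ccontr)
  assume "\<not> a \<le> b"
  then have ab: "b < a" "0 < a" using assms(2) by auto
  define x where "x = b / a"
  have x: "norm x < 1" "0 \<le> x" using ab assms(2) by (simp_all add: x_def)
  have "(\<lambda>m. d * (real m * x ^ m) + x ^ m) \<longlonglongrightarrow> d * 0 + 0"
    using x by (intro tendsto_intros powser_times_n_limit_0 LIMSEQ_power_zero)
  then have "\<forall>\<^sub>F m in sequentially. d * (real m * x ^ m) + x ^ m < 1"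
    by (intro order_tendstoD(2)) auto
  then obtain m where "d * (real m * x ^ m) + x ^ m < 1"
    using eventually_happens' [OF sequentially_bot] by blast
  moreover have "1 \<le> d * (real m * x ^ m) + x ^ m"
    using assms(3) [of m] ab by (simp add: x_def power_divide field_simps)
  ultimately show False by simp
qed

lemma poly_scalar_mult:
  fixes p :: "'n::finite ncps"
  assumes "ps_polynomial p" "ps_polynomial q"
  shows "poly_scalar (ps_mult p q) z = poly_scalar p z * poly_scalar q z"
proof -
  have *: "poly_op r (scal z) = op_scaleC (poly_scalar r z) id_blinfun" for r
    unfolding poly_scalar_eq by (rule clinear_op_complex) (rule clinear_op_poly_op, rule clinear_op_scal)
  have "poly_op (ps_mult p q) (scal z) = poly_op p (scal z) o\<^sub>L poly_op q (scal z)"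
    by (intro poly_op_mult clinear_op_scal assms)
  then have "blinfun_apply (poly_op (ps_mult p q) (scal z)) 1
      = blinfun_apply (poly_op p (scal z)) (blinfun_apply (poly_op q (scal z)) 1)"
    by simp
  then show ?thesis by (simp add: * scaleC_complex_def)
qed

lemma poly_scalar_one: "poly_scalar ps_one z = 1"
  by (simp add: poly_scalar_eq poly_op_one)

lemma ps_mult_degree:
  assumes "\<And>\<alpha>. d < length \<alpha> \<Longrightarrow> p \<alpha> = 0" "\<And>\<alpha>. e < length \<alpha> \<Longrightarrow> q \<alpha> = 0" "d + e < length \<beta>"
  shows "ps_mult p q \<beta> = 0"
  unfolding ps_mult_eq_sum_splits
proof (rule sum.neutral, rule ballI)
  fix z assume "z \<in> {z. fst z @ snd z = \<beta>}"
  then have "length (fst z) + length (snd z) = length \<beta>"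
    by (metis (mono_tags) length_append mem_Collect_eq)
  then have "d < length (fst z) \<or> e < length (snd z)" using assms(3) by linarith
  then show "p (fst z) * q (snd z) = 0" using assms(1,2) by auto
qed

text \<open>The Hilbert norm of the coefficients is the norm of p(S) at the vacuum vector, and it
  bounds the value of each of the \<open>d + 1\<close> homogeneous parts at
  \<open>z\<close>.\<close>

lemma poly_scalar_crude_bound:
  fixes p :: "'n::finite ncps"
  assumes d: "\<And>\<alpha>. d < length \<alpha> \<Longrightarrow> p \<alpha> = 0" and z: "norm z \<le> 1"
  shows "cmod (poly_scalar p z) \<le> (real d + 1) * norm (poly_op p creation)"
proof -
  have poly: "ps_polynomial p" by (rule ps_polynomialI [of "Suc d"]) (use d in auto)
  then have l2: "ell2_seq p" by (rule ell2_seq_polynomial)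
  have "ell2_norm p = norm (poly_op p creation (ket []))"
    using lmul_symbol_id [OF lmul_poly_op_lshift [OF inj_on_id poly]] by (simp add: norm_ell2_def)
  also have "\<dots> \<le> norm (poly_op p creation) * norm (ket [] :: 'n list ell2)" by (rule norm_blinfun)
  also have "\<dots> \<le> norm (poly_op p creation)" using norm_ket by (rule mult_left_le) simp
  finally have le: "ell2_norm p \<le> norm (poly_op p creation)" .
  have "norm (hom_part p (scal z) k) \<le> norm (poly_op p creation)" for k
  proof -
    have "norm (hom_part p (scal z) k) \<le> ell2_norm p * norm z ^ k"
      using norm_hom_part_ell2_le [of "scal z" p k] by (simp add: clinear_op_scal l2 row_norm_scal)
    also have "\<dots> \<le> ell2_norm p * 1"
      using z by (intro mult_left_mono power_le_one) (auto simp: ell2_norm_nonneg)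
    finally show ?thesis using le by simp
  qed
  then have "norm (\<Sum>k<Suc d. hom_part p (scal z) k) \<le> (\<Sum>k<Suc d. norm (poly_op p creation))"
    by (intro sum_norm_le)
  then have "norm (poly_op p (scal z)) \<le> (real d + 1) * norm (poly_op p creation)"
    by (subst poly_op_eq_sum_less [of "Suc d"]) (use d in \<open>auto simp: add.commute\<close>)
  moreover have "cmod (poly_scalar p z) \<le> norm (poly_op p (scal z))"
    unfolding poly_scalar_eq using norm_blinfun [of "poly_op p (scal z)" 1] by simp
  ultimately show ?thesis by simp
qed

text \<open>Applied to the powers of \<open>p\<close>, the crude bound loses only a factor that
  grows linearly.\<close>

lemma poly_scalar_le_norm:
  fixes p :: "'n::finite ncps"
  assumes p: "ps_polynomial p" and z: "norm z \<le> 1"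
  shows "cmod (poly_scalar p z) \<le> norm (poly_op p creation)"
proof -
  obtain d where d: "\<And>\<alpha>. d \<le> length \<alpha> \<Longrightarrow> p \<alpha> = 0" using ps_polynomial_bound [OF p] by blast
  \<comment> \<open>The \<open>m\<close>-th power has degree at most \<open>m * d\<close>; the
    strict inequality admits \<open>ps_one\<close> for \<open>m = 0\<close>.\<close>
  have pow: "\<exists>q. ps_polynomial q \<and> (\<forall>\<alpha>. m * d < length \<alpha> \<longrightarrow> q \<alpha> = 0) \<and>
      poly_scalar q z = poly_scalar p z ^ m \<and> norm (poly_op q creation) \<le> norm (poly_op p creation) ^ m" for m
  proof (induction m)
    case 0
    show ?case
      by (rule exI [of _ ps_one])
        (simp add: ps_polynomial_one poly_scalar_one poly_op_one norm_blinfun_id_le, simp add: ps_one_def)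
  next
    case (Suc m)
    then obtain q where q: "ps_polynomial q" "\<And>\<alpha>. m * d < length \<alpha> \<Longrightarrow> q \<alpha> = 0"
      "poly_scalar q z = poly_scalar p z ^ m" "norm (poly_op q creation) \<le> norm (poly_op p creation) ^ m"
      by blast
    have "norm (poly_op (ps_mult p q) creation) \<le> norm (poly_op p creation) * norm (poly_op q creation)"
      by (simp add: poly_op_mult clinear_op_creation p q(1) norm_compose_le)
    also have "\<dots> \<le> norm (poly_op p creation) ^ Suc m"
      using q(4) by (simp add: mult_left_mono)
    finally have "norm (poly_op (ps_mult p q) creation) \<le> norm (poly_op p creation) ^ Suc m" .
    moreover have "ps_mult p q \<alpha> = 0" if "Suc m * d < length \<alpha>" for \<alpha>
      by (rule ps_mult_degree [of d _ "m * d"]) (use d q(2) that in auto)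
    moreover have "poly_scalar (ps_mult p q) z = poly_scalar p z ^ Suc m"
      by (simp add: poly_scalar_mult p q(1,3))
    ultimately show ?case
      using ps_polynomial_mult [OF p q(1)] by blast
  qed
  show ?thesis
  proof (rule le_of_power_le_linear)
    fix m
    obtain q where q: "ps_polynomial q" "\<And>\<alpha>. m * d < length \<alpha> \<Longrightarrow> q \<alpha> = 0"
      "poly_scalar q z = poly_scalar p z ^ m" "norm (poly_op q creation) \<le> norm (poly_op p creation) ^ m"
      using pow [of m] by blast
    have "cmod (poly_scalar p z) ^ m \<le> (real (m * d) + 1) * norm (poly_op q creation)"
      using poly_scalar_crude_bound [of "m * d" q, OF q(2) z] by (simp add: q(3) norm_power)
    also have "\<dots> \<le> (real (m * d) + 1) * norm (poly_op p creation) ^ m"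
      using q(4) by (intro mult_left_mono) auto
    finally show "cmod (poly_scalar p z) ^ m \<le> (real m * real d + 1) * norm (poly_op p creation) ^ m"
      by simp
  qed auto
qed

lemma poly_scalar_add:
  "ps_polynomial p \<Longrightarrow> ps_polynomial q \<Longrightarrow>
    poly_scalar (\<lambda>\<alpha>. p \<alpha> + q \<alpha>) z = poly_scalar p z + poly_scalar q z"
  by (simp add: poly_scalar_eq poly_op_add blinfun.add_left)

lemma poly_scalar_scale: "poly_scalar (\<lambda>\<alpha>. c * p \<alpha>) z = c * poly_scalar p z"
  by (simp add: poly_scalar_eq poly_op_scale scaleC_complex_def)

text \<open>Evaluation is contractive on polynomials in S even at boundary points, so it extends
  continuously to the norm closure, and the algebraic laws pass to the limit.\<close>

lemma evaluation_character_exists: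
  fixes z :: "complex ^ 'n::finite"
  assumes z: "norm z \<le> 1"
  shows "\<exists>\<phi>\<in>characters (domain_algebra (creation :: 'n \<Rightarrow> _)). \<forall>j. \<phi> (creation j) = z $ j"
proof -
  define P where "P = {poly_op p (creation :: 'n \<Rightarrow> _) |p. ps_polynomial p}"
  have A: "domain_algebra creation = closure P" by (simp add: domain_algebra_def P_def)
  \<comment> \<open>Reading the polynomial off the vacuum vector makes \<open>u\<close> well defined
    on \<open>P\<close>. For a symbol with infinite support the sum in \<open>poly_scalar\<close>
    defaults to 0 and carries no meaning.\<close>
  define u where "u T = poly_scalar (coord (T (ket []))) z"
    for T :: "'n list ell2 \<Rightarrow>\<^sub>L 'n list ell2"
  have u: "u (poly_op p creation) = poly_scalar p z" if "ps_polynomial p" for p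
    by (simp add: u_def lmul_symbol_id [OF lmul_poly_op_lshift [OF inj_on_id that]])
  have "uniformly_continuous_on P u"
    unfolding uniformly_continuous_on_def
  proof (intro allI impI exI conjI ballI)
    fix e :: real and S T assume e: "0 < e" and "S \<in> P" "T \<in> P" "dist T S < e"
    then obtain p q where p: "ps_polynomial p" "S = poly_op p creation"
      and q: "ps_polynomial q" "T = poly_op q creation"
      unfolding P_def by blast
    define r where "r \<alpha> = q \<alpha> + (-1) * p \<alpha>" for \<alpha>
    have mp: "ps_polynomial (\<lambda>\<alpha>. (-1) * p \<alpha>)" by (rule ps_polynomial_scale [OF p(1)])
    have r: "ps_polynomial r" unfolding r_def by (rule ps_polynomial_add [OF q(1) mp])
    have "poly_op r creation = T - S" "poly_scalar r z = u T - u S"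
      unfolding r_def poly_op_add [OF q(1) mp] poly_scalar_add [OF q(1) mp] poly_op_scale poly_scalar_scale
      by (simp_all add: p q u op_scaleC_minus_one)
    then show "dist (u T) (u S) < e"
      using poly_scalar_le_norm [OF r z] \<open>dist T S < e\<close> by (simp add: dist_norm)
  qed
  then obtain v where v: "uniformly_continuous_on (closure P) v" "\<And>T. T \<in> P \<Longrightarrow> u T = v T"
    using uniformly_continuous_on_extension_on_closure by metis
  have vp: "v (poly_op p creation) = poly_scalar p z" if "ps_polynomial p" for p
  proof -
    have "poly_op p creation \<in> P" using that unfolding P_def by blast
    from v(2) [OF this] show ?thesis by (simp only: u [OF that])
  qed
  have vc: "continuous_on (domain_algebra creation) v"
    unfolding A by (rule uniformly_continuous_imp_continuous [OF v(1)])
  have vlim: "(\<lambda>n. poly_scalar (p n) z) \<longlonglongrightarrow> v T"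
    if "T \<in> domain_algebra creation" "\<And>n. ps_polynomial (p n)" "(\<lambda>n. poly_op (p n) creation) \<longlonglongrightarrow> T"
    for p T
    using continuous_on_tendsto_compose [OF vc that(3,1)] that(2)
    by (simp add: poly_op_in_domain_algebra vp)
  define \<phi> where "\<phi> = restrict v (domain_algebra creation)"
  have add: "v (S + T) = v S + v T" and comp: "v (S o\<^sub>L T) = v S * v T" and sc: "v (op_scaleC c T) = c * v T"
    if S: "S \<in> domain_algebra creation" and T: "T \<in> domain_algebra creation" for S T c
  proof -
    obtain p where p: "\<And>n. ps_polynomial (p n)" "(\<lambda>n. poly_op (p n) creation) \<longlonglongrightarrow> S"
      using domain_algebraE [OF S] by blast
    obtain q where q: "\<And>n. ps_polynomial (q n)" "(\<lambda>n. poly_op (q n) creation) \<longlonglongrightarrow> T"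
      using domain_algebraE [OF T] by blast
    note lims = vlim [OF S p] vlim [OF T q]
    have "(\<lambda>n. poly_scalar (\<lambda>\<alpha>. p n \<alpha> + q n \<alpha>) z) \<longlonglongrightarrow> v (S + T)"
      using tendsto_add [OF p(2) q(2)]
      by (intro vlim) (auto simp: poly_op_add p(1) q(1) intro: domain_algebra_add S T ps_polynomial_add)
    then show "v (S + T) = v S + v T"
      using tendsto_add [OF lims] by (simp add: poly_scalar_add p(1) q(1) LIMSEQ_unique)
    have "(\<lambda>n. poly_scalar (ps_mult (p n) (q n)) z) \<longlonglongrightarrow> v (S o\<^sub>L T)"
      using tendsto_blinfun_compose [OF p(2) q(2)]
      by (intro vlim) (auto simp: poly_op_mult clinear_op_creation p(1) q(1)
          intro: domain_algebra_compose clinear_op_creation S T ps_polynomial_mult)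
    then show "v (S o\<^sub>L T) = v S * v T"
      using tendsto_mult [OF lims] by (simp add: poly_scalar_mult p(1) q(1) LIMSEQ_unique)
    have "(\<lambda>n. poly_scalar (\<lambda>\<alpha>. c * q n \<alpha>) z) \<longlonglongrightarrow> v (op_scaleC c T)"
      using bounded_linear.tendsto [OF bounded_linear_op_scaleC q(2), of c]
      by (intro vlim) (auto simp: poly_op_scale q(1) intro: domain_algebra_scaleC T ps_polynomial_scale)
    then show "v (op_scaleC c T) = c * v T"
      using tendsto_mult_left [OF lims(2), of c] by (simp add: poly_scalar_scale LIMSEQ_unique)
  qed
  have "v id_blinfun = 1"
    using vp [OF ps_polynomial_one] by (simp add: poly_op_one poly_scalar_one)
  then have "\<phi> \<in> characters (domain_algebra creation)"
    unfolding characters_def \<phi>_def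
    by (auto simp: add comp sc domain_algebra_add domain_algebra_scaleC domain_algebra_compose
        clinear_op_creation domain_algebra_id intro!: bexI [of _ id_blinfun])
  moreover have "\<phi> (creation j) = z $ j" for j
    using vp [OF ps_polynomial_var, of j]
    by (simp add: \<phi>_def domain_algebra_generator poly_op_var poly_scalar_eq scal_def scaleC_complex_def)
  ultimately show ?thesis by blast
qed

text \<open>The test operator \<open>T\<close> with conjugated coefficients has \<phi>-value equal
  to the squared norm of \<open>z\<close>, while its operator norm is at most that of
  \<open>z\<close>, because the creation operators form a row contraction.\<close>

lemma norm_character_creation_le:
  fixes z :: "complex ^ 'n::finite"
  assumes \<phi>: "\<phi> \<in> characters (domain_algebra (creation :: 'n \<Rightarrow> _))"
    and z: "\<And>j. \<phi> (creation j) = z $ j"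
  shows "norm z \<le> 1"
proof -
  define T where "T = (\<Sum>j\<in>UNIV. op_scaleC (cnj (z $ j)) (creation j))"
  have TA: "T \<in> domain_algebra creation"
    unfolding T_def by (intro domain_algebra_sum domain_algebra_scaleC domain_algebra_generator)
  have "\<phi> T = (\<Sum>j\<in>UNIV. cnj (z $ j) * z $ j)"
    unfolding T_def
    by (subst character_sum [OF clinear_op_creation \<phi>])
      (auto simp: character_scaleC [OF clinear_op_creation \<phi>] domain_algebra_generator z
        intro: domain_algebra_scaleC domain_algebra_generator)
  also have "\<dots> = of_real (\<Sum>j\<in>UNIV. (cmod (z $ j))\<^sup>2)"
    by (simp add: complex_norm_square mult.commute del: of_real_power)
  also have "\<dots> = of_real ((norm z)\<^sup>2)"
    by (simp add: norm_vec_def L2_set_def sum_nonneg)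
  finally have "(norm z)\<^sup>2 = cmod (\<phi> T)" by (simp add: norm_power)
  also have "\<dots> \<le> norm T" by (rule character_contractive [OF clinear_op_creation \<phi> TA])
  also have "\<dots> \<le> norm z"
  proof (rule norm_blinfun_bound)
    fix h
    have "T h = (\<Sum>j\<in>UNIV. creation j (cnj (z $ j) *\<^sub>C h))"
    proof -
      have "creation j (c *\<^sub>C h) = c *\<^sub>C creation j h" for j :: 'n and c
        using clinear_op_creation unfolding clinear_op_def by blast
      then show ?thesis by (simp only: T_def blinfun.sum_left blinfun_apply_op_scaleC)
    qed
    also have "norm \<dots> \<le> row_norm (creation :: 'n \<Rightarrow> _) * L2_set (\<lambda>j. norm (cnj (z $ j) *\<^sub>C h)) UNIV"
      by (rule norm_row_le)
    also have "\<dots> \<le> 1 * L2_set (\<lambda>j. norm (cnj (z $ j) *\<^sub>C h)) UNIV"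
      by (intro mult_right_mono row_norm_creation) simp
    also have "\<dots> = norm z * norm h"
      by (simp add: norm_scaleC norm_vec_def L2_set_left_distrib)
    finally show "norm (T h) \<le> norm z * norm h" .
  qed simp
  finally show ?thesis
    using norm_ge_zero [of z] by (cases "z = 0") (auto simp: power2_eq_square)
qed

text \<open>\<open>nc_domain\<close> states complex linearity for the point, and its value inherits
  it as a limit. In dimension one this turns the value into a scalar tuple.\<close>

lemma clinear_op_has_value:
  assumes "has_value f X Y" "\<And>i. clinear_op (X i)"
  shows "clinear_op (Y j)"
  unfolding clinear_op_def
proof (intro allI)
  fix c x
  from assms(1) consider "sot_value f X Y" | "rad_value f X Y" by (auto simp: has_value_def)
  then show "Y j (c *\<^sub>C x) = c *\<^sub>C Y j x"
  proof cases
    case 1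
    then have "(\<lambda>k. hom_part (f j) X k (c *\<^sub>C x)) sums Y j (c *\<^sub>C x)"
      "(\<lambda>k. c *\<^sub>C hom_part (f j) X k x) sums (c *\<^sub>C Y j x)"
      by (auto simp: sot_value_def intro: bounded_linear.sums [OF bounded_linear_scaleC])
    then show ?thesis
      using clinear_op_hom_part [of X "f j"] assms(2) by (simp add: clinear_op_def sums_unique2)
  next
    case 2
    then obtain \<delta> where \<delta>: "\<delta> \<in> {0<..<1}"
      "\<And>s. s \<in> {\<delta><..<1} \<Longrightarrow> summable (hom_part (f j) (\<lambda>i. s *\<^sub>R X i))"
      unfolding rad_value_def by auto
    let ?F = "\<lambda>s. ps_eval (f j) (\<lambda>i. s *\<^sub>R X i)"
    have lim: "((\<lambda>s. ?F s h) \<longlongrightarrow> Y j h) (at_left 1)" for h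
      using 2 by (simp add: rad_value_def)
    have ev: "\<forall>\<^sub>F s in at_left 1. s \<in> {\<delta><..<1}"
      using \<delta>(1) by (intro eventually_at_leftI [of \<delta>]) auto
    have "((\<lambda>s. c *\<^sub>C ?F s x)
        \<longlongrightarrow> c *\<^sub>C Y j x) (at_left 1)"
      by (rule bounded_linear.tendsto [OF bounded_linear_scaleC lim])
    moreover have "\<forall>\<^sub>F s in at_left 1. c *\<^sub>C ?F s x
        = ?F s (c *\<^sub>C x)"
      using ev
    proof eventually_elim
      case (elim s)
      have "clinear_op (?F s)"
        unfolding ps_eval_def
        by (rule clinear_op_sums [OF summable_sums [OF \<delta>(2) [OF elim]]])
          (intro clinear_op_hom_part clinear_op_scaleR assms(2))
      then show ?case by (simp add: clinear_op_def)
    qed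
    ultimately have "((\<lambda>s. ?F s (c *\<^sub>C x))
        \<longlongrightarrow> c *\<^sub>C Y j x) (at_left 1)"
      by (rule Lim_transform_eventually)
    then show ?thesis
      using tendsto_unique [OF trivial_limit_at_left_real lim] by blast
  qed
qed

text \<open>Easy case of Abel's theorem: under absolute convergence the radial function is
  continuous up to 1, so the SOT and radial readings of \<open>has_value\<close> give the same
  operator.\<close>

lemma absolutely_convergent_has_value:
  fixes f :: "'n::finite \<Rightarrow> 'n ncps" and X Y :: "'n \<Rightarrow> 'h::chilbert \<Rightarrow>\<^sub>L 'h"
  assumes "has_value f X Y" "\<And>i. clinear_op (X i)"
    and "summable (\<lambda>k. norm (hom_part (f j) X k))"
  shows "hom_part (f j) X sums Y j"
proof -
  define T where "T = ps_eval (f j) X"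
  have T: "hom_part (f j) X sums T"
    unfolding T_def by (rule hom_part_sums_ps_eval [OF assms(3)])
  from assms(1) consider "sot_value f X Y" | "rad_value f X Y" by (auto simp: has_value_def)
  then have "blinfun_apply T h = blinfun_apply (Y j) h" for h
  proof cases
    case 1
    then show ?thesis
      using sums_blinfun_apply [OF T, of h] by (auto simp: sot_value_def intro: sums_unique2)
  next
    case 2
    have "uniform_limit {0..1} (\<lambda>n s. \<Sum>k<n. s ^ k *\<^sub>R hom_part (f j) X k)
        (\<lambda>s. \<Sum>k. s ^ k *\<^sub>R hom_part (f j) X k) sequentially"
      by (rule Weierstrass_m_test [OF _ assms(3)])
        (auto simp: power_le_one intro!: mult_left_le_one_le)
    then have "continuous_on {0..1} (\<lambda>s. \<Sum>k. s ^ k *\<^sub>R hom_part (f j) X k)"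
      by (rule uniform_limit_theorem [OF always_eventually, rotated]) (auto intro!: continuous_intros)
    moreover have "(\<Sum>k. s ^ k *\<^sub>R hom_part (f j) X k) = ps_eval (f j) (\<lambda>i. s *\<^sub>R X i)" for s
      by (simp add: ps_eval_def hom_part_scaleR assms(2))
    ultimately have "continuous_on {0..1} (\<lambda>s. ps_eval (f j) (\<lambda>i. s *\<^sub>R X i))" by simp
    then have "((\<lambda>s. ps_eval (f j) (\<lambda>i. s *\<^sub>R X i)) \<longlongrightarrow> ps_eval (f j) (\<lambda>i. 1 *\<^sub>R X i)) (at 1 within {0..1})"
      unfolding continuous_on_def by (rule bspec) simp
    then have "((\<lambda>s. ps_eval (f j) (\<lambda>i. s *\<^sub>R X i)) \<longlongrightarrow> T) (at_left 1)"
      by (simp add: T_def at_within_Icc_at_left)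
    from tendsto_blinfun_apply [OF this, of h] show ?thesis
      using 2 tendsto_unique [OF trivial_limit_at_left_real] unfolding rad_value_def by blast
  qed
  then have "T = Y j" by (rule blinfun_eqI)
  with T show ?thesis by simp
qed

lemma Hausdorff_character_space: "Hausdorff_space (character_space A)"
  unfolding character_space_def
  by (intro Hausdorff_space_subtopology) (simp add: Hausdorff_space_product_topology)

lemma topspace_character_space: "topspace (character_space A) = characters A"
  by (auto simp: character_space_def topspace_product_topology characters_def PiE_def)

theorem theorem4p12:
  fixes f g :: "'n::finite \<Rightarrow> 'n ncps"
    and M :: "'n \<Rightarrow> 'n list ell2 \<Rightarrow>\<^sub>L 'n list ell2"
  assumes "radial_approximation_property f"
    and "universal_model f g M"
  shows "homeomorphic_map (top_of_set (scalar_domain f g)) (character_space (domain_algebra M))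
           (point_character M) \<and>
         scalar_domain f g homeomorphic cball (0 :: complex ^ 'n) 1"
proof -

  \<comment> \<open>A dilated model and norm convergence\<close>
  obtain \<delta> where \<delta>: "\<delta> \<in> {0<..<1}"
    "\<And>r. r \<in> {\<delta><..1} \<Longrightarrow> model_property (\<lambda>j \<alpha>. complex_of_real r * f j \<alpha>)"
    using assms(1) unfolding radial_approximation_property_def by auto
  \<comment> \<open>Any admissible factor strictly between \<delta> and 1 would do; it has to stay
    below 1 to produce decay.\<close>
  define r where "r = (\<delta> + 1) / 2"
  have r: "0 < r" "r < 1" "r \<in> {\<delta><..1}" using \<delta>(1) by (auto simp: r_def)
  obtain g' M' where um': "universal_model (\<lambda>j \<alpha>. complex_of_real r * f j \<alpha>) g' M'"
    using \<delta>(2) [OF r(3)] unfolding model_property_def by blast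
  have M: "clinear_op (M i)" "lmul id (M i) (g i)" for i
    using assms(2) universal_model_lmul(2) [OF assms(2)] by (auto simp: universal_model_def)
  have M': "clinear_op (M' i)" "lmul id (M' i) (g' i)" for i
    using um' universal_model_lmul(2) [OF um'] by (auto simp: universal_model_def)
  have g': "ell2_seq (g' i)" "complex_of_real r ^ length \<alpha> * g' i \<alpha> = g i \<alpha>" for i \<alpha>
    using universal_model_lmul(1) [OF um'] inverse_of_dilated [OF r(1) _ assms(2) um'] r(2) by auto
  note model = r(1,2) M M' g' universal_model_lmul(3) [OF um']
  have sumS: "hom_part (g i) creation sums M i"
    and absS: "summable (\<lambda>k. norm (hom_part (g i) creation k))" for i
    by (rule inverse_creation_sums [OF model], rule summable_inverse_creation [OF model])
  have nv: "norm_value f M creation"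
    by (rule norm_value_creation [OF model])

  \<comment> \<open>Equality of the two operator algebras\<close>
  define A where "A = domain_algebra M"
  have SA: "creation j \<in> A" for j
  proof -
    consider "\<forall>j. hom_part (f j) M sums creation j"
      | \<delta> where "\<delta> \<in> {0<..<1}" "\<And>s j. s \<in> {\<delta><..<1} \<Longrightarrow> summable (hom_part (f j) (\<lambda>i. s *\<^sub>R M i))"
        "\<And>j. ((\<lambda>s. ps_eval (f j) (\<lambda>i. s *\<^sub>R M i)) \<longlongrightarrow> creation j) (at_left 1)"
      using nv unfolding norm_value_def by auto
    then show ?thesis
    proof cases
      case 1
      then show ?thesis
        unfolding A_def
        by (intro domain_algebra_sums [OF 1 [rule_format]] domain_algebra_hom_part M(1) domain_algebra_generator)
    next
      case 2
      have "ps_eval (f j) (\<lambda>i. s *\<^sub>R M i) \<in> A" if "s \<in> {\<delta><..<1}" for s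
        unfolding A_def ps_eval_def
        by (rule domain_algebra_sums [OF summable_sums [OF 2(2) [OF that]]])
          (intro domain_algebra_hom_part M(1) domain_algebra_scaleR domain_algebra_generator)
      moreover have "\<forall>\<^sub>F s in at_left 1. s \<in> {\<delta><..<1}"
        using 2(1) by (intro eventually_at_leftI [of \<delta>]) auto
      ultimately have "\<forall>\<^sub>F s in at_left 1. ps_eval (f j) (\<lambda>i. s *\<^sub>R M i) \<in> A"
        by (auto elim: eventually_mono)
      then show ?thesis
        unfolding A_def by (rule domain_algebra_limit [OF 2(3) _ trivial_limit_at_left_real])
    qed
  qed
  have MS: "M i \<in> domain_algebra creation" for i
    by (rule domain_algebra_sums [OF sumS])
      (intro domain_algebra_hom_part clinear_op_creation domain_algebra_generator)
  \<comment> \<open>Each tuple lies in the closed algebra generated by the other.\<close>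
  have AS: "A = domain_algebra creation"
    unfolding A_def
    by (intro equalityI domain_algebra_subset clinear_op_creation M(1) MS SA [unfolded A_def])
  have MA: "M i \<in> A" for i using MS AS by simp
  note SM = clinear_op_creation M(1)

  \<comment> \<open>The closed ball and the scalar domain\<close>
  define D where "D = scalar_domain f g"
  have "\<forall>w. \<exists>\<phi>. norm (w :: complex ^ 'n) \<le> 1 \<longrightarrow> \<phi> \<in> characters A \<and> (\<forall>j. \<phi> (creation j) = w $ j)"
    unfolding AS using evaluation_character_exists by blast
  then obtain ev where ev: "\<And>w. norm (w :: complex ^ 'n) \<le> 1 \<Longrightarrow> ev w \<in> characters A"
    "\<And>w j. norm w \<le> 1 \<Longrightarrow> ev w (creation j) = w $ j"
    by metis
  \<comment> \<open>\<open>E w\<close> is g(w), as \<open>value_g\<close> below shows when applied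
    to the character \<open>ev w\<close>.\<close>
  define E where "E w = (\<chi> i. ev w (M i))" for w

  have value_g: "hom_part (g i) (scal w) sums scal (\<chi> i. \<phi> (M i)) i"
    and abs_g: "summable (\<lambda>k. norm (hom_part (g i) (scal w) k))"
    if \<phi>: "\<phi> \<in> characters A" and w: "\<And>j. \<phi> (creation j) = w $ j" for \<phi> w i
  proof -
    have \<phi>S: "\<phi> \<in> characters (domain_algebra creation)" using \<phi> AS by simp
    have h: "hom_part (g i) (scal w) k = op_scaleC (\<phi> (hom_part (g i) creation k)) id_blinfun" for k
      by (rule character_hom_part [OF clinear_op_creation \<phi>S domain_algebra_generator w])
    have hA: "hom_part (g i) creation k \<in> domain_algebra creation" for k
      by (intro domain_algebra_hom_part clinear_op_creation domain_algebra_generator)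
    have "norm (hom_part (g i) (scal w) k) \<le> norm (hom_part (g i) creation k)" for k
      unfolding h using norm_op_scaleC_le [of "\<phi> (hom_part (g i) creation k)" "id_blinfun :: complex \<Rightarrow>\<^sub>L complex"]
        character_contractive [OF clinear_op_creation \<phi>S hA, of k] by simp
    then show "summable (\<lambda>k. norm (hom_part (g i) (scal w) k))"
      by (intro summable_comparison_test' [OF absS [of i]]) auto
    have "norm_value g creation M" using sumS by (simp add: norm_value_def)
    then have "has_value g (scal w) (scal (\<chi> i. \<phi> (M i)))"
      by (rule character_has_value [OF clinear_op_creation \<phi>S]) (simp_all add: domain_algebra_generator MS w)
    then show "hom_part (g i) (scal w) sums scal (\<chi> i. \<phi> (M i)) i"
      by (rule absolutely_convergent_has_value [OF _ clinear_op_scal])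
        (rule \<open>summable (\<lambda>k. norm (hom_part (g i) (scal w) k))\<close>)
  qed
  have D_char: "(\<chi> i. \<phi> (M i)) \<in> D" if \<phi>: "\<phi> \<in> characters A" for \<phi>
  proof -
    define z where "z = (\<chi> i. \<phi> (M i))"
    define w where "w = (\<chi> i. \<phi> (creation i))"
    have \<phi>S: "\<phi> \<in> characters (domain_algebra creation)" using \<phi> AS by simp
    have w1: "norm w \<le> 1" by (rule norm_character_creation_le [OF \<phi>S]) (simp add: w_def)
    have "has_value f (scal z) (scal w)"
      by (rule character_has_value [OF clinear_op_creation \<phi>S nv])
        (simp_all add: domain_algebra_generator MS z_def w_def)
    moreover have "has_value g (scal w) (scal z)"
      using value_g [OF \<phi>, of w]
      by (simp add: has_value_def sot_value_def sums_blinfun_apply z_def w_def)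
    ultimately have "scal z \<in> nc_domain f g"
      using w1 by (auto simp: nc_domain_def clinear_op_scal row_norm_scal)
    then show ?thesis by (simp add: D_def scalar_domain_def z_def scal_def [abs_def])
  qed
  \<comment> \<open>The value \<open>Y\<close> of \<open>f\<close> at \<open>z\<close> may be
    attained in either sense. Complex linearity makes it a point \<open>w\<close> of the ball, and
    absolute convergence of \<open>g\<close> at \<open>w\<close> forces z = g(w) whichever sense is
    meant.\<close>
  have D_E: "\<exists>w. norm w \<le> 1 \<and> E w = z" if z: "z \<in> D" for z
  proof -
    have "scal z \<in> nc_domain f g" using z by (simp add: D_def scalar_domain_def scal_def [abs_def])
    then obtain Y where Y: "has_value f (scal z) Y" "has_value g Y (scal z)" "row_norm Y \<le> 1"
      by (auto simp: nc_domain_def)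
    define w where "w = (\<chi> j. blinfun_apply (Y j) 1)"
    have "Y j = scal w j" for j
      using clinear_op_complex [OF clinear_op_has_value [OF Y(1) clinear_op_scal]]
      by (simp add: scal_def w_def)
    then have Yw: "Y = scal w" by (rule ext)
    have w1: "norm w \<le> 1" using Y(3) by (simp add: Yw row_norm_scal)
    have "scal z i = scal (E w) i" for i
    proof (rule sums_unique2)
      show "hom_part (g i) (scal w) sums scal z i"
        using Y(2) by (intro absolutely_convergent_has_value abs_g [OF ev(1) [OF w1] ev(2) [OF w1]])
          (simp_all add: Yw clinear_op_scal)
      show "hom_part (g i) (scal w) sums scal (E w) i"
        using value_g [OF ev(1) [OF w1] ev(2) [OF w1]] by (simp add: E_def)
    qed
    then have "z $ i = E w $ i" for i
      using op_scaleC_id_apply [of "z $ i" 1] op_scaleC_id_apply [of "E w $ i" 1]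
      by (simp add: scal_def)
    then have "E w = z" by (simp add: vec_eq_iff)
    with w1 show ?thesis by blast
  qed
  have D_eq: "E ` cball 0 1 = D"
    using D_E D_char ev(1) by (fastforce simp: E_def)
  \<comment> \<open>The values at \<open>M\<close> determine a character on the common algebra,
    hence its values at the creation operators, which are the coordinates of the point.\<close>
  have E_inj: "inj_on E (cball 0 1)"
  proof (rule inj_onI)
    fix w w' assume w: "w \<in> cball 0 1" "w' \<in> cball 0 1" "E w = E w'"
    then have n: "norm w \<le> 1" "norm w' \<le> 1" by auto
    have "ev w (M i) = ev w' (M i)" for i using w(3) by (simp add: E_def vec_eq_iff)
    then have "ev w = ev w'"
      by (intro character_unique [OF M(1)]) (use ev(1) n in \<open>simp_all add: A_def\<close>)
    then show "w = w'" using ev(2) [OF n(1)] ev(2) [OF n(2)] by (simp add: vec_eq_iff)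
  qed
  have "continuous_on (cball 0 1) (\<lambda>w. ev w (M i))" for i
    by (rule continuous_on_characters [OF clinear_op_creation _ _ MS])
      (use ev AS in auto)
  then have E_cont: "continuous_on (cball 0 1) E"
    unfolding E_def by (intro continuous_on_vec_lambda)
  have "cball (0 :: complex ^ 'n) 1 homeomorphic D"
    by (rule homeomorphic_compact [OF compact_cball E_cont D_eq E_inj])
  then have hom: "D homeomorphic cball (0 :: complex ^ 'n) 1" by (rule iffD1 [OF homeomorphic_sym])
  have D_compact: "compact D"
    using compact_continuous_image [OF E_cont compact_cball] by (simp add: D_eq)

  \<comment> \<open>Point characters as a homeomorphism\<close>
  have pc: "point_character M z \<in> characters A \<and> (\<forall>i. point_character M z (M i) = z $ i)"
    if z: "z \<in> D" for z
  proof -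
    obtain w where w: "norm w \<le> 1" "E w = z" using D_E [OF z] by blast
    have "ev w \<in> characters (domain_algebra M)" using ev(1) [OF w(1)] by (simp add: A_def)
    moreover have "ev w (M i) = z $ i" for i using w(2) by (auto simp: E_def)
    ultimately have "point_character M z = ev w" "\<forall>i. ev w (M i) = z $ i"
      using point_character_eq [of M "ev w" z, OF M(1)] by auto
    then show ?thesis using ev(1) [OF w(1)] by simp
  qed
  have "homeomorphic_map (top_of_set D) (character_space A) (point_character M)"
  proof (rule continuous_imp_homeomorphic_map)
    show "compact_space (top_of_set D)"
      using D_compact by (simp add: compact_space_subtopology compactin_euclidean_iff)
    show "Hausdorff_space (character_space A)" by (rule Hausdorff_character_space)
    have "continuous_on D (\<lambda>z. point_character M z T)" if "T \<in> A" for T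
      by (rule continuous_on_characters [OF M(1)]) (use pc that in \<open>auto simp: A_def\<close>)
    then show "continuous_map (top_of_set D) (character_space A) (point_character M)"
      unfolding character_space_def continuous_map_in_subtopology continuous_map_componentwise
      using pc by (auto simp: characters_def)
    show "inj_on (point_character M) (topspace (top_of_set D))"
    proof (rule inj_onI)
      fix z z' assume "z \<in> topspace (top_of_set D)" "z' \<in> topspace (top_of_set D)"
        "point_character M z = point_character M z'"
      then show "z = z'" using pc [of z] pc [of z'] by (simp add: vec_eq_iff)
    qed
    show "point_character M ` topspace (top_of_set D) = topspace (character_space A)"
    proof
      show "point_character M ` topspace (top_of_set D) \<subseteq> topspace (character_space A)"
        using pc by (auto simp: topspace_character_space)
      show "topspace (character_space A) \<subseteq> point_character M ` topspace (top_of_set D)"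
      proof
        fix \<phi> assume "\<phi> \<in> topspace (character_space A)"
        then have \<phi>: "\<phi> \<in> characters A" by (simp add: topspace_character_space)
        have "point_character M (\<chi> i. \<phi> (M i)) = \<phi>"
          using \<phi> by (intro point_character_eq [OF M(1)]) (simp_all add: A_def)
        then show "\<phi> \<in> point_character M ` topspace (top_of_set D)"
          using D_char [OF \<phi>] by (intro image_eqI [of _ _ "\<chi> i. \<phi> (M i)"]) simp_all
      qed
    qed
  qed
  with hom show ?thesis by (simp add: D_def A_def)
qed

end
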